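(* Let $d\ge2$ and $a>0$. Let $E\subset\mathbb R^d$ be a closed set that has a unique diameter of length $2a$ between the poles $(-a,\mathbf 0)$ and $(a,\mathbf 0)$, has smooth pole caps with boundary functions $s^\ell,s^r$, and satisfies the curvature condition for some $\eta\in(0,1)$ (all as defined in the context). Let $f:E\to[0,\infty)$ satisfy $\int_Ef(z)\,\mathrm dz=1$, be continuous at both poles, with $p_\ell:=f(-a,\mathbf 0)>0$ and $p_r:=f(a,\mathbf 0)>0$. Let $Z_1,Z_2,\ldots$ be i.i.d. with density $f$, for each $n$ let $N_n$ be Poisson with mean $n$ and independent of $(Z_i)_{i\ge 1}$, and for $k\in\mathbb N$ let $D_n^{(1)}\ge\ldots\ge D_n^{(k)}$ be the $k$ largest distances, in descending order, among the values $|Z_i-Z_j|$, $1\le i<j\le N_n$. Then, for each $k\in\mathbb N$, as $n\to\infty$, $$n^{\frac2{d+1}}\big(2a-D_n^{(1)},\ldots,2a-D_n^{(k)}\big)\overset{\mathcal D}{\longrightarrow}\big(t_1(\xi),\ldots,t_k(\xi)\big),$$ where $\xi:=\sum_{i,j\ge1}\varepsilon_{G(\mathcal X_i,\mathcal Y_j)}$, $G(x,y):=x_1+y_1-\frac1{4a}|\widetilde x-\widetilde y|^2$, and $\{\mathcal X_i,i\ge1\}$, $\{\mathcal Y_j,j\ge1\}$ are independent Poisson processes with intensity measures $p_\ell\cdot m_d|_{P(H_\ell)}$ and $p_r\cdot m_d|_{P(H_r)}$, respectively.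
   Context: Notation: $|\cdot|$ is the Euclidean norm, $m_d$ Lebesgue measure on $\mathbb R^d$, $\mu|_A(B):=\mu(A\cap B)$, $\varepsilon_t$ the unit point mass at $t$, $\widetilde z:=(z_2,\ldots,z_d)$ for $z\in\mathbb R^d$. For a point process $\xi$ on $[0,\infty)$ and $i\in\mathbb N$, $t_i(\xi):=\inf\{t:\xi([0,t])\ge i\}$. If fewer than $k$ pairs are available, the $D_n^{(i)}$ may be defined arbitrarily (this has probability tending to $0$). Unique diameter: $E\subset\mathbb R^d$ is closed, $0<2a=\mathrm{diam}(E)<\infty$, $(-a,\mathbf 0),(a,\mathbf 0)\in E$, and $|x-y|<2a$ for each $(x,y)\in(E\setminus\{(-a,\mathbf 0),(a,\mathbf 0)\})\times E$. Smooth pole caps: there are constants $\delta_\ell,\delta_r\in(0,a]$, open neighborhoods $O_\ell,O_r\subset\mathbb R^{d-1}$ of $\mathbf 0$ and twice continuously differentiable functions $s^\ell:O_\ell\to[0,\infty)$, $s^r:O_r\to[0,\infty)$ with $E\cap\{z_1<-a+\delta_\ell\}=\{(z_1,\widetilde z):-a+s^\ell(\widetilde z)\le z_1<-a+\delta_\ell,\ \widetilde z\in O_\ell\}$ and $E\cap\{a-\delta_r<z_1\}=\{(z_1,\widetilde z):a-\delta_r<z_1\le a-s^r(\widetilde z),\ \widetilde z\in O_r\}$. For $i\in\{\ell,r\}$, $H_i$ is the Hessian of $s^i$ at $\mathbf 0$ (symmetric positive definite in this setting), $\kappa_2^i\le\ldots\le\kappa_d^i$ its eigenvalues, $D_i:=\mathrm{diag}(\kappa_2^i,\ldots,\kappa_d^i)$,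 and $U_i$ an orthogonal matrix whose columns are corresponding orthonormal eigenvectors, so $U_i^\top H_iU_i=D_i$. Curvature condition for $\eta\in(0,1)$: the matrix $$A(\eta):=\begin{pmatrix} 2a\eta D_\ell-\mathrm I_{d-1} & U_\ell^\top U_r \\ U_r^\top U_\ell & 2a\eta D_r-\mathrm I_{d-1} \end{pmatrix}$$ is positive semi-definite. For a $(d-1)\times(d-1)$ matrix $H$: $P(H):=\{(z_1,\widetilde z)\in\mathbb R^d:\frac12\widetilde z^\top H\widetilde z\le z_1\}$. *)

theory Defs
  imports "HOL-Probability.Probability"
begin

text \<open>
  The space R^d with \<open>d \<ge> 2\<close> is rendered as \<open>real \<times> real ^ 'm\<close>, a point being split into its first
  coordinate \<open>fst z\<close> and the remaining \<open>d - 1 = CARD('m)\<close> coordinates \<open>snd z\<close>. The norm of this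
  product type is the Euclidean norm, \<open>lborel\<close> is Lebesgue measure and \<open>DIM(real \<times> real ^ 'm)\<close>
  is \<open>d\<close>.
\<close>

definition left_pole :: "real \<Rightarrow> real \<times> (real ^ 'm)" where
  "left_pole a = (- a, 0)"

definition right_pole :: "real \<Rightarrow> real \<times> (real ^ 'm)" where
  "right_pole a = (a, 0)"

text \<open>Boundedness is explicit because \<^const>\<open>diameter\<close> is unspecified on unbounded sets.\<close>

definition unique_diameter :: "real \<Rightarrow> (real \<times> (real ^ 'm)) set \<Rightarrow> bool" where
  "unique_diameter a E \<longleftrightarrow>
     closed E \<and> bounded E \<and> 0 < 2 * a \<and> diameter E = 2 * a \<and>
     left_pole a \<in> E \<and> right_pole a \<in> E \<and>
     (\<forall>x \<in> E - {left_pole a, right_pole a}. \<forall>y \<in> E. dist x y < 2 * a)"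

definition gradient :: "(real ^ 'm \<Rightarrow> real) \<Rightarrow> real ^ 'm \<Rightarrow> real ^ 'm" where
  "gradient s x = (\<chi> i. frechet_derivative s (at x) (axis i 1))"

definition hessian :: "(real ^ 'm \<Rightarrow> real) \<Rightarrow> real ^ 'm \<Rightarrow> real ^ 'm ^ 'm" where
  "hessian s x = matrix (frechet_derivative (gradient s) (at x))"

definition twice_continuously_differentiable_on ::
    "(real ^ 'm \<Rightarrow> real) \<Rightarrow> (real ^ 'm) set \<Rightarrow> bool" where
  "twice_continuously_differentiable_on s U \<longleftrightarrow>
     open U \<and> s differentiable_on U \<and> gradient s differentiable_on U \<and>
     continuous_on U (hessian s)"

text \<open>The boundary functions matter on the neighborhoods \<open>Ol\<close> and \<open>Or\<close> of the origin only; the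
  values of the total functions \<open>sl\<close> and \<open>sr\<close> elsewhere are irrelevant.\<close>

definition smooth_pole_caps ::
    "real \<Rightarrow> (real \<times> (real ^ 'm)) set \<Rightarrow> (real ^ 'm \<Rightarrow> real) \<Rightarrow> (real ^ 'm \<Rightarrow> real) \<Rightarrow> bool" where
  "smooth_pole_caps a E sl sr \<longleftrightarrow>
     (\<exists>\<delta>l \<delta>r Ol Or.
        0 < \<delta>l \<and> \<delta>l \<le> a \<and> 0 < \<delta>r \<and> \<delta>r \<le> a \<and>
        open Ol \<and> 0 \<in> Ol \<and> open Or \<and> 0 \<in> Or \<and>
        (\<forall>u \<in> Ol. 0 \<le> sl u) \<and> (\<forall>u \<in> Or. 0 \<le> sr u) \<and>
        twice_continuously_differentiable_on sl Ol \<and>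
        twice_continuously_differentiable_on sr Or \<and>
        E \<inter> {z. fst z < - a + \<delta>l} =
          {z. - a + sl (snd z) \<le> fst z \<and> fst z < - a + \<delta>l \<and> snd z \<in> Ol} \<and>
        E \<inter> {z. a - \<delta>r < fst z} =
          {z. a - \<delta>r < fst z \<and> fst z \<le> a - sr (snd z) \<and> snd z \<in> Or})"

text \<open>The index type carries a linear order, so that eigenvalues can be listed in increasing order.\<close>

definition ordered_eigensystem ::
    "real ^ ('m :: {finite, linorder}) ^ ('m :: {finite, linorder}) \<Rightarrow>
     real ^ ('m :: {finite, linorder}) \<Rightarrow>
     real ^ ('m :: {finite, linorder}) ^ ('m :: {finite, linorder}) \<Rightarrow> bool" where
  "ordered_eigensystem H \<kappa> U \<longleftrightarrow>
     mono (\<lambda>i. \<kappa> $ i) \<and> orthogonal_matrix U \<and>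
     (\<forall>i. H *v column i U = \<kappa> $ i *\<^sub>R column i U)"

definition diagonal :: "real ^ 'm \<Rightarrow> real ^ 'm ^ 'm" where
  "diagonal \<kappa> = (\<chi> i j. if i = j then \<kappa> $ i else 0)"

definition block_matrix ::
    "real ^ 'm ^ 'm \<Rightarrow> real ^ 'm ^ 'm \<Rightarrow> real ^ 'm ^ 'm \<Rightarrow> real ^ 'm ^ 'm \<Rightarrow>
     real ^ ('m + 'm) ^ ('m + 'm)" where
  "block_matrix A B C D =
     (\<chi> i j. case i of
        Inl p \<Rightarrow> (case j of Inl q \<Rightarrow> A $ p $ q | Inr q \<Rightarrow> B $ p $ q)
      | Inr p \<Rightarrow> (case j of Inl q \<Rightarrow> C $ p $ q | Inr q \<Rightarrow> D $ p $ q))"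

definition positive_semidefinite :: "real ^ 'n ^ 'n \<Rightarrow> bool" where
  "positive_semidefinite A \<longleftrightarrow> transpose A = A \<and> (\<forall>v. 0 \<le> v \<bullet> (A *v v))"

definition curvature_matrix ::
    "real \<Rightarrow> real \<Rightarrow> real ^ 'm \<Rightarrow> real ^ 'm ^ 'm \<Rightarrow> real ^ 'm \<Rightarrow> real ^ 'm ^ 'm \<Rightarrow>
     real ^ ('m + 'm) ^ ('m + 'm)" where
  "curvature_matrix a \<eta> \<kappa>l Ul \<kappa>r Ur =
     block_matrix
       ((2 * a * \<eta>) *\<^sub>R diagonal \<kappa>l - mat 1)  (transpose Ul ** Ur)
       (transpose Ur ** Ul)  ((2 * a * \<eta>) *\<^sub>R diagonal \<kappa>r - mat 1)"

definition paraboloid :: "real ^ 'm ^ 'm \<Rightarrow> (real \<times> (real ^ 'm)) set" where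
  "paraboloid H = {z. 1 / 2 * (snd z \<bullet> (H *v snd z)) \<le> fst z}"

text \<open>Distances of the first \<open>N\<close> points, counted with multiplicity; points are numbered from 0.\<close>

definition pair_distances :: "(nat \<Rightarrow> 'a :: metric_space) \<Rightarrow> nat \<Rightarrow> real multiset" where
  "pair_distances z N =
     image_mset (\<lambda>(i, j). dist (z i) (z j)) (mset_set {(i, j). i < j \<and> j < N})"

text \<open>Meaningful for \<open>1 \<le> i \<le> size A\<close>.\<close>

definition ith_largest :: "nat \<Rightarrow> real multiset \<Rightarrow> real" where
  "ith_largest i A = rev (sorted_list_of_multiset A) ! (i - 1)"

text \<open>A point configuration is given by an indexed family of points \<open>x\<close>; \<open>num_points x\<close> is the
  counting measure \<open>\<Sum>i. \<epsilon>\<^bsub>x i\<^esub>\<close>, multiplicities included.\<close>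

definition num_points :: "('i \<Rightarrow> 'a) \<Rightarrow> 'a set \<Rightarrow> enat" where
  "num_points x B = (if finite {i. x i \<in> B} then enat (card {i. x i \<in> B}) else \<infinity>)"

text \<open>For \<open>i \<ge> 1\<close> the set of times is bounded below by 0; it is nonempty as soon as at least \<open>i\<close> of the
  points are nonnegative. On an empty set \<^const>\<open>Inf\<close> is unspecified, where one would read \<open>\<infinity>\<close>.\<close>

definition arrival_time :: "nat \<Rightarrow> ('i \<Rightarrow> real) \<Rightarrow> real" where
  "arrival_time i x = Inf {t. enat i \<le> num_points x {0..t}}"

text \<open>The mean-zero case is included in the formula for finite intensity.\<close>

definition poisson_process :: "'w measure \<Rightarrow> 'a measure \<Rightarrow> (nat \<Rightarrow> 'w \<Rightarrow> 'a) \<Rightarrow> bool" where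
  "poisson_process M \<mu> X \<longleftrightarrow>
     (\<forall>i. X i \<in> measurable M \<mu>) \<and>
     (\<forall>B \<in> sets \<mu>. emeasure \<mu> B < \<infinity> \<longrightarrow>
        (\<forall>m. measure M {\<omega> \<in> space M. num_points (\<lambda>i. X i \<omega>) B = enat m} =
              measure \<mu> B ^ m / fact m * exp (- measure \<mu> B))) \<and>
     (\<forall>B \<in> sets \<mu>. emeasure \<mu> B = \<infinity> \<longrightarrow> (AE \<omega> in M. num_points (\<lambda>i. X i \<omega>) B = \<infinity>)) \<and>
     (\<forall>(J :: nat set) B. finite J \<longrightarrow> B ` J \<subseteq> sets \<mu> \<longrightarrow> disjoint_family_on B J \<longrightarrow>
        prob_space.indep_vars M (\<lambda>_. count_space UNIV) (\<lambda>j \<omega>. num_points (\<lambda>i. X i \<omega>) (B j)) J)"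

text \<open>Unlike \<^const>\<open>prob_space.indep_var\<close>, the following allows values in different types.\<close>

definition independent_rvs ::
    "'w measure \<Rightarrow> 'a measure \<Rightarrow> ('w \<Rightarrow> 'a) \<Rightarrow> 'b measure \<Rightarrow> ('w \<Rightarrow> 'b) \<Rightarrow> bool" where
  "independent_rvs M S X T Y \<longleftrightarrow>
     X \<in> measurable M S \<and> Y \<in> measurable M T \<and>
     prob_space.indep_set M {X -` A \<inter> space M | A. A \<in> sets S} {Y -` B \<inter> space M | B. B \<in> sets T}"

text \<open>Independence as random counting measures; the enumerations of the points need not be
  independent.\<close>

definition independent_point_processes ::
    "'w measure \<Rightarrow> (nat \<Rightarrow> 'w \<Rightarrow> 'a :: topological_space) \<Rightarrow> (nat \<Rightarrow> 'w \<Rightarrow> 'a) \<Rightarrow> bool" where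
  "independent_point_processes M X Y \<longleftrightarrow>
     independent_rvs M
       (PiM (sets borel) (\<lambda>_. count_space UNIV)) (\<lambda>\<omega>. \<lambda>B \<in> sets borel. num_points (\<lambda>i. X i \<omega>) B)
       (PiM (sets borel) (\<lambda>_. count_space UNIV)) (\<lambda>\<omega>. \<lambda>B \<in> sets borel. num_points (\<lambda>i. Y i \<omega>) B)"

definition gap :: "real \<Rightarrow> real \<times> (real ^ 'm) \<Rightarrow> real \<times> (real ^ 'm) \<Rightarrow> real" where
  "gap a x y = fst x + fst y - 1 / (4 * a) * (norm (snd x - snd y))\<^sup>2"

text \<open>The \<open>k\<close>-tuple \<open>(x 1, \<dots>, x k)\<close> as a point of \<^term>\<open>Euclidean_space k\<close>, whose coordinates are
  numbered from 0 and whose points vanish at all indices \<open>\<ge> k\<close>.\<close>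

definition tuple :: "nat \<Rightarrow> (nat \<Rightarrow> real) \<Rightarrow> nat \<Rightarrow> real" where
  "tuple k x = (\<lambda>i. if i < k then x (Suc i) else 0)"

definition random_element :: "'b topology \<Rightarrow> 'w measure \<Rightarrow> ('w \<Rightarrow> 'b) \<Rightarrow> bool" where
  "random_element T M X \<longleftrightarrow>
     (\<forall>\<omega> \<in> space M. X \<omega> \<in> topspace T) \<and> (\<forall>V. openin T V \<longrightarrow> X -` V \<inter> space M \<in> sets M)"

definition converges_in_distribution ::
    "'b topology \<Rightarrow> 'w measure \<Rightarrow> (nat \<Rightarrow> 'w \<Rightarrow> 'b) \<Rightarrow> 'v measure \<Rightarrow> ('v \<Rightarrow> 'b) \<Rightarrow> bool" where
  "converges_in_distribution T M X M' Y \<longleftrightarrow>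
     (\<forall>n. random_element T M (X n)) \<and> random_element T M' Y \<and>
     (\<forall>g. continuous_map T euclideanreal g \<and> bounded (g ` topspace T) \<longrightarrow>
        (\<lambda>n. \<integral>\<omega>. g (X n \<omega>) \<partial>M) \<longlonglongrightarrow> (\<integral>\<omega>. g (Y \<omega>) \<partial>M'))"

end

theory Submission
  imports Defs
begin

text \<open>
  Only the numbers of points in small cells enter the argument. Put \<open>h = n powr (-1/(d+1))\<close> and blow up
  the first coordinate at each pole by \<open>1/h\<^sup>2\<close> and the others by \<open>1/h\<close>; this multiplies volumes by \<open>n\<close>.
  Because \<open>\<eta> < 1\<close>, the curvature condition confines, for large \<open>n\<close> and without any randomness, all pairs
  with \<open>(2 a - dist x y) / h\<^sup>2 \<le> T\<close> to a bounded window in blown-up coordinates, where this scaled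
  gap converges uniformly to \<^const>\<open>gap\<close>; the pairs of the limit with \<^const>\<open>gap\<close> at most \<open>T\<close> are confined in the
  same way. Cut the window into finitely many cells of small diameter. The cell counts of the Poissonized
  sample are independent Poisson variables whose means converge to those of the limit, and on the event
  that the counts take prescribed values both \<open>k\<close>-tuples are within \<open>\<delta>\<close> of one and the same vector. Since
  finitely many values of the counts carry almost all the mass, the expectations of a bounded continuous
  function converge.
\<close>

section \<open>Order statistics and finite partitions\<close>

text \<open>Independence of the two limiting processes is assumed for their counting measures, not
  for the enumerations of their points; this is why every probabilistic statement concerns numbers
  of points in Borel cells. The vector \<open>cell_arrival\<close> is a function of these numbers
  alone, so it can serve as common reference for two systems that live on different probability
  spaces. The scaling is forced by the geometry: a gap of order \<open>h^2\<close> allows heights of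
  order \<open>h^2\<close> and lateral displacements of order \<open>h\<close>, a region of volume
  of order \<open>h^(d+1)\<close>, which has to contain boundedly many of about \<open>n\<close>
  points. The margin \<open>1 - \<eta>\<close> pays for two errors in the confinement of pairs: the
  Taylor remainder of the boundary functions and the quadratic term in the expansion of the
  distance. The quantities are fixed in the order \<epsilon>, time horizon \<open>T\<close>, window
  radius \<open>K\<close>, tolerance \<delta>, cells, bound \<open>L\<close> on the counts, and last
  the threshold for \<open>n\<close>; tightness of the sample is then inherited from the
  limit.\<close>

lemma Inf_close_if_shifted:
  fixes A B :: "real set"
  assumes A: "bdd_below A" and "0 \<le> \<delta>"
    and t0: "t0 \<in> B" "t0 \<le> b"
    and BA: "\<And>t. t \<in> B \<Longrightarrow> t \<le> b \<Longrightarrow> t + \<delta> \<in> A"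
    and AB: "\<And>t. t \<in> A \<Longrightarrow> t \<le> b + \<delta> \<Longrightarrow> t + \<delta> \<in> B"
  shows "\<bar>Inf A - Inf B\<bar> \<le> \<delta>" and "Inf A \<le> b + \<delta>"
proof -
  have *: "Inf A - \<delta> \<le> t" if "t \<in> B" "t \<le> b" for t
    using cInf_lower[OF BA[OF that] A] by simp
  \<comment> \<open>Members of \<open>B\<close> beyond \<open>b\<close> are larger than
    \<open>t0\<close>, which already satisfies the bound. So a comparison of the two sets up to
    \<open>b\<close> controls the infima.\<close>
  have "Inf A - \<delta> \<le> t" if "t \<in> B" for t
    using *[OF that] *[OF t0] t0 by linarith
  then have B: "bdd_below B" and 1: "Inf A - \<delta> \<le> Inf B"
    using t0 by (auto intro!: bdd_belowI cInf_greatest)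
  have "Inf B - \<delta> \<le> t" if "t \<in> A" for t
  proof (cases "t \<le> b + \<delta>")
    case True
    then show ?thesis using cInf_lower[OF AB[OF that True] B] by simp
  next
    case False
    then show ?thesis using cInf_lower[OF t0(1) B] t0(2) assms(2) by linarith
  qed
  then have "Inf B - \<delta> \<le> Inf A"
    using BA[OF t0] by (intro cInf_greatest) auto
  with 1 show "\<bar>Inf A - Inf B\<bar> \<le> \<delta>" by linarith
  show "Inf A \<le> b + \<delta>" using *[OF t0] t0 by linarith
qed

text \<open>Turns order statistics into counts. In the descending list the entries
  \<open>>= s\<close> form an initial segment; list indices start at 0, so it has length at least
  \<open>i\<close> exactly if it contains index \<open>i - 1\<close>.\<close>

lemma le_ith_largest_iff:
  assumes "1 \<le> i" "i \<le> size A"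
  shows "s \<le> ith_largest i A \<longleftrightarrow> i \<le> size {#x \<in># A. s \<le> x#}"
proof -
  define xs where "xs = rev (sorted_list_of_multiset A)"
  have A: "mset xs = A" by (simp add: xs_def)
  have len: "i \<le> length xs" using assms A by (metis size_mset)
  have "sorted (sorted_list_of_multiset A)" by (rule sorted_sorted_list_of_multiset)
  then have desc: "sorted_wrt (\<ge>) xs"
    by (simp add: xs_def sorted_wrt_rev)
  have dec: "xs ! q \<le> xs ! p" if "p \<le> q" "q < length xs" for p q
    using that desc by (cases "p = q") (auto simp: sorted_wrt_iff_nth_less)
  have sz: "size {#x \<in># A. s \<le> x#} = card {p. p < length xs \<and> s \<le> xs ! p}"
    by (simp flip: A mset_filter add: length_filter_conv_card)
  have fin: "finite {p. p < length xs \<and> s \<le> xs ! p}" by simp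
  show ?thesis
  proof
    assume "s \<le> ith_largest i A"
    then have "s \<le> xs ! (i - 1)" by (simp add: ith_largest_def xs_def)
    then have "{..<i} \<subseteq> {p. p < length xs \<and> s \<le> xs ! p}"
      using len dec[of _ "i - 1"] assms(1) by (auto intro: order_trans)
    from card_mono[OF fin this] show "i \<le> size {#x \<in># A. s \<le> x#}" by (simp add: sz)
  next
    assume *: "i \<le> size {#x \<in># A. s \<le> x#}"
    show "s \<le> ith_largest i A"
    proof (rule ccontr)
      assume "\<not> s \<le> ith_largest i A"
      then have lt: "xs ! (i - 1) < s" by (simp add: ith_largest_def xs_def)
      have "p < i - 1" if "p < length xs" "s \<le> xs ! p" for p
        using dec[of "i - 1" p] that lt by (meson not_le order.strict_trans1 order_trans)
      then have "{p. p < length xs \<and> s \<le> xs ! p} \<subseteq> {..<i - 1}" by auto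
      from card_mono[OF _ this] * assms(1) show False by (simp add: sz)
    qed
  qed
qed

lemma size_filter_pair_distances:
  "size {#x \<in># pair_distances z N. s \<le> x#} =
     card {(p, q). p < q \<and> q < N \<and> s \<le> dist (z p) (z q)}"
proof -
  have fin: "finite {(p, q). p < q \<and> q < (N :: nat)}"
    by (rule finite_subset[of _ "{..<N} \<times> {..<N}"]) auto
  have "{#x \<in># pair_distances z N. s \<le> x#} =
     image_mset (\<lambda>(i, j). dist (z i) (z j)) {#x \<in># mset_set {(i, j). i < j \<and> j < N}. s \<le> (\<lambda>(i, j). dist (z i) (z j)) x#}"
    unfolding pair_distances_def by (simp add: filter_mset_image_mset)
  also have "size \<dots> = card {x \<in> {(i, j). i < j \<and> j < N}. s \<le> (\<lambda>(i, j). dist (z i) (z j)) x}"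
    using fin by (simp add: filter_mset_mset_set)
  also have "{x \<in> {(i, j). i < j \<and> j < N}. s \<le> (\<lambda>(i, j). dist (z i) (z j)) x} =
     {(p, q). p < q \<and> q < N \<and> s \<le> dist (z p) (z q)}" by auto
  finally show ?thesis .
qed

text \<open>A finite cover by balls is made disjoint by removing from each ball all earlier ones.
  The center \<open>ctr j\<close> may lie outside its cell, which can even be empty, but it lies in
  \<open>W\<close>, where \<open>gap\<close> will be uniformly continuous.\<close>

lemma compact_cells:
  fixes W :: "'a :: metric_space set"
  assumes "compact W" "0 < \<rho>"
  obtains m :: nat and B :: "nat \<Rightarrow> 'a set" and ctr :: "nat \<Rightarrow> 'a"
  where "\<And>j. j < m \<Longrightarrow> B j \<in> sets borel" "(\<Union>j<m. B j) = W" "disjoint_family_on B {..<m}"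
    "\<And>j x. j < m \<Longrightarrow> x \<in> B j \<Longrightarrow> dist (ctr j) x < \<rho>"
    "\<And>j. j < m \<Longrightarrow> ctr j \<in> W"
proof -
  obtain F where F: "finite F" "F \<subseteq> W" "W \<subseteq> (\<Union>x\<in>F. ball x \<rho>)"
    using compactE_image[OF assms(1), of W "\<lambda>x. ball x \<rho>"] assms(2)
    by (metis UN_I centre_in_ball open_ball subsetI)
  obtain m and ctr :: "nat \<Rightarrow> 'a" where ctr: "F = ctr ` {..<m}"
    using F(1) by (metis finite_imp_nat_seg_image_inj_on lessThan_def)
  define B where "B j = W \<inter> (ball (ctr j) \<rho> - (\<Union>i<j. ball (ctr i) \<rho>))" for j
  show thesis
  proof
    show "B j \<in> sets borel" if "j < m" for j
      unfolding B_def using compact_imp_closed[OF assms(1)] by (intro sets.Int sets.Diff sets.finite_UN) auto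
    show "(\<Union>j<m. B j) = W"
    proof
      show "W \<subseteq> (\<Union>j<m. B j)"
      proof
        fix x assume x: "x \<in> W"
        then obtain j where j: "j < m" "x \<in> ball (ctr j) \<rho>"
          using F(3) ctr by auto
        define i where "i = (LEAST i. x \<in> ball (ctr i) \<rho>)"
        have "x \<in> ball (ctr i) \<rho>" "i \<le> j"
          unfolding i_def using j(2) by (auto intro: LeastI Least_le simp del: mem_ball)
        moreover have "x \<notin> ball (ctr i') \<rho>" if "i' < i" for i'
          using not_less_Least[OF that[unfolded i_def]] .
        ultimately show "x \<in> (\<Union>j<m. B j)"
          using x j(1) by (auto simp: B_def intro!: bexI[of _ i])
      qed
    qed (auto simp: B_def)
    have "B i \<inter> B j = {}" if "i < j" for i j
      using that by (auto simp: B_def)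
    then show "disjoint_family_on B {..<m}"
      unfolding disjoint_family_on_def by (metis Int_commute nat_neq_iff)
    show "dist (ctr j) x < \<rho>" if "j < m" "x \<in> B j" for j x
      using that by (auto simp: B_def)
    show "ctr j \<in> W" if "j < m" for j using that F(2) ctr by auto
  qed
qed

section \<open>Poissonization\<close>

text \<open>The multinomial probability divided by \<open>m!\<close>: the factor \<open>1 - sum \<nu> J\<close> accounts for the trials
  that hit no cell, and the division turns the recursion in \<open>m\<close> into the polynomial identity below.\<close>

definition multinomial_weight :: "'j set \<Rightarrow> ('j \<Rightarrow> real) \<Rightarrow> nat \<Rightarrow> ('j \<Rightarrow> nat) \<Rightarrow> real" where
  "multinomial_weight J \<nu> m c =
     (\<Prod>j\<in>J. \<nu> j ^ c j / fact (c j)) *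
     (if sum c J \<le> m then (1 - sum \<nu> J) ^ (m - sum c J) / fact (m - sum c J) else 0)"

text \<open>Splits according to the outcome of one further trial: no cell, or cell \<open>j\<close>.
  Relative to the new weight, the term of cell \<open>j\<close> carries the factor
  \<open>c j\<close> and the miss term the factor \<open>Suc m - sum c J\<close>; together they give
  \<open>Suc m\<close>.\<close>

lemma multinomial_weight_Suc:
  assumes "finite J"
  shows "real (Suc m) * multinomial_weight J \<nu> (Suc m) c =
     (1 - sum \<nu> J) * multinomial_weight J \<nu> m c +
     (\<Sum>j\<in>J. if 0 < c j then \<nu> j * multinomial_weight J \<nu> m (c(j := c j - 1)) else 0)"
proof -
  let ?w = "multinomial_weight J \<nu>"
  define s where "s = sum c J"
  define p where "p = 1 - sum \<nu> J"
  define P where "P = (\<Prod>j\<in>J. \<nu> j ^ c j / fact (c j))"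
  have w: "?w m c = P * (if s \<le> m then p ^ (m - s) / fact (m - s) else 0)" for m
    by (simp add: multinomial_weight_def s_def p_def P_def)
  have 1: "(if 0 < c j then \<nu> j * ?w m (c(j := c j - 1)) else 0) = real (c j) * ?w (Suc m) c"
    if j: "j \<in> J" for j
  proof (cases "c j")
    case (Suc l)
    have s': "s = Suc (sum (c(j := l)) J)"
    proof -
      have "sum (c(j := l)) (J - {j}) = sum c (J - {j})" by (rule sum.cong) auto
      then show ?thesis
        using sum.remove[OF assms j, of c] sum.remove[OF assms j, of "c(j := l)"] Suc by (simp add: s_def)
    qed
    define Y where "Y = (\<Prod>i\<in>J - {j}. \<nu> i ^ c i / fact (c i))"
    define X where "X = (\<Prod>i\<in>J. \<nu> i ^ (c(j := l)) i / fact ((c(j := l)) i))"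
    have "P = \<nu> j ^ Suc l / fact (Suc l) * Y"
      using j assms Suc by (simp add: P_def Y_def prod.remove[of J j])
    moreover have "X = \<nu> j ^ l / fact l * Y"
      unfolding X_def Y_def using j assms by (subst prod.remove[of J j]) (auto intro!: prod.cong)
    ultimately have "P = \<nu> j * X / real (Suc l)"
      by (simp add: ac_simps del: of_nat_Suc)
    then have "\<nu> j * X = real (Suc l) * P"
      by (simp del: of_nat_Suc)
    then have P: "\<nu> j * (X * x) = real (Suc l) * (P * x)" for x
      by (metis mult.assoc)
    have "c j - 1 = l" using Suc by simp
    then show ?thesis
      using P s' Suc unfolding w multinomial_weight_def p_def[symmetric]
      by (simp only: X_def[symmetric] P_def[symmetric] s_def[symmetric] if_True zero_less_Suc Suc_le_mono diff_Suc_Suc)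
  qed simp
  have 2: "p * ?w m c = (real (Suc m) - real s) * ?w (Suc m) c"
  proof -
    \<comment> \<open>At \<open>s = Suc m\<close> the right side vanishes through its factor, the
      left side through its weight; beyond that both weights are zero.\<close>
    consider "s \<le> m" | "s = Suc m" | "Suc m < s" by linarith
    then show ?thesis
    proof cases
      case 1
      then have "Suc m - s = Suc (m - s)" by simp
      moreover have "real (Suc m) - real s = real (Suc (m - s))" using 1 by (simp add: of_nat_diff)
      ultimately show ?thesis using 1
        by (simp add: w del: of_nat_Suc)
    qed (auto simp: w)
  qed
  have "(\<Sum>j\<in>J. if 0 < c j then \<nu> j * ?w m (c(j := c j - 1)) else 0) = real s * ?w (Suc m) c"
    using 1 by (simp add: s_def sum_distrib_right cong: sum.cong)
  with 2 show ?thesis by (simp add: p_def algebra_simps)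
qed

text \<open>Here a Poisson number of trials makes the cell counts independent. With \<open>p\<close>
  the probability to miss all cells, the series is an exponential series in \<open>r * p\<close>,
  and \<open>exp (- r) * exp (r * p)\<close> splits into one exponential for each cell.\<close>

lemma sums_poisson_multinomial_weight:
  assumes "finite J"
  shows "(\<lambda>m. r ^ m / fact m * exp (- r) * (fact m * multinomial_weight J \<nu> m c)) sums
     (\<Prod>j\<in>J. (r * \<nu> j) ^ c j / fact (c j) * exp (- (r * \<nu> j)))"
proof -
  define s where "s = sum c J"
  define p where "p = 1 - sum \<nu> J"
  define P where "P = (\<Prod>j\<in>J. \<nu> j ^ c j / fact (c j))"
  let ?f = "\<lambda>m. r ^ m / fact m * exp (- r) * (fact m * multinomial_weight J \<nu> m c)"
  have "(\<lambda>m. (r * p) ^ m /\<^sub>R fact m) sums exp (r * p)" by (rule exp_converges)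
  from sums_mult[OF this, of "exp (- r) * P * r ^ s"]
  have "(\<lambda>m. ?f (m + s)) sums (exp (- r) * P * r ^ s * exp (r * p))"
  proof (rule back_subst[where P = "\<lambda>f. f sums _"], intro ext)
    fix m
    have "?f (m + s) = r ^ (m + s) * exp (- r) * (P * (p ^ m / fact m))"
      by (simp add: multinomial_weight_def flip: s_def p_def P_def)
    then show "exp (- r) * P * r ^ s * ((r * p) ^ m /\<^sub>R fact m) = ?f (m + s)"
      by (simp only:) (simp add: power_add power_mult_distrib divide_inverse ac_simps)
  qed
  \<comment> \<open>Fewer than \<open>s\<close> trials cannot produce \<open>s\<close> hits, so the
    series effectively starts at \<open>s\<close>.\<close>
  moreover have "(\<Sum>m<s. ?f m) = 0"
    by (simp add: multinomial_weight_def s_def)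
  ultimately have "?f sums (exp (- r) * P * r ^ s * exp (r * p))"
    by (subst (asm) sums_iff_shift) simp
  moreover have "exp (- r) * P * r ^ s * exp (r * p) =
     (\<Prod>j\<in>J. (r * \<nu> j) ^ c j / fact (c j) * exp (- (r * \<nu> j)))"
  proof -
    have "exp (- r) * exp (r * p) = (\<Prod>j\<in>J. exp (- (r * \<nu> j)))"
      unfolding exp_sum[OF assms, symmetric] exp_add[symmetric]
      by (simp add: p_def right_diff_distrib sum_negf sum_distrib_left)
    moreover have "P * r ^ s = (\<Prod>j\<in>J. (r * \<nu> j) ^ c j / fact (c j))"
      by (simp add: P_def s_def power_sum power_mult_distrib prod_dividef prod.distrib)
    moreover have "exp (- r) * P * r ^ s * exp (r * p) = (P * r ^ s) * (exp (- r) * exp (r * p))"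
      by simp
    ultimately show ?thesis by (simp only: prod.distrib)
  qed
  ultimately show ?thesis by simp
qed

lemma card_Suc_filter:
  "card {i. i < Suc m \<and> P i} = card {i. i < m \<and> P i} + (if P m then 1 else 0)"
proof -
  have "{i. i < Suc m \<and> P i} = {i. i < m \<and> P i} \<union> (if P m then {m} else {})"
    by (auto simp: less_Suc_eq)
  then show ?thesis by auto
qed

context prob_space begin

text \<open>Induction over the trials: the last one is independent of the counts of the earlier
  ones, and the resulting recursion is that of \<open>multinomial_weight_Suc\<close>.\<close>

lemma prob_multinomial_counts:
  fixes Z :: "nat \<Rightarrow> 'a \<Rightarrow> 'b"
  assumes ind: "indep_vars (\<lambda>_. T) Z UNIV"
    and J: "finite J" and S: "\<And>j. j \<in> J \<Longrightarrow> S j \<in> sets T" and disj: "disjoint_family_on S J"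
    and \<nu>: "\<And>i j. j \<in> J \<Longrightarrow> prob {\<omega> \<in> space M. Z i \<omega> \<in> S j} = \<nu> j"
  shows "prob {\<omega> \<in> space M. \<forall>j\<in>J. card {i. i < m \<and> Z i \<omega> \<in> S j} = c j} =
     fact m * multinomial_weight J \<nu> m c"
proof (induction m arbitrary: c)
  case 0
  have "(\<Prod>j\<in>J. \<nu> j ^ c j / fact (c j)) = 1" if "sum c J = 0"
    using that J by (intro prod.neutral) auto
  moreover have "prob {\<omega> \<in> space M. \<forall>j\<in>J. 0 = c j} = (if sum c J = 0 then 1 else 0)"
  proof (cases "\<forall>j\<in>J. c j = 0")
    case True
    then show ?thesis using prob_space by simp
  next
    case False
    then have "{\<omega> \<in> space M. \<forall>j\<in>J. 0 = c j} = {}" by auto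
    then show ?thesis using False J by (simp only:) auto
  qed
  ultimately show ?case by (simp add: multinomial_weight_def)
next
  case (Suc m)
  define Ev where "Ev m c = {\<omega> \<in> space M. \<forall>j\<in>J. card {i. i < m \<and> Z i \<omega> \<in> S j} = c j}" for m c
  have Zm[measurable]: "Z i \<in> measurable M T" for i
    using ind by (auto simp: indep_vars_def)
  have S'[measurable]: "\<And>j. j \<in> J \<Longrightarrow> S j \<in> sets T" by fact
  have US[measurable]: "\<Union>(S ` J) \<in> sets T" using J S by (intro sets.finite_UN) auto
  have cnt: "card {i. i < m \<and> x i \<in> S j} = (\<Sum>i<m. indicator (S j) (x i))" for x :: "nat \<Rightarrow> 'b" and j m
    by (simp add: indicator_def sum.If_cases Int_def)
  have Evm[measurable]: "Ev m c \<in> events" for m c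
    unfolding Ev_def cnt using J by measurable
  have ind': "prob (Ev m c \<inter> {\<omega> \<in> space M. Z m \<omega> \<in> A}) = prob (Ev m c) * prob {\<omega> \<in> space M. Z m \<omega> \<in> A}"
    if A[measurable]: "A \<in> sets T" for c A
  proof -
    \<comment> \<open>Independence of the whole family is used for two blocks of indices, the first
      \<open>m\<close> trials and the single trial \<open>m\<close>.\<close>
    let ?X = "\<lambda>\<omega>. restrict (\<lambda>i. Z i \<omega>) {..<m}" and ?Y = "\<lambda>\<omega>. restrict (\<lambda>i. Z i \<omega>) {m}"
    have iv: "indep_var (PiM {..<m} (\<lambda>_. T)) ?X (PiM {m} (\<lambda>_. T)) ?Y"
      using ind by (rule indep_var_restrict) auto
    define C where "C = {x \<in> space (PiM {..<m} (\<lambda>_. T)). \<forall>j\<in>J. (\<Sum>i<m. indicator (S j) (x i) :: nat) = c j}"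
    define D where "D = {x \<in> space (PiM {m} (\<lambda>_. T)). x m \<in> A}"
    have C: "C \<in> sets (PiM {..<m} (\<lambda>_. T))"
      unfolding C_def using J by measurable
    have D: "D \<in> sets (PiM {m} (\<lambda>_. T))"
      unfolding D_def by measurable
    have sp: "Z i \<omega> \<in> space T" if "\<omega> \<in> space M" for i \<omega>
      using measurable_space[OF Zm that] .
    have 1: "?X -` C \<inter> space M = Ev m c"
      using sp by (auto simp: C_def Ev_def cnt space_PiM)
    have 2: "?Y -` D \<inter> space M = {\<omega> \<in> space M. Z m \<omega> \<in> A}"
      using sp by (auto simp: D_def space_PiM)
    have "(\<lambda>x. (?X x, ?Y x)) -` (C \<times> D) \<inter> space M = (?X -` C \<inter> space M) \<inter> (?Y -` D \<inter> space M)"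
      by auto
    with indep_varD[OF iv C D] show ?thesis by (simp only: 1 2)
  qed
  let ?R = "{\<omega> \<in> space M. Z m \<omega> \<in> space T - \<Union>(S ` J)}"
  \<comment> \<open>A cell with \<open>c j = 0\<close> cannot receive the last trial. It has to be
    excluded, since \<open>c j - 1\<close> would be truncated to 0 and describe a wrong
    event.\<close>
  define J' where "J' = {j\<in>J. 0 < c j}"
  let ?F = "\<lambda>j. Ev m (c(j := c j - 1)) \<inter> {\<omega> \<in> space M. Z m \<omega> \<in> S j}"
  have J': "finite J'" "J' \<subseteq> J" using J by (auto simp: J'_def)
  have dj: "j = j'" if "j \<in> J" "j' \<in> J" "z \<in> S j" "z \<in> S j'" for j j' z
    using disj that by (auto simp: disjoint_family_on_def)
  have split: "Ev (Suc m) c = (Ev m c \<inter> ?R) \<union> (\<Union>j\<in>J'. ?F j)"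
  proof (intro set_eqI iffI)
    fix \<omega> assume w: "\<omega> \<in> Ev (Suc m) c"
    then have sp: "\<omega> \<in> space M" by (simp add: Ev_def)
    have eq: "card {i. i < m \<and> Z i \<omega> \<in> S j} + (if Z m \<omega> \<in> S j then 1 else 0) = c j" if "j \<in> J" for j
      using w that by (simp add: Ev_def card_Suc_filter)
    show "\<omega> \<in> (Ev m c \<inter> ?R) \<union> (\<Union>j\<in>J'. ?F j)"
    proof (cases "\<exists>j\<in>J. Z m \<omega> \<in> S j")
      case True
      then obtain j where j: "j \<in> J" "Z m \<omega> \<in> S j" by blast
      have "card {i. i < m \<and> Z i \<omega> \<in> S l} = (c(j := c j - 1)) l" if "l \<in> J" for l
      proof (cases "l = j")
        case True
        then show ?thesis using eq[OF j(1), symmetric] j(2) by simp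
      next
        case False
        then have "Z m \<omega> \<notin> S l" using dj[OF that j(1) _ j(2)] by blast
        then show ?thesis using eq[OF that] False by simp
      qed
      moreover have "0 < c j" using eq[OF j(1)] j(2) by simp
      ultimately show ?thesis using j sp by (auto simp: Ev_def J'_def)
    next
      case False
      then have "card {i. i < m \<and> Z i \<omega> \<in> S l} = c l" if "l \<in> J" for l
        using eq[OF that] that by auto
      with False show ?thesis using sp measurable_space[OF Zm sp] by (auto simp: Ev_def)
    qed
  next
    fix \<omega> assume "\<omega> \<in> (Ev m c \<inter> ?R) \<union> (\<Union>j\<in>J'. ?F j)"
    then consider "\<omega> \<in> Ev m c" "\<omega> \<in> ?R" | j where "j \<in> J'" "\<omega> \<in> ?F j" by auto
    then show "\<omega> \<in> Ev (Suc m) c"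
    proof cases
      case 1
      then show ?thesis by (auto simp: Ev_def card_Suc_filter)
    next
      case 2
      then have "card {i. i < Suc m \<and> Z i \<omega> \<in> S l} = c l" if "l \<in> J" for l
        using that dj[of l j "Z m \<omega>"] by (cases "l = j") (auto simp: Ev_def card_Suc_filter J'_def)
      then show ?thesis using 2 by (auto simp: Ev_def)
    qed
  qed
  have disjF: "disjoint_family_on ?F J'"
    using J'(2) dj unfolding disjoint_family_on_def by blast
  have Fm: "?F j \<in> events" if "j \<in> J'" for j
    using J'(2) that by (intro sets.Int Evm) (auto intro: measurable_sets_Collect)
  have R': "?R \<in> events" by measurable
  have R: "prob ?R = 1 - sum \<nu> J"
  proof -
    have "?R = space M - {\<omega> \<in> space M. Z m \<omega> \<in> \<Union>(S ` J)}"
      using measurable_space[OF Zm] by auto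
    then have "prob ?R = 1 - prob {\<omega> \<in> space M. Z m \<omega> \<in> \<Union>(S ` J)}"
      by (simp only:) (rule prob_compl, measurable)
    also have "{\<omega> \<in> space M. Z m \<omega> \<in> \<Union>(S ` J)} = (\<Union>j\<in>J. {\<omega> \<in> space M. Z m \<omega> \<in> S j})" by auto
    also have "prob \<dots> = (\<Sum>j\<in>J. prob {\<omega> \<in> space M. Z m \<omega> \<in> S j})"
      using J disj by (intro finite_measure_finite_Union) (auto simp: disjoint_family_on_def)
    finally show ?thesis using \<nu> by simp
  qed
  have "prob (Ev (Suc m) c) = prob (Ev m c \<inter> ?R) + prob (\<Union>j\<in>J'. ?F j)"
    unfolding split using J' R' Fm by (intro finite_measure_Union sets.finite_UN sets.Int Evm) auto
  also have "prob (\<Union>j\<in>J'. ?F j) = (\<Sum>j\<in>J'. prob (?F j))"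
    using J' disjF Fm by (intro finite_measure_finite_Union) auto
  also have "\<dots> = (\<Sum>j\<in>J'. fact m * multinomial_weight J \<nu> m (c(j := c j - 1)) * \<nu> j)"
  proof (rule sum.cong)
    fix j assume "j \<in> J'"
    then have j: "j \<in> J" using J'(2) by blast
    show "prob (?F j) = fact m * multinomial_weight J \<nu> m (c(j := c j - 1)) * \<nu> j"
      unfolding ind'[OF S[OF j]] \<nu>[OF j] using Suc.IH[of "c(j := c j - 1)"] by (simp only: Ev_def)
  qed simp
  also have "\<dots> = fact m * (\<Sum>j\<in>J. if 0 < c j then \<nu> j * multinomial_weight J \<nu> m (c(j := c j - 1)) else 0)"
    using J by (simp add: J'_def sum_distrib_left sum.inter_filter[symmetric] ac_simps)
  also have "prob (Ev m c \<inter> ?R) = fact m * multinomial_weight J \<nu> m c * (1 - sum \<nu> J)"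
    using ind'[of "space T - \<Union>(S ` J)" c] R Suc.IH by (simp add: Ev_def)
  finally have "prob (Ev (Suc m) c) = fact m * (real (Suc m) * multinomial_weight J \<nu> (Suc m) c)"
    unfolding multinomial_weight_Suc[OF J] by (simp add: algebra_simps)
  then show ?case by (simp add: Ev_def)
qed

text \<open>Partition by the value of \<open>N\<close>, factor each piece by independence of
  \<open>N\<close> and the sample, and sum the series found before.\<close>

lemma prob_poisson_counts:
  fixes Z :: "nat \<Rightarrow> 'a \<Rightarrow> 'b"
  assumes ind: "indep_vars (\<lambda>_. T) Z UNIV"
    and J: "finite J" and S: "\<And>j. j \<in> J \<Longrightarrow> S j \<in> sets T" and disj: "disjoint_family_on S J"
    and \<nu>: "\<And>i j. j \<in> J \<Longrightarrow> prob {\<omega> \<in> space M. Z i \<omega> \<in> S j} = \<nu> j"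
    and r: "0 < r" and N: "distr M (count_space UNIV) N = measure_pmf (poisson_pmf r)"
    and indN: "independent_rvs M (count_space UNIV) N (PiM UNIV (\<lambda>_. T)) (\<lambda>\<omega> i. Z i \<omega>)"
  shows "prob {\<omega> \<in> space M. \<forall>j\<in>J. card {i. i < N \<omega> \<and> Z i \<omega> \<in> S j} = c j} =
     (\<Prod>j\<in>J. (r * \<nu> j) ^ c j / fact (c j) * exp (- (r * \<nu> j)))"
proof -
  define Ev where "Ev m = {\<omega> \<in> space M. \<forall>j\<in>J. card {i. i < m \<and> Z i \<omega> \<in> S j} = c j}" for m
  have Zm[measurable]: "Z i \<in> measurable M T" for i
    using ind by (auto simp: indep_vars_def)
  have S'[measurable]: "\<And>j. j \<in> J \<Longrightarrow> S j \<in> sets T" by fact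
  have N'[measurable]: "N \<in> measurable M (count_space UNIV)"
    using indN by (simp add: independent_rvs_def)
  have cnt: "card {i. i < m \<and> x i \<in> S j} = (\<Sum>i<m. indicator (S j) (x i))" for x :: "nat \<Rightarrow> 'b" and j m
    by (simp add: indicator_def sum.If_cases Int_def)
  have Evm[measurable]: "Ev m \<in> events" for m
    unfolding Ev_def cnt using J by measurable
  have *: "prob ({\<omega> \<in> space M. N \<omega> = m} \<inter> Ev m) = r ^ m / fact m * exp (- r) * (fact m * multinomial_weight J \<nu> m c)" for m
  proof -
    define C where "C = {x \<in> space (PiM UNIV (\<lambda>_. T)). \<forall>j\<in>J. (\<Sum>i<m. indicator (S j) (x i) :: nat) = c j}"
    have C: "C \<in> sets (PiM UNIV (\<lambda>_. T))"
      unfolding C_def using J by measurable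
    have sp: "Z i \<omega> \<in> space T" if "\<omega> \<in> space M" for i \<omega>
      using measurable_space[OF Zm that] .
    have 1: "(\<lambda>\<omega> i. Z i \<omega>) -` C \<inter> space M = Ev m"
      using sp by (auto simp: C_def Ev_def cnt space_PiM)
    have 2: "{\<omega> \<in> space M. N \<omega> = m} = N -` {m} \<inter> space M" by auto
    have "indep_set {N -` A \<inter> space M | A. A \<in> sets (count_space UNIV)}
        {(\<lambda>\<omega> i. Z i \<omega>) -` B \<inter> space M | B. B \<in> sets (PiM UNIV (\<lambda>_. T))}"
      using indN by (simp add: independent_rvs_def)
    then have "prob ({\<omega> \<in> space M. N \<omega> = m} \<inter> Ev m) = prob {\<omega> \<in> space M. N \<omega> = m} * prob (Ev m)"
      by (rule indep_setD) (use C 1 2 in auto)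
    also have "prob {\<omega> \<in> space M. N \<omega> = m} = measure (distr M (count_space UNIV) N) {m}"
      by (simp add: measure_distr 2)
    also have "\<dots> = r ^ m / fact m * exp (- r)"
      using r by (simp add: N measure_pmf_single pmf_poisson[OF r])
    also have "prob (Ev m) = fact m * multinomial_weight J \<nu> m c"
      unfolding Ev_def by (rule prob_multinomial_counts[OF ind J S disj \<nu>])
    finally show ?thesis .
  qed
  have "(\<lambda>m. prob ({\<omega> \<in> space M. N \<omega> = m} \<inter> Ev m)) sums prob (\<Union>m. {\<omega> \<in> space M. N \<omega> = m} \<inter> Ev m)"
    by (intro finite_measure_UNION) (auto simp: disjoint_family_on_def)
  then have "prob (\<Union>m. {\<omega> \<in> space M. N \<omega> = m} \<inter> Ev m) =
      (\<Prod>j\<in>J. (r * \<nu> j) ^ c j / fact (c j) * exp (- (r * \<nu> j)))"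
    unfolding * by (rule sums_unique2[OF _ sums_poisson_multinomial_weight[OF J]])
  also have "(\<Union>m. {\<omega> \<in> space M. N \<omega> = m} \<inter> Ev m) =
      {\<omega> \<in> space M. \<forall>j\<in>J. card {i. i < N \<omega> \<and> Z i \<omega> \<in> S j} = c j}"
    by (auto simp: Ev_def)
  finally show ?thesis .
qed

end

section \<open>The Hessian and the curvature condition\<close>

lemma has_derivative_gradient:
  assumes "s differentiable at x"
  shows "(s has_derivative (\<lambda>v. gradient s x \<bullet> v)) (at x)"
proof -
  let ?D = "frechet_derivative s (at x)"
  have D: "(s has_derivative ?D) (at x)" using assms by (simp add: frechet_derivative_works)
  then have lin: "linear ?D" by (rule has_derivative_linear)
  have "?D v = gradient s x \<bullet> v" for v
  proof -
    have "?D v = ?D (\<Sum>i\<in>UNIV. v $ i *\<^sub>R axis i 1)"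
      by (simp add: basis_expansion flip: scalar_mult_eq_scaleR)
    also have "\<dots> = (\<Sum>i\<in>UNIV. v $ i * ?D (axis i 1))"
      by (simp add: linear_sum[OF lin] linear_cmul[OF lin])
    finally show ?thesis by (simp add: gradient_def inner_vec_def mult.commute)
  qed
  then have "?D = (\<lambda>v. gradient s x \<bullet> v)" by (rule ext)
  with D show ?thesis by simp
qed

text \<open>At the minimum the gradient vanishes, so differentiability of the gradient says that it
  is \<open>H y\<close> up to a small multiple of \<open>norm y\<close>. The mean value theorem
  along the segment from 0 to \<open>u\<close> passes this on to \<open>s\<close>.\<close>

lemma second_order_expansion_at_minimum:
  assumes diff: "twice_continuously_differentiable_on s U"
    and U: "0 \<in> U" and s0: "s 0 = 0" and nonneg: "\<And>u. u \<in> U \<Longrightarrow> 0 \<le> s u" and "0 < \<epsilon>"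
  obtains r where "0 < r"
    "\<And>u. norm u < r \<Longrightarrow> u \<in> U \<and> \<bar>s u - 1 / 2 * (u \<bullet> (hessian s 0 *v u))\<bar> \<le> \<epsilon> * (norm u)\<^sup>2"
proof -
  let ?g = "gradient s" and ?H = "hessian s 0"
  have opU: "open U" using diff by (simp add: twice_continuously_differentiable_on_def)
  have ds: "(s has_derivative (\<lambda>v. ?g x \<bullet> v)) (at x)" if "x \<in> U" for x
    using diff that opU
    by (intro has_derivative_gradient)
      (simp add: twice_continuously_differentiable_on_def differentiable_on_eq_differentiable_at)
  have "(\<lambda>v. ?g 0 \<bullet> v) = (\<lambda>v. 0)"
    using nonneg s0 by (intro differential_zero_maxmin[OF U opU ds[OF U]]) auto
  then have "?g 0 \<bullet> ?g 0 = 0" by meson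
  then have g0: "?g 0 = 0" by simp
  have "?g differentiable at 0"
    using diff U opU by (simp add: twice_continuously_differentiable_on_def differentiable_on_eq_differentiable_at)
  then have dg: "(?g has_derivative frechet_derivative ?g (at 0)) (at 0)"
    by (simp add: frechet_derivative_works)
  have "frechet_derivative ?g (at 0) = (\<lambda>v. ?H *v v)"
    unfolding hessian_def using has_derivative_linear[OF dg] by (simp add: matrix_works fun_eq_iff)
  then have dg: "(?g has_derivative (\<lambda>v. ?H *v v)) (at 0)"
    using dg by simp
  obtain r1 where r1: "0 < r1" "\<And>y. norm y < r1 \<Longrightarrow> norm (?g y - ?H *v y) \<le> \<epsilon> * norm y"
    using dg[unfolded has_derivative_at_alt] \<open>0 < \<epsilon>\<close> g0 by fastforce
  obtain r2 where r2: "0 < r2" "ball 0 r2 \<subseteq> U"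
    using opU U open_contains_ball by blast
  show thesis
  proof (rule that[of "min r1 r2"])
    show "0 < min r1 r2" using r1 r2 by simp
    fix u :: "real ^ 'a" assume u: "norm u < min r1 r2"
    have tU: "t *\<^sub>R u \<in> U" "norm (t *\<^sub>R u) < r1" if "0 \<le> t" "t \<le> 1" for t
    proof -
      have "norm (t *\<^sub>R u) \<le> norm u" using that by (simp add: mult_left_le_one_le)
      then show "t *\<^sub>R u \<in> U" "norm (t *\<^sub>R u) < r1" using u r2(2) by (auto simp: subset_iff)
    qed
    \<comment> \<open>The Taylor remainder along the segment. Its value at 1 is the quantity to be
      bounded, its value at 0 is \<open>s 0 = 0\<close>, and its derivative is the linearization
      error of the gradient paired with \<open>u\<close>.\<close>
    define \<phi> where "\<phi> t = s (t *\<^sub>R u) - t\<^sup>2 / 2 * (u \<bullet> (?H *v u))" for t :: real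
    define \<phi>' where "\<phi>' t = ?g (t *\<^sub>R u) \<bullet> u - t * (u \<bullet> (?H *v u))" for t :: real
    have "DERIV \<phi> t :> \<phi>' t" if t: "0 \<le> t" "t \<le> 1" for t
    proof -
      have "((\<lambda>t. s (t *\<^sub>R u)) has_derivative (\<lambda>x. ?g (t *\<^sub>R u) \<bullet> (x *\<^sub>R u))) (at t)"
        by (rule has_derivative_compose[where g = s and f = "\<lambda>t. t *\<^sub>R u", OF _ ds[OF tU(1)[OF t]]])
          (auto intro!: derivative_eq_intros)
      then have "((\<lambda>t. s (t *\<^sub>R u)) has_field_derivative ?g (t *\<^sub>R u) \<bullet> u) (at t)"
        by (simp add: has_field_derivative_def mult.commute[of _ "_ \<bullet> _"] mult_commute_abs)
      then show ?thesis unfolding \<phi>_def \<phi>'_def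
        by (auto intro!: derivative_eq_intros)
    qed
    then have "\<exists>z>0. z < 1 \<and> \<phi> 1 - \<phi> 0 = (1 - 0) * \<phi>' z"
      by (intro MVT2) auto
    then obtain z where z: "0 < z" "z < 1" "\<phi> 1 - \<phi> 0 = \<phi>' z" by auto
    have "\<phi>' z = (?g (z *\<^sub>R u) - ?H *v (z *\<^sub>R u)) \<bullet> u"
      by (simp add: \<phi>'_def inner_diff_left matrix_vector_mult_scaleR inner_diff_right inner_commute)
    then have "\<bar>\<phi>' z\<bar> \<le> norm (?g (z *\<^sub>R u) - ?H *v (z *\<^sub>R u)) * norm u"
      by (simp add: Cauchy_Schwarz_ineq2)
    also have "\<dots> \<le> (\<epsilon> * norm (z *\<^sub>R u)) * norm u"
      using r1(2)[OF tU(2)[of z]] z by (intro mult_right_mono) auto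
    also have "\<dots> = z * (\<epsilon> * (norm u)\<^sup>2)" using z by (simp add: power2_eq_square)
    also have "\<dots> \<le> \<epsilon> * (norm u)\<^sup>2" using z \<open>0 < \<epsilon>\<close> by (intro mult_left_le_one_le) auto
    finally have "\<bar>\<phi> 1 - \<phi> 0\<bar> \<le> \<epsilon> * (norm u)\<^sup>2" using z by simp
    moreover have "u \<in> U" using tU(1)[of 1] by simp
    ultimately show "u \<in> U \<and> \<bar>s u - 1 / 2 * (u \<bullet> (?H *v u))\<bar> \<le> \<epsilon> * (norm u)\<^sup>2"
      by (simp add: \<phi>_def s0)
  qed
qed

section \<open>The curvature condition as an inequality between quadratic forms\<close>

lemma sum_UNIV_Plus:
  "(\<Sum>i\<in>(UNIV :: ('m :: finite + 'n :: finite) set). g i) =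
     (\<Sum>p\<in>UNIV. g (Inl p)) + (\<Sum>q\<in>UNIV. g (Inr q))" for g :: "_ \<Rightarrow> real"
  by (simp add: sum.Plus flip: UNIV_Plus_UNIV)

lemma inner_block_matrix:
  fixes v w :: "real ^ 'm"
  defines "z \<equiv> (\<chi> i. case i of Inl p \<Rightarrow> v $ p | Inr q \<Rightarrow> w $ q)"
  shows "z \<bullet> (block_matrix A B C D *v z) =
     v \<bullet> (A *v v) + v \<bullet> (B *v w) + w \<bullet> (C *v v) + w \<bullet> (D *v w)"
  by (simp add: z_def block_matrix_def inner_vec_def matrix_vector_mult_def sum_UNIV_Plus
      sum.distrib distrib_left)

text \<open>Expand \<open>u\<close> in the columns of the orthogonal matrix \<open>U\<close>; on
  each column \<open>H\<close> acts by its eigenvalue.\<close>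

lemma eigensystem_form:
  assumes "ordered_eigensystem H \<kappa> U"
  shows "u \<bullet> (H *v u) = (transpose U *v u) \<bullet> (diagonal \<kappa> *v (transpose U *v u))"
    and "U *v (transpose U *v u) = u"
proof -
  define v where "v = transpose U *v u"
  have orth: "orthogonal_matrix U" and eig: "\<And>i. H *v column i U = \<kappa> $ i *\<^sub>R column i U"
    using assms by (auto simp: ordered_eigensystem_def)
  show u: "U *v (transpose U *v u) = u"
    using orth unfolding matrix_vector_mul_assoc by (simp add: orthogonal_matrix_def)
  have "H *v u = H *v (U *v v)" using u by (simp add: v_def)
  also have "\<dots> = (\<Sum>i\<in>UNIV. v $ i *\<^sub>R (H *v column i U))"
    unfolding matrix_mult_sum[of U v]
    by (simp add: linear_sum[OF matrix_vector_mul_linear] scalar_mult_eq_scaleR matrix_vector_mult_scaleR)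
  also have "\<dots> = (\<Sum>i\<in>UNIV. (\<kappa> $ i * v $ i) *\<^sub>R column i U)"
    by (simp add: eig mult.commute)
  also have "diagonal \<kappa> *v v = (\<chi> i. \<kappa> $ i * v $ i)"
    by (simp add: diagonal_def matrix_vector_mult_def vec_eq_iff if_distrib[of "\<lambda>x. x * _"] cong: if_cong)
  then have "(\<Sum>i\<in>UNIV. (\<kappa> $ i * v $ i) *\<^sub>R column i U) = U *v (diagonal \<kappa> *v v)"
    by (simp add: matrix_mult_sum[of U] scalar_mult_eq_scaleR)
  finally have "u \<bullet> (H *v u) = u \<bullet> (U *v (diagonal \<kappa> *v v))" by simp
  also have "\<dots> = v \<bullet> (diagonal \<kappa> *v v)"
    by (simp add: v_def dot_lmul_matrix[symmetric] vector_transpose_matrix)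
  finally show "u \<bullet> (H *v u) = (transpose U *v u) \<bullet> (diagonal \<kappa> *v (transpose U *v u))"
    by (simp add: v_def)
qed

text \<open>Test the block matrix on the spectral coordinates of \<open>x\<close> and
  \<open>y\<close>. Norms are preserved and each off-diagonal block contributes
  \<open>x \<bullet> y\<close>, so the form is the right side minus the squared norm of
  \<open>x - y\<close>. All later geometry uses the condition in this coordinate-free form; putting
  one argument to 0 also shows that each Hessian form is nonnegative.\<close>

lemma curvature_condition_form:
  fixes Hl Hr Ul Ur :: "real ^ ('m :: {finite, linorder}) ^ ('m :: {finite, linorder})"
  assumes l: "ordered_eigensystem Hl \<kappa>l Ul" and r: "ordered_eigensystem Hr \<kappa>r Ur"
    and psd: "positive_semidefinite (curvature_matrix a \<eta> \<kappa>l Ul \<kappa>r Ur)"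
  shows "(norm (x - y))\<^sup>2 \<le> 2 * a * \<eta> * (x \<bullet> (Hl *v x) + y \<bullet> (Hr *v y))"
proof -
  let ?v = "transpose Ul *v x" and ?w = "transpose Ur *v y"
  have nl: "?v \<bullet> ?v = x \<bullet> x"
    using eigensystem_form(2)[OF l, of x]
    by (metis dot_lmul_matrix vector_transpose_matrix)
  have nr: "?w \<bullet> ?w = y \<bullet> y"
    using eigensystem_form(2)[OF r, of y]
    by (metis dot_lmul_matrix vector_transpose_matrix)
  have c1: "?v \<bullet> ((transpose Ul ** Ur) *v ?w) = x \<bullet> y"
    using eigensystem_form(2)[OF l, of x] eigensystem_form(2)[OF r, of y]
    by (metis matrix_vector_mul_assoc dot_lmul_matrix vector_transpose_matrix inner_commute)
  have c2: "?w \<bullet> ((transpose Ur ** Ul) *v ?v) = x \<bullet> y"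
    using eigensystem_form(2)[OF l, of x] eigensystem_form(2)[OF r, of y]
    by (metis matrix_vector_mul_assoc dot_lmul_matrix vector_transpose_matrix inner_commute)
  have sub: "((c *\<^sub>R D - mat 1) *v u) = c *\<^sub>R (D *v u) - u" for c and D :: "real^('m::{finite,linorder})^('m::{finite,linorder})" and u
    by (simp add: matrix_vector_mult_diff_rdistrib scaleR_matrix_vector_assoc)
  have "0 \<le> ?v \<bullet> (((2 * a * \<eta>) *\<^sub>R diagonal \<kappa>l - mat 1) *v ?v) + x \<bullet> y + x \<bullet> y
      + ?w \<bullet> (((2 * a * \<eta>) *\<^sub>R diagonal \<kappa>r - mat 1) *v ?w)"
  proof -
    let ?z = "\<chi> i. case i of Inl p \<Rightarrow> ?v $ p | Inr q \<Rightarrow> ?w $ q"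
    have "0 \<le> ?z \<bullet> (curvature_matrix a \<eta> \<kappa>l Ul \<kappa>r Ur *v ?z)"
      using psd by (simp only: positive_semidefinite_def)
    then show ?thesis
      unfolding curvature_matrix_def inner_block_matrix c1 c2 .
  qed
  then have "0 \<le> 2 * a * \<eta> * (x \<bullet> (Hl *v x)) - x \<bullet> x + 2 * (x \<bullet> y) + 2 * a * \<eta> * (y \<bullet> (Hr *v y)) - y \<bullet> y"
    unfolding sub eigensystem_form(1)[OF l] eigensystem_form(1)[OF r]
    using nl nr by (simp add: inner_diff_right)
  moreover have "(norm (x - y))\<^sup>2 = x \<bullet> x - 2 * (x \<bullet> y) + y \<bullet> y"
    by (simp add: power2_norm_eq_inner inner_diff_left inner_diff_right inner_commute)
  ultimately show ?thesis by (simp add: algebra_simps)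
qed

section \<open>Blow-up at the poles\<close>

text \<open>Blown-up coordinates at the left pole for \<open>\<sigma> = 1\<close> and at the right pole for \<open>\<sigma> = -1\<close>.\<close>

definition pole_chart :: "real \<Rightarrow> real \<Rightarrow> real \<Rightarrow> real \<times> (real ^ 'm) \<Rightarrow> real \<times> (real ^ 'm)" where
  "pole_chart a \<sigma> h x = (\<sigma> * (h\<^sup>2 * fst x - a), h *\<^sub>R snd x)"

definition scaled_gap :: "real \<Rightarrow> real \<Rightarrow> real \<times> (real ^ 'm) \<Rightarrow> real \<times> (real ^ 'm) \<Rightarrow> real" where
  "scaled_gap a h z w = (2 * a - dist z w) / h\<^sup>2"

lemma scaled_gap_commute: "scaled_gap a h z w = scaled_gap a h w z"
  by (simp add: scaled_gap_def dist_commute)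

text \<open>An exact identity. Compare the square of \<open>dist = 2 * a - h^2 * u\<close> with the
  Pythagorean formula in the charts: the constant terms cancel, a factor \<open>h^2\<close> can be
  divided out, and the rest is \<open>gap\<close> plus a term of order \<open>h^2\<close> in which
  \<open>u\<close> itself occurs.\<close>

lemma scaled_gap_eq_gap:
  assumes "0 < a" "0 < h"
  defines "u x y \<equiv> scaled_gap a h (pole_chart a 1 h x) (pole_chart a (- 1) h y)"
  shows "u x y = gap a x y + h\<^sup>2 * ((u x y)\<^sup>2 - (fst x + fst y)\<^sup>2) / (4 * a)"
proof -
  let ?d = "dist (pole_chart a 1 h x) (pole_chart a (- 1) h y)"
  define s where "s = fst x + fst y"
  define q where "q = (norm (snd x - snd y))\<^sup>2"
  have "?d\<^sup>2 = (h\<^sup>2 * s - 2 * a)\<^sup>2 + h\<^sup>2 * q"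
  proof -
    have "dist (h *\<^sub>R snd x) (h *\<^sub>R snd y) = h * norm (snd x - snd y)"
      using assms(2) by (simp add: dist_norm flip: scaleR_diff_right)
    moreover have "dist (h\<^sup>2 * fst x - a) (- (h\<^sup>2 * fst y - a)) = \<bar>h\<^sup>2 * s - 2 * a\<bar>"
      by (simp add: dist_real_def s_def algebra_simps)
    ultimately show ?thesis
      by (simp add: pole_chart_def dist_Pair_Pair q_def power_mult_distrib)
  qed
  moreover have "?d = 2 * a - h\<^sup>2 * u x y"
    using assms by (simp add: u_def scaled_gap_def)
  ultimately have "(2 * a - h\<^sup>2 * u x y)\<^sup>2 = (h\<^sup>2 * s - 2 * a)\<^sup>2 + h\<^sup>2 * q" by simp
  then have "h\<^sup>2 * (4 * a * u x y) = h\<^sup>2 * (4 * a * s - q + h\<^sup>2 * ((u x y)\<^sup>2 - s\<^sup>2))"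
    by (simp add: power2_eq_square algebra_simps)
  then have "4 * a * u x y = 4 * a * s - q + h\<^sup>2 * ((u x y)\<^sup>2 - s\<^sup>2)"
    using assms(2) by simp
  then have "u x y = (4 * a * s - q + h\<^sup>2 * ((u x y)\<^sup>2 - s\<^sup>2)) / (4 * a)"
    using assms(1) by (simp add: field_simps)
  also have "\<dots> = gap a x y + h\<^sup>2 * ((u x y)\<^sup>2 - s\<^sup>2) / (4 * a)"
    using assms(1) by (simp add: gap_def s_def q_def field_simps)
  finally show ?thesis by (simp add: s_def)
qed

lemma scaled_gap_near_gap:
  assumes "0 < a" "0 < \<rho>"
  obtains h0 where "0 < h0"
    "\<And>h x y. 0 < h \<Longrightarrow> h < h0 \<Longrightarrow> norm x \<le> K \<Longrightarrow> norm y \<le> K \<Longrightarrow>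
       \<bar>scaled_gap a h (pole_chart a 1 h x) (pole_chart a (- 1) h y) - gap a x y\<bar> \<le> \<rho>"
proof -
  define L where "L = \<bar>K\<bar>"
  \<comment> \<open>\<open>G\<close> bounds \<open>gap\<close> on the window, \<open>V\<close>
    bounds the scaled gap there, and \<open>C\<close> bounds the coefficient of \<open>h^2\<close>
    in the difference of the two.\<close>
  define G where "G = 2 * L + (2 * L)\<^sup>2 / (4 * a)"
  define V where "V = 2 * G + 2 * L\<^sup>2 / a"
  define C where "C = (V\<^sup>2 + (2 * L)\<^sup>2) / (4 * a)"
  have nn: "0 \<le> L" "0 \<le> G" "0 \<le> V" "0 \<le> C"
    using assms(1) by (simp_all add: L_def G_def V_def C_def)
  \<comment> \<open>The bound 1 gives \<open>h^2 <= h\<close>; adding 1 to \<open>C\<close> avoids a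
    division by zero.\<close>
  define h0 where "h0 = min 1 (\<rho> / (C + 1))"
  show thesis
  proof (rule that[of h0])
    show "0 < h0" using assms(2) nn by (simp add: h0_def)
    fix h and x y :: "real \<times> (real ^ 'a)"
    assume h: "0 < h" "h < h0" and xK: "norm x \<le> K" and yK: "norm y \<le> K"
    define u where "u = scaled_gap a h (pole_chart a 1 h x) (pole_chart a (- 1) h y)"
    define s where "s = fst x + fst y"
    define q where "q = (norm (snd x - snd y))\<^sup>2"
    have K: "\<bar>fst x\<bar> \<le> L" "\<bar>fst y\<bar> \<le> L" "norm (snd x) \<le> L" "norm (snd y) \<le> L"
      using xK yK norm_fst_le[of "fst x" "snd x"] norm_fst_le[of "fst y" "snd y"]
        norm_snd_le[of "snd x" "fst x"] norm_snd_le[of "snd y" "fst y"] by (simp_all add: L_def)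
    have h1: "h\<^sup>2 \<le> h" "h\<^sup>2 \<le> 1"
      using h by (auto simp: h0_def power2_eq_square mult_left_le mult_le_one)
    have s: "\<bar>s\<bar> \<le> 2 * L" using K by (simp add: s_def)
    then have s2: "s\<^sup>2 \<le> (2 * L)\<^sup>2" by (metis abs_ge_zero power2_abs power_mono)
    have "norm (snd x - snd y) \<le> 2 * L" using K norm_triangle_ineq4[of "snd x" "snd y"] by linarith
    then have q: "0 \<le> q" "q \<le> (2 * L)\<^sup>2" using power_mono[of "norm (snd x - snd y)" "2 * L" 2] by (simp_all add: q_def)
    have g: "gap a x y = s - q / (4 * a)" by (simp add: gap_def s_def q_def)
    have "0 \<le> q / (4 * a)" "q / (4 * a) \<le> (2 * L)\<^sup>2 / (4 * a)"
      using q assms(1) by (simp, intro divide_right_mono) auto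
    then have gG: "\<bar>gap a x y\<bar> \<le> G" using s by (simp add: g G_def)
    have u: "u = gap a x y + h\<^sup>2 * (u\<^sup>2 - s\<^sup>2) / (4 * a)"
      unfolding u_def s_def by (rule scaled_gap_eq_gap[OF assms(1) h(1)])
    define d where "d = dist (pole_chart a 1 h x) (pole_chart a (- 1) h y)"
    have d: "d = 2 * a - h\<^sup>2 * u" "0 \<le> d"
      using h by (simp_all add: d_def u_def scaled_gap_def)
    \<comment> \<open>The identity for \<open>u\<close> contains \<open>u^2\<close>, so a bound on
      \<open>u\<close> has to come first. Replacing one factor \<open>h^2 * u\<close> by
      \<open>2 * a - d\<close> makes the equation linear,
      \<open>u * (2 * a + d) = 4 * a * gap a x y - h^2 * s^2\<close>, and \<open>d\<close> is
      nonnegative.\<close>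
    have "4 * a * u = 4 * a * gap a x y + h\<^sup>2 * (u\<^sup>2 - s\<^sup>2)"
      using arg_cong[OF u, of "\<lambda>t. 4 * a * t"] assms(1) by (simp add: distrib_left)
    then have "u * (2 * a + d) = 4 * a * gap a x y - h\<^sup>2 * s\<^sup>2"
      by (simp add: d(1) algebra_simps power2_eq_square)
    then have "\<bar>u\<bar> * (2 * a + d) = \<bar>4 * a * gap a x y - h\<^sup>2 * s\<^sup>2\<bar>"
      using d(2) assms(1) by (metis abs_mult abs_of_nonneg add_nonneg_nonneg less_imp_le mult_2)
    also have "\<dots> \<le> 4 * a * G + (2 * L)\<^sup>2"
    proof -
      have "\<bar>4 * a * gap a x y\<bar> \<le> 4 * a * G" using gG assms(1) by (simp add: abs_mult)
      moreover have "0 \<le> h\<^sup>2 * s\<^sup>2" "h\<^sup>2 * s\<^sup>2 \<le> 1 * (2 * L)\<^sup>2"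
        using h1(2) s2 by (simp, intro mult_mono) auto
      ultimately show ?thesis by linarith
    qed
    finally have "\<bar>u\<bar> * (2 * a) \<le> 4 * a * G + (2 * L)\<^sup>2"
      using d(2) mult_left_mono[of "2 * a" "2 * a + d" "\<bar>u\<bar>"] by linarith
    then have "\<bar>u\<bar> \<le> (4 * a * G + (2 * L)\<^sup>2) / (2 * a)"
      using assms(1) by (simp add: pos_le_divide_eq)
    also have "\<dots> = V" using assms(1) by (simp add: V_def field_simps power2_eq_square)
    finally have uV: "u\<^sup>2 \<le> V\<^sup>2" by (metis abs_ge_zero power2_abs power_mono)
    have "\<bar>u - gap a x y\<bar> = h\<^sup>2 * (\<bar>u\<^sup>2 - s\<^sup>2\<bar> / (4 * a))"
    proof -
      have "u - gap a x y = h\<^sup>2 * ((u\<^sup>2 - s\<^sup>2) / (4 * a))" using u by simp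
      then show ?thesis using assms(1) by (simp only: abs_mult abs_divide) simp
    qed
    also have "\<dots> \<le> h * C"
    proof -
      have "\<bar>u\<^sup>2 - s\<^sup>2\<bar> \<le> V\<^sup>2 + (2 * L)\<^sup>2"
        using uV s2 zero_le_power2[of u] zero_le_power2[of s] by linarith
      then show ?thesis
        using h1(1) assms(1) h unfolding C_def by (intro mult_mono divide_right_mono) auto
    qed
    also have "\<dots> \<le> \<rho> / (C + 1) * C" using h nn by (intro mult_right_mono) (auto simp: h0_def)
    also have "\<dots> \<le> \<rho>" using nn assms(2) by (simp add: field_simps)
    finally show "\<bar>scaled_gap a h (pole_chart a 1 h x) (pole_chart a (- 1) h y) - gap a x y\<bar> \<le> \<rho>"
      by (simp add: u_def)
  qed
qed

text \<open>Compactness: away from neighborhoods of the two orderings of the pole pair, the distance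
  attains its maximum, and by uniqueness of the diameter this maximum is below
  \<open>2 * a\<close>.\<close>

lemma almost_diametral_points_near_poles:
  assumes E: "unique_diameter a E" and "0 < r"
  obtains c where "0 < c"
    "\<And>x y. x \<in> E \<Longrightarrow> y \<in> E \<Longrightarrow> 2 * a - c < dist x y \<Longrightarrow>
       dist (left_pole a) x < r \<and> dist (right_pole a) y < r \<or>
       dist (left_pole a) y < r \<and> dist (right_pole a) x < r"
proof -
  let ?near = "ball (left_pole a) r \<times> ball (right_pole a) r \<union> ball (right_pole a) r \<times> ball (left_pole a) r"
  define S where "S = E \<times> E - ?near"
  have bd: "bounded E" and cl: "closed E" and a: "0 < a" and dm: "diameter E = 2 * a"
    and un: "\<And>x y. x \<in> E - {left_pole a, right_pole a} \<Longrightarrow> y \<in> E \<Longrightarrow> dist x y < 2 * a"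
    using E by (auto simp: unique_diameter_def)
  have "compact E" using bd cl by (simp add: compact_eq_bounded_closed)
  then have S: "compact S"
    unfolding S_def by (intro compact_diff compact_Times open_Un open_Times) auto
  have le: "dist x y \<le> 2 * a" if "x \<in> E" "y \<in> E" for x y
    using diameter_bounded_bound[OF bd that] dm by simp
  have lt: "dist x y < 2 * a" if "(x, y) \<in> S" for x y
  proof (rule ccontr)
    assume n: "\<not> dist x y < 2 * a"
    have xy: "x \<in> E" "y \<in> E" "(x, y) \<notin> ?near" using that by (auto simp: S_def)
    have "x \<in> {left_pole a, right_pole a}" using un[of x y] xy n by auto
    moreover have "y \<in> {left_pole a, right_pole a}" using un[of y x] xy n by (auto simp: dist_commute)
    moreover have "x \<noteq> y" using n a by auto
    ultimately show False using xy(3) \<open>0 < r\<close> by auto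
  qed
  have "\<exists>c>0. \<forall>(x, y)\<in>S. dist x y \<le> 2 * a - c"
  proof (cases "S = {}")
    case True
    then show ?thesis by (auto intro: exI[of _ 1])
  next
    case False
    obtain p where p: "p \<in> S" "\<And>q. q \<in> S \<Longrightarrow> dist (fst q) (snd q) \<le> dist (fst p) (snd p)"
      using continuous_attains_sup[OF S False, of "\<lambda>q. dist (fst q) (snd q)"]
    proof -
      have "continuous_on S (\<lambda>q. dist (fst q) (snd q))" by (intro continuous_intros)
      from continuous_attains_sup[OF S False this] show thesis using that by blast
    qed
    show ?thesis
      using lt[of "fst p" "snd p"] p by (intro exI[of _ "2 * a - dist (fst p) (snd p)"]) fastforce
  qed
  then obtain c where c: "0 < c" "\<And>x y. (x, y) \<in> S \<Longrightarrow> dist x y \<le> 2 * a - c" by blast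
  show thesis
  proof (rule that[OF c(1)])
    fix x y assume "x \<in> E" "y \<in> E" "2 * a - c < dist x y"
    then have "(x, y) \<in> ?near" using c(2)[of x y] by (auto simp: S_def)
    then show "dist (left_pole a) x < r \<and> dist (right_pole a) y < r \<or>
       dist (left_pole a) y < r \<and> dist (right_pole a) x < r" by auto
  qed
qed

text \<open>Combines a lower bound for the first coordinates (\<open>s\<close>) in terms of the Hessian forms (\<open>Q\<close>)
  with the curvature condition; \<open>\<theta> = 1 - \<eta>\<close> is what remains after the two have been balanced.\<close>

lemma linear_bound_from_curvature:
  fixes s Q T \<theta> :: real
  assumes "0 < \<theta>" "\<theta> < 1" "(8 - \<theta>) * Q \<le> 16 * s" "(8 - \<theta>) * s \<le> 8 * T + 4 * (1 - \<theta>) * Q" "0 \<le> s"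
  shows "s \<le> 2 * T / \<theta>"
proof -
  have "(8 - \<theta>) * (4 * (1 - \<theta>) * Q) \<le> 4 * (1 - \<theta>) * (16 * s)"
    using mult_left_mono[OF assms(3), of "4 * (1 - \<theta>)"] assms(2) by (simp add: algebra_simps)
  also have "\<dots> \<le> (8 - \<theta>) * ((8 - 7 * \<theta>) * s)"
  proof -
    \<comment> \<open>The difference of the two sides is \<open>7 * \<theta>^2\<close>.\<close>
    have "64 * (1 - \<theta>) \<le> (8 - \<theta>) * (8 - 7 * \<theta>)" by (simp add: algebra_simps)
    from mult_right_mono[OF this assms(5)] show ?thesis by (simp add: algebra_simps)
  qed
  finally have "4 * (1 - \<theta>) * Q \<le> (8 - 7 * \<theta>) * s" using assms(2) by simp
  with assms(4) have "6 * \<theta> * s \<le> 8 * T" by (simp add: algebra_simps)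
  then have "s * \<theta> \<le> 4 * T / 3" by (simp add: mult.commute)
  moreover have "0 \<le> s * \<theta>" using assms by simp
  ultimately have "s * \<theta> \<le> 2 * T" by linarith
  then show ?thesis using assms(1) by (simp add: pos_le_divide_eq)
qed


lemma pole_chart_surj:
  assumes "0 < h" "\<bar>\<sigma>\<bar> = 1"
  shows "pole_chart a \<sigma> h ((\<sigma> * fst z + a) / h\<^sup>2, snd z /\<^sub>R h) = z"
proof -
  have "\<sigma> = 1 \<or> \<sigma> = - 1" using assms(2) by linarith
  then show ?thesis using assms(1) by (auto simp: pole_chart_def)
qed

text \<open>The sign \<sigma> reflects the right pole to the left, so that every local argument is
  carried out once for both caps. The normalization \<open>s 0 = 0\<close> is recorded because the
  expansion at the minimum starts from it.\<close>

definition pole_cap :: "real \<Rightarrow> real \<Rightarrow> (real \<times> (real ^ 'm)) set \<Rightarrow> (real ^ 'm \<Rightarrow> real) \<Rightarrow> bool" where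
  "pole_cap a \<sigma> E s \<longleftrightarrow>
     (\<exists>\<delta> U. 0 < \<delta> \<and> 0 \<in> U \<and> s 0 = 0 \<and> (\<forall>u\<in>U. 0 \<le> s u) \<and> twice_continuously_differentiable_on s U \<and>
        (\<forall>z. \<sigma> * fst z < - a + \<delta> \<longrightarrow> (z \<in> E \<longleftrightarrow> - a + s (snd z) \<le> \<sigma> * fst z \<and> snd z \<in> U)))"

lemma smooth_pole_caps_imp_pole_cap:
  assumes "unique_diameter a E" "smooth_pole_caps a E sl sr"
  shows "pole_cap a 1 E sl" "pole_cap a (- 1) E sr"
proof -
  obtain \<delta>l \<delta>r Ol Or where c: "0 < \<delta>l" "\<delta>l \<le> a" "0 < \<delta>r" "\<delta>r \<le> a"
      "0 \<in> Ol" "0 \<in> Or" "\<forall>u \<in> Ol. 0 \<le> sl u" "\<forall>u \<in> Or. 0 \<le> sr u"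
      "twice_continuously_differentiable_on sl Ol" "twice_continuously_differentiable_on sr Or"
      and l: "E \<inter> {z. fst z < - a + \<delta>l} =
          {z. - a + sl (snd z) \<le> fst z \<and> fst z < - a + \<delta>l \<and> snd z \<in> Ol}"
      and r: "E \<inter> {z. a - \<delta>r < fst z} =
          {z. a - \<delta>r < fst z \<and> fst z \<le> a - sr (snd z) \<and> snd z \<in> Or}"
    using assms(2) unfolding smooth_pole_caps_def by blast
  have p: "left_pole a \<in> E" "right_pole a \<in> E" using assms(1) by (auto simp: unique_diameter_def)
  \<comment> \<open>Membership of the pole in the cap gives \<open>sl 0 <= 0\<close>, and
    \<open>sl\<close> is nonnegative at 0.\<close>
  have "left_pole a \<in> E \<inter> {z. fst z < - a + \<delta>l}" using p c by (simp add: left_pole_def)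
  then have l0: "sl 0 = 0" unfolding l using c by (auto simp: left_pole_def intro: antisym)
  have "right_pole a \<in> E \<inter> {z. a - \<delta>r < fst z}" using p c by (simp add: right_pole_def)
  then have r0: "sr 0 = 0" unfolding r using c by (auto simp: right_pole_def intro: antisym)
  have l': "z \<in> E \<longleftrightarrow> - a + sl (snd z) \<le> fst z \<and> snd z \<in> Ol" if "fst z < - a + \<delta>l" for z
    using l that by blast
  have r': "z \<in> E \<longleftrightarrow> fst z \<le> a - sr (snd z) \<and> snd z \<in> Or" if "a - \<delta>r < fst z" for z
    using r that by blast
  show "pole_cap a 1 E sl"
    unfolding pole_cap_def using c l0 l' by (intro exI[of _ \<delta>l] exI[of _ Ol]) simp
  show "pole_cap a (- 1) E sr"
    unfolding pole_cap_def using c r0 r' 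
  proof (intro exI[of _ \<delta>r] exI[of _ Or] conjI allI impI)
    fix z :: "real \<times> (real ^ 'a)" assume "- 1 * fst z < - a + \<delta>r"
    then have "a - \<delta>r < fst z" by simp
    moreover have "fst z \<le> a - sr (snd z) \<longleftrightarrow> - a + sr (snd z) \<le> - 1 * fst z" by linarith
    ultimately show "(z \<in> E) = (- a + sr (snd z) \<le> - 1 * fst z \<and> snd z \<in> Or)"
      using r' by simp
  qed auto
qed

text \<open>The radius \<open>r\<close> is independent of \<open>h\<close>: the chart scales heights
  by \<open>h^2\<close> and lateral coordinates by \<open>h\<close>, so a quadratic lower bound for
  the boundary function keeps its form at every scale. The \<epsilon>-term flattens the paraboloid
  to absorb the Taylor remainder.\<close>

lemma pole_cap_above_paraboloid:
  assumes cap: "pole_cap a \<sigma> E s" and \<sigma>: "\<bar>\<sigma>\<bar> = 1" and "0 < \<epsilon>"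
  obtains r where "0 < r"
    "\<And>z h. z \<in> E \<Longrightarrow> dist (- \<sigma> * a, 0) z < r \<Longrightarrow> 0 < h \<Longrightarrow>
      \<exists>x. z = pole_chart a \<sigma> h x \<and> 0 \<le> fst x \<and> h\<^sup>2 * fst x < r \<and>
        1 / 2 * (snd x \<bullet> (hessian s 0 *v snd x)) - \<epsilon> * (norm (snd x))\<^sup>2 \<le> fst x"
proof -
  obtain \<delta> U where c: "0 < \<delta>" "0 \<in> U" "s 0 = 0" "\<And>u. u \<in> U \<Longrightarrow> 0 \<le> s u"
      "twice_continuously_differentiable_on s U"
      and E: "\<And>z. \<sigma> * fst z < - a + \<delta> \<Longrightarrow> z \<in> E \<longleftrightarrow> - a + s (snd z) \<le> \<sigma> * fst z \<and> snd z \<in> U"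
    using cap unfolding pole_cap_def by blast
  obtain r1 where r1: "0 < r1"
    "\<And>u. norm u < r1 \<Longrightarrow> u \<in> U \<and> \<bar>s u - 1 / 2 * (u \<bullet> (hessian s 0 *v u))\<bar> \<le> \<epsilon> * (norm u)\<^sup>2"
    using second_order_expansion_at_minimum[OF c(5,2,3,4) \<open>0 < \<epsilon>\<close>] by blast
  show thesis
  proof (rule that[of "min \<delta> r1"])
    show "0 < min \<delta> r1" using c(1) r1(1) by simp
    fix z :: "real \<times> (real ^ 'a)" and h :: real
    assume z: "z \<in> E" "dist (- \<sigma> * a, 0) z < min \<delta> r1" and h: "0 < h"
    define x where "x = ((\<sigma> * fst z + a) / h\<^sup>2, snd z /\<^sub>R h)"
    have zx: "z = pole_chart a \<sigma> h x" unfolding x_def by (rule pole_chart_surj[OF h \<sigma>, symmetric])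
    have d: "\<bar>- \<sigma> * a - fst z\<bar> < min \<delta> r1" "norm (snd z) < min \<delta> r1"
      using z(2) dist_fst_le[of "(- \<sigma> * a, 0)" z] dist_snd_le[of "(- \<sigma> * a, 0)" z]
      by (simp_all add: dist_real_def dist_norm)
    have d': "\<sigma> * fst z + a < min \<delta> r1"
      using d(1) \<sigma> by (auto simp: abs_if split: if_splits)
    have "- a + s (snd z) \<le> \<sigma> * fst z" "0 \<le> s (snd z)"
      using E[of z] z(1) d' c(4) by auto
    moreover have "\<bar>s (snd z) - 1 / 2 * (snd z \<bullet> (hessian s 0 *v snd z))\<bar> \<le> \<epsilon> * (norm (snd z))\<^sup>2"
      using r1(2) d(2) by simp
    moreover have sz: "snd z = h *\<^sub>R snd x" and fz: "\<sigma> * fst z + a = h\<^sup>2 * fst x"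
      using h by (simp_all add: x_def)
    ultimately have 1: "0 \<le> h\<^sup>2 * fst x" "h\<^sup>2 * (1 / 2 * (snd x \<bullet> (hessian s 0 *v snd x)) - \<epsilon> * (norm (snd x))\<^sup>2) \<le> h\<^sup>2 * fst x"
      by (simp_all add: matrix_vector_mult_scaleR power_mult_distrib power2_eq_square[of h] algebra_simps)
    have "h\<^sup>2 * fst x < min \<delta> r1" using d' fz by simp
    moreover have "0 \<le> fst x" "1 / 2 * (snd x \<bullet> (hessian s 0 *v snd x)) - \<epsilon> * (norm (snd x))\<^sup>2 \<le> fst x"
      using 1 h by (simp_all add: zero_le_mult_iff mult_le_cancel_left)
    ultimately show "\<exists>x. z = pole_chart a \<sigma> h x \<and> 0 \<le> fst x \<and> h\<^sup>2 * fst x < min \<delta> r1 \<and>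
        1 / 2 * (snd x \<bullet> (hessian s 0 *v snd x)) - \<epsilon> * (norm (snd x))\<^sup>2 \<le> fst x"
      using zx by blast
  qed
qed


section \<open>Confinement of the relevant pairs, in the sample and in the limit\<close>

lemma norm_le_add_sqrt:
  fixes x :: "real \<times> 'a :: real_normed_vector"
  assumes "0 \<le> fst x" "fst x \<le> S" "(norm (snd x))\<^sup>2 \<le> R"
  shows "norm x \<le> S + sqrt R"
  using norm_Pair_le[of "fst x" "snd x"] assms real_le_rsqrt[OF assms(3)] by simp

lemma norm_le_add_sqrt2:
  fixes x y :: "real \<times> 'a :: real_normed_vector"
  assumes "0 \<le> fst x" "0 \<le> fst y" "fst x + fst y \<le> S" "(norm (snd x))\<^sup>2 + (norm (snd y))\<^sup>2 \<le> R"
  shows "norm x \<le> S + sqrt R" "norm y \<le> S + sqrt R"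
proof -
  have "(norm (snd x))\<^sup>2 \<le> R" "(norm (snd y))\<^sup>2 \<le> R"
    using assms(4) zero_le_power2[of "norm (snd x)"] zero_le_power2[of "norm (snd y)"] by linarith+
  then show "norm x \<le> S + sqrt R" "norm y \<le> S + sqrt R"
    using assms by (auto intro!: norm_le_add_sqrt)
qed

text \<open>Compactness first brings the two points near the poles. There the sum \<open>s\<close>
  of the heights and the sum \<open>Q\<close> of the Hessian forms bound each other: the caps lie
  above flattened paraboloids (\<open>F1\<close>), and a small gap together with curvature bounds
  \<open>s\<close> by \<open>Q\<close> (\<open>F2\<close>). Because \<eta> is below 1 the two
  inequalities can be closed up.\<close>

lemma almost_diametral_pairs_in_window:
  assumes E: "unique_diameter a E" and l: "pole_cap a 1 E sl" and r: "pole_cap a (- 1) E sr"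
    and curv: "\<And>x y. (norm (x - y))\<^sup>2 \<le> 2 * a * \<eta> * (x \<bullet> (hessian sl 0 *v x) + y \<bullet> (hessian sr 0 *v y))"
    and \<eta>: "0 < \<eta>" "\<eta> < 1" and T: "0 < T"
  obtains K h0 where "0 < h0"
    "\<And>h z w. 0 < h \<Longrightarrow> h < h0 \<Longrightarrow> z \<in> E \<Longrightarrow> w \<in> E \<Longrightarrow> scaled_gap a h z w \<le> T \<Longrightarrow>
      (\<exists>x y. norm x \<le> K \<and> norm y \<le> K \<and>
        (z = pole_chart a 1 h x \<and> w = pole_chart a (- 1) h y \<or>
         w = pole_chart a 1 h x \<and> z = pole_chart a (- 1) h y))"
proof -
  have a: "0 < a" and bd: "bounded E" and dm: "diameter E = 2 * a"
    using E by (auto simp: unique_diameter_def)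
  define \<theta> where "\<theta> = 1 - \<eta>"
  have \<theta>: "0 < \<theta>" "\<theta> < 1" using \<eta> by (auto simp: \<theta>_def)
  \<comment> \<open>Chosen so that the total Taylor error \<open>\<epsilon> * (2 * a * Q)\<close>
    equals \<open>\<theta> * Q / 16\<close>.\<close>
  define \<epsilon> where "\<epsilon> = \<theta> / (32 * a)"
  have \<epsilon>: "0 < \<epsilon>" using \<theta> a by (simp add: \<epsilon>_def)
  let ?ql = "\<lambda>u. u \<bullet> (hessian sl 0 *v u)" and ?qr = "\<lambda>u. u \<bullet> (hessian sr 0 *v u)"
  obtain rl where rl: "0 < rl"
    "\<And>z h. z \<in> E \<Longrightarrow> dist (- 1 * a, 0) z < rl \<Longrightarrow> 0 < h \<Longrightarrow>
      \<exists>x. z = pole_chart a 1 h x \<and> 0 \<le> fst x \<and> h\<^sup>2 * fst x < rl \<and>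
        1 / 2 * ?ql (snd x) - \<epsilon> * (norm (snd x))\<^sup>2 \<le> fst x"
    using pole_cap_above_paraboloid[OF l _ \<epsilon>] by (metis abs_one)
  obtain rr where rr: "0 < rr"
    "\<And>z h. z \<in> E \<Longrightarrow> dist (- (- 1) * a, 0) z < rr \<Longrightarrow> 0 < h \<Longrightarrow>
      \<exists>x. z = pole_chart a (- 1) h x \<and> 0 \<le> fst x \<and> h\<^sup>2 * fst x < rr \<and>
        1 / 2 * ?qr (snd x) - \<epsilon> * (norm (snd x))\<^sup>2 \<le> fst x"
    using pole_cap_above_paraboloid[OF r _ \<epsilon>] by (metis abs_minus_cancel abs_one)
  \<comment> \<open>The bound \<open>a * \<theta> / 4\<close> at each pole yields
    \<open>h^2 * s <= a * \<theta> / 2\<close>, hence the error \<open>h^2 * s^2 / (4 * a)\<close>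
    of the expansion is at most \<open>\<theta> * s / 8\<close>.\<close>
  define r0 where "r0 = min (min rl rr) (a * \<theta> / 4)"
  have r0: "0 < r0" using rl(1) rr(1) a \<theta> by (simp add: r0_def)
  obtain c where c: "0 < c"
    "\<And>x y. x \<in> E \<Longrightarrow> y \<in> E \<Longrightarrow> 2 * a - c < dist x y \<Longrightarrow>
       dist (left_pole a) x < r0 \<and> dist (right_pole a) y < r0 \<or>
       dist (left_pole a) y < r0 \<and> dist (right_pole a) x < r0"
    using almost_diametral_points_near_poles[OF E r0] by blast
  \<comment> \<open>For \<open>h < h0\<close> a scaled gap of at most \<open>T\<close> means
    \<open>2 * a - dist z w <= T * h^2 < c\<close>.\<close>
  define h0 where "h0 = sqrt (c / T)"
  define S where "S = 2 * T / \<theta>"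
  \<comment> \<open>The lateral squares add up to at most \<open>2 * a * Q\<close>, and
    \<open>F1\<close> with \<open>\<theta> < 1\<close> gives \<open>Q <= 16 / 7 * s\<close>;
    \<open>8 * a * S\<close> is a round upper bound.\<close>
  define K where "K = S + sqrt (8 * a * S)"
  have *: "\<exists>x y. norm x \<le> K \<and> norm y \<le> K \<and> z = pole_chart a 1 h x \<and> w = pole_chart a (- 1) h y"
    if h: "0 < h" and zw: "z \<in> E" "w \<in> E" and u: "scaled_gap a h z w \<le> T"
      and near: "dist (left_pole a) z < r0" "dist (right_pole a) w < r0" for h z w
  proof -
    obtain x where x: "z = pole_chart a 1 h x" "0 \<le> fst x"
        "1 / 2 * ?ql (snd x) - \<epsilon> * (norm (snd x))\<^sup>2 \<le> fst x"
      using rl(2)[OF zw(1) _ h] near(1) by (auto simp: r0_def left_pole_def)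
    obtain y where y: "w = pole_chart a (- 1) h y" "0 \<le> fst y"
        "1 / 2 * ?qr (snd y) - \<epsilon> * (norm (snd y))\<^sup>2 \<le> fst y"
      using rr(2)[OF zw(2) _ h] near(2) by (auto simp: r0_def right_pole_def)
    define s where "s = fst x + fst y"
    define Q where "Q = ?ql (snd x) + ?qr (snd y)"
    have s0: "0 \<le> s" using x y by (simp add: s_def)
    have "\<bar>- a - fst z\<bar> < r0" "\<bar>a - fst w\<bar> < r0"
      using near dist_fst_le[of "left_pole a" z] dist_fst_le[of "right_pole a" w]
      by (simp_all add: left_pole_def right_pole_def dist_real_def)
    then have hs: "h\<^sup>2 * s \<le> a * \<theta> / 2"
    proof -
      have "fst z + a = h\<^sup>2 * fst x" "a - fst w = h\<^sup>2 * fst y" "r0 \<le> a * \<theta> / 4"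
        by (simp_all add: x(1) y(1) pole_chart_def r0_def)
      moreover have "fst z + a < r0" "a - fst w < r0"
        using \<open>\<bar>- a - fst z\<bar> < r0\<close> \<open>\<bar>a - fst w\<bar> < r0\<close> by linarith+
      ultimately show ?thesis unfolding s_def distrib_left by linarith
    qed
    have "0 \<le> ?ql (snd x)" "0 \<le> ?qr (snd y)"
      using order_trans[OF zero_le_power2 curv[of "snd x" 0]] order_trans[OF zero_le_power2 curv[of 0 "snd y"]]
        mult_pos_pos[OF a \<eta>(1)] by (simp_all add: zero_le_mult_iff mult.commute)
    then have Q0: "0 \<le> Q" by (simp add: Q_def)
    have n: "(norm (snd x))\<^sup>2 + (norm (snd y))\<^sup>2 \<le> 2 * a * Q"
    proof -
      have "(norm (snd x))\<^sup>2 + (norm (snd y))\<^sup>2 \<le> 2 * a * \<eta> * Q"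
        using curv[of "snd x" 0] curv[of 0 "snd y"] by (simp add: Q_def distrib_left)
      also have "\<dots> \<le> 2 * a * 1 * Q" using \<eta> a Q0 by (intro mult_right_mono mult_left_mono) auto
      finally show ?thesis by simp
    qed
    have "\<epsilon> * ((norm (snd x))\<^sup>2 + (norm (snd y))\<^sup>2) \<le> \<epsilon> * (2 * a * Q)"
      using n \<epsilon> by (intro mult_left_mono) auto
    also have "\<dots> = \<theta> * Q / 16" using a by (simp add: \<epsilon>_def)
    finally have "1 / 2 * Q - \<theta> * Q / 16 \<le> s"
      using x(3) y(3) unfolding s_def distrib_left Q_def[symmetric]
      by (simp only: Q_def distrib_left)
    then have F1: "(8 - \<theta>) * Q \<le> 16 * s" by (simp add: algebra_simps)
    let ?u = "scaled_gap a h z w"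
    have u0: "0 \<le> ?u"
      using diameter_bounded_bound[OF bd zw] dm by (simp add: scaled_gap_def)
    have ug: "?u = gap a x y + h\<^sup>2 * (?u\<^sup>2 - s\<^sup>2) / (4 * a)"
      unfolding x(1) y(1) s_def by (rule scaled_gap_eq_gap[OF a h])
    have "gap a x y \<le> T + (h\<^sup>2 * s) * s / (4 * a)"
    proof -
      have "0 \<le> h\<^sup>2 * ?u\<^sup>2 / (4 * a)" using a by simp
      moreover have "h\<^sup>2 * (?u\<^sup>2 - s\<^sup>2) / (4 * a) = h\<^sup>2 * ?u\<^sup>2 / (4 * a) - (h\<^sup>2 * s) * s / (4 * a)"
        by (simp add: power2_eq_square algebra_simps diff_divide_distrib)
      ultimately show ?thesis using ug u by linarith
    qed
    also have "(h\<^sup>2 * s) * s / (4 * a) \<le> (a * \<theta> / 2) * s / (4 * a)"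
      using hs s0 a by (intro divide_right_mono mult_right_mono) auto
    also have "(a * \<theta> / 2) * s / (4 * a) = \<theta> * s / 8" using a by simp
    finally have g: "gap a x y \<le> T + \<theta> * s / 8" by simp
    have "(norm (snd x - snd y))\<^sup>2 / (4 * a) \<le> 2 * a * \<eta> * Q / (4 * a)"
      using curv[of "snd x" "snd y"] a unfolding Q_def by (intro divide_right_mono) auto
    also have "\<dots> = (1 - \<theta>) * Q / 2" using a by (simp add: \<theta>_def)
    finally have "s - (1 - \<theta>) * Q / 2 \<le> gap a x y" by (simp add: gap_def s_def)
    with g have "8 * s - 4 * ((1 - \<theta>) * Q) \<le> 8 * T + \<theta> * s" by linarith
    then have F2: "(8 - \<theta>) * s \<le> 8 * T + 4 * (1 - \<theta>) * Q" by (simp add: algebra_simps)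
    have sS: "s \<le> S" unfolding S_def by (rule linear_bound_from_curvature[OF \<theta> F1 F2 s0])
    have "7 * Q \<le> (8 - \<theta>) * Q" using \<theta> Q0 by (intro mult_right_mono) auto
    then have "Q \<le> 16 / 7 * s" using F1 by linarith
    moreover have "16 / 7 * s \<le> 2 * (8 / 7 * s)" by simp
    ultimately have "2 * a * Q \<le> 2 * a * (16 / 7 * S)"
      using sS a by (intro mult_left_mono) linarith+
    then have n': "(norm (snd x))\<^sup>2 + (norm (snd y))\<^sup>2 \<le> 8 * a * S"
      using n sS s0 mult_nonneg_nonneg[of a S] a by linarith
    have "norm x \<le> K" "norm y \<le> K"
      unfolding K_def using norm_le_add_sqrt2[OF x(2) y(2) sS[unfolded s_def] n'] by auto
    then show ?thesis using x(1) y(1) by blast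
  qed
  show thesis
  proof (rule that[of h0 K])
    show "0 < h0" using c T by (simp add: h0_def)
    fix h z w assume h: "0 < h" "h < h0" and zw: "z \<in> E" "w \<in> E" and u: "scaled_gap a h z w \<le> T"
    have "h\<^sup>2 < h0\<^sup>2" using h by (intro power_strict_mono) auto
    then have "h\<^sup>2 < c / T" using c T by (simp add: h0_def)
    then have "T * h\<^sup>2 < c" using T by (simp add: pos_less_divide_eq mult.commute)
    moreover have "2 * a - dist z w \<le> T * h\<^sup>2" using u h by (simp add: scaled_gap_def pos_divide_le_eq)
    ultimately have "2 * a - c < dist z w" by simp
    from c(2)[OF zw this] *[OF h(1) zw u] *[OF h(1) zw(2,1)] u
    show "\<exists>x y. norm x \<le> K \<and> norm y \<le> K \<and>
        (z = pole_chart a 1 h x \<and> w = pole_chart a (- 1) h y \<or>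
         w = pole_chart a 1 h x \<and> z = pole_chart a (- 1) h y)"
      unfolding scaled_gap_commute[of a h w z] by blast
  qed
qed

text \<open>The confinement in the limit, without error terms. On the paraboloids
  \<open>Q <= 2 * s\<close>, so curvature bounds the subtracted square in \<open>gap\<close> by
  \<open>\<eta> * s\<close>, which leaves \<open>gap a x y >= (1 - \<eta>) * s\<close>.\<close>

lemma paraboloid_gap_bounds:
  assumes curv: "\<And>x y. (norm (x - y))\<^sup>2 \<le> 2 * a * \<eta> * (x \<bullet> (Hl *v x) + y \<bullet> (Hr *v y))"
    and a: "0 < a" and \<eta>: "0 < \<eta>" "\<eta> < 1"
    and x: "x \<in> paraboloid Hl" and y: "y \<in> paraboloid Hr"
  shows "0 \<le> gap a x y"
    and "gap a x y \<le> T \<Longrightarrow> norm x \<le> T / (1 - \<eta>) + sqrt (4 * a * (T / (1 - \<eta>)))"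
    and "gap a x y \<le> T \<Longrightarrow> norm y \<le> T / (1 - \<eta>) + sqrt (4 * a * (T / (1 - \<eta>)))"
proof -
  define s where "s = fst x + fst y"
  define Q where "Q = snd x \<bullet> (Hl *v snd x) + snd y \<bullet> (Hr *v snd y)"
  have "0 \<le> snd x \<bullet> (Hl *v snd x)" "0 \<le> snd y \<bullet> (Hr *v snd y)"
    using order_trans[OF zero_le_power2 curv[of "snd x" 0]] order_trans[OF zero_le_power2 curv[of 0 "snd y"]]
      mult_pos_pos[OF a \<eta>(1)] by (simp_all add: zero_le_mult_iff mult.commute)
  then have f: "0 \<le> fst x" "0 \<le> fst y" and Q0: "0 \<le> Q" and Qs: "Q \<le> 2 * s"
    using x y by (simp_all add: paraboloid_def s_def Q_def)
  have "(norm (snd x - snd y))\<^sup>2 / (4 * a) \<le> 2 * a * \<eta> * Q / (4 * a)"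
    using curv[of "snd x" "snd y"] a unfolding Q_def by (intro divide_right_mono) auto
  also have "\<dots> = \<eta> * Q / 2" using a by simp
  also have "\<dots> \<le> \<eta> * s" using Qs \<eta> by simp
  finally have g: "(1 - \<eta>) * s \<le> gap a x y" by (simp add: gap_def s_def algebra_simps)
  moreover have "0 \<le> (1 - \<eta>) * s" using f \<eta> by (simp add: s_def)
  ultimately show "0 \<le> gap a x y" by linarith
  have n: "(norm (snd x))\<^sup>2 + (norm (snd y))\<^sup>2 \<le> 4 * a * s"
  proof -
    have "(norm (snd x))\<^sup>2 + (norm (snd y))\<^sup>2 \<le> 2 * a * \<eta> * Q"
      using curv[of "snd x" 0] curv[of 0 "snd y"] by (simp add: Q_def distrib_left)
    also have "\<dots> \<le> 2 * a * 1 * (2 * s)" using \<eta> a Q0 Qs by (intro mult_mono mult_left_mono) auto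
    finally show ?thesis by simp
  qed
  show "norm x \<le> T / (1 - \<eta>) + sqrt (4 * a * (T / (1 - \<eta>)))"
    and "norm y \<le> T / (1 - \<eta>) + sqrt (4 * a * (T / (1 - \<eta>)))" if "gap a x y \<le> T"
  proof -
    have "(1 - \<eta>) * s \<le> T" using g that by simp
    then have S: "s \<le> T / (1 - \<eta>)" using \<eta> by (simp add: pos_le_divide_eq mult.commute)
    then have "4 * a * s \<le> 4 * a * (T / (1 - \<eta>))" using a by (intro mult_left_mono) auto
    with n have "(norm (snd x))\<^sup>2 + (norm (snd y))\<^sup>2 \<le> 4 * a * (T / (1 - \<eta>))" by simp
    from norm_le_add_sqrt2[OF f S[unfolded s_def] this]
    show "norm x \<le> T / (1 - \<eta>) + sqrt (4 * a * (T / (1 - \<eta>)))"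
      and "norm y \<le> T / (1 - \<eta>) + sqrt (4 * a * (T / (1 - \<eta>)))"
      by auto
  qed
qed

section \<open>Convergence of the intensities\<close>

lemma continuous_on_pole_chart: "continuous_on A (pole_chart a \<sigma> h)"
  unfolding pole_chart_def[abs_def] by (intro continuous_intros)

lemma pole_chart_measurable [measurable]: "pole_chart a \<sigma> h \<in> borel_measurable borel"
  by (intro borel_measurable_continuous_onI continuous_on_pole_chart)

lemma pole_chart_inject:
  assumes "0 < h" "\<bar>\<sigma>\<bar> = 1"
  shows "pole_chart a \<sigma> h x = pole_chart a \<sigma> h y \<longleftrightarrow> x = y"
  using assms by (auto simp: pole_chart_def prod_eq_iff)

lemma pole_chart_image_borel:
  assumes "0 < h" "\<bar>\<sigma>\<bar> = 1" "B \<in> sets borel"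
  shows "pole_chart a \<sigma> h ` B \<in> sets borel"
proof -
  define \<psi> where "\<psi> z = ((\<sigma> * fst z + a) / h\<^sup>2, snd z /\<^sub>R h)" for z :: "real \<times> (real ^ 'a)"
  have 1: "pole_chart a \<sigma> h (\<psi> z) = z" for z
    unfolding \<psi>_def by (rule pole_chart_surj[OF assms(1,2)])
  have "pole_chart a \<sigma> h ` B = \<psi> -` B"
  proof (intro set_eqI iffI)
    fix z assume "z \<in> pole_chart a \<sigma> h ` B"
    then obtain x where x: "x \<in> B" "z = pole_chart a \<sigma> h x" by auto
    have "\<psi> z = x" using 1[of z] x(2) pole_chart_inject[OF assms(1,2)] by metis
    then show "z \<in> \<psi> -` B" using x(1) by simp
  next
    fix z assume "z \<in> \<psi> -` B"
    then show "z \<in> pole_chart a \<sigma> h ` B" using 1[of z] by (metis imageI vimageD)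
  qed
  moreover have "continuous_on UNIV \<psi>" unfolding \<psi>_def using assms(1) by (intro continuous_intros) auto
  then have "\<psi> \<in> borel_measurable borel" by (rule borel_measurable_continuous_onI)
  ultimately show ?thesis using measurable_sets[of \<psi> borel borel B] assms(3) by simp
qed

lemma pole_in_pole_cap:
  assumes "pole_cap a \<sigma> E s" "\<bar>\<sigma>\<bar> = 1"
  shows "(- \<sigma> * a, 0) \<in> E"
proof -
  have "\<sigma> = 1 \<or> \<sigma> = - 1" using assms(2) by linarith
  then show ?thesis using assms(1) unfolding pole_cap_def by fastforce
qed

lemma closed_paraboloid: "closed (paraboloid H)"
  unfolding paraboloid_def
  by (intro closed_Collect_le continuous_intros continuous_on_compose2[OF matrix_vector_mult_linear_continuous_on]) auto

text \<open>One coordinate is scaled by \<open>h^2\<close> and \<open>CARD('m)\<close> coordinates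
  by \<open>h\<close>; the Jacobian exponent \<open>CARD('m) + 2\<close> is \<open>d + 1\<close>.
  The chart is written as a diagonal affine map in the standard basis.\<close>

lemma lborel_integral_pole_chart:
  fixes F :: "real \<times> (real ^ 'm) \<Rightarrow> real"
  assumes h: "0 < h" and \<sigma>: "\<bar>\<sigma>\<bar> = 1" and F[measurable]: "F \<in> borel_measurable borel"
  shows "(\<integral>z. F z \<partial>lborel) = h ^ (CARD('m) + 2) * (\<integral>x. F (pole_chart a \<sigma> h x) \<partial>lborel)"
proof -
  let ?e = "(1, 0) :: real \<times> (real ^ 'm)"
  define c where "c j = (if j = ?e then \<sigma> * h\<^sup>2 else h)" for j :: "real \<times> (real ^ 'm)"
  define t where "t = (- (\<sigma> * a), 0 :: real ^ 'm)"
  have e: "?e \<in> Basis" by (simp add: Basis_prod_def)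
  have c0: "c j \<noteq> 0" for j using h \<sigma> by (auto simp: c_def)
  have T: "t + (\<Sum>j\<in>Basis. (c j * (x \<bullet> j)) *\<^sub>R j) = pole_chart a \<sigma> h x" for x
  proof (rule euclidean_eqI)
    fix b :: "real \<times> (real ^ 'm)" assume b: "b \<in> Basis"
    have "(t + (\<Sum>j\<in>Basis. (c j * (x \<bullet> j)) *\<^sub>R j)) \<bullet> b = t \<bullet> b + c b * (x \<bullet> b)"
      using b by (simp add: inner_add_left)
    also have "\<dots> = pole_chart a \<sigma> h x \<bullet> b"
      using b by (auto simp: Basis_prod_def c_def t_def pole_chart_def inner_prod_def algebra_simps)
    finally show "(t + (\<Sum>j\<in>Basis. (c j * (x \<bullet> j)) *\<^sub>R j)) \<bullet> b = pole_chart a \<sigma> h x \<bullet> b" .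
  qed
  have "(\<Prod>j\<in>Basis. \<bar>c j\<bar>) = \<bar>c ?e\<bar> * (\<Prod>j\<in>Basis - {?e}. \<bar>c j\<bar>)"
    using e by (simp add: prod.remove)
  also have "(\<Prod>j\<in>Basis - {?e}. \<bar>c j\<bar>) = (\<Prod>j\<in>Basis - {?e}. h)"
    using h by (intro prod.cong) (auto simp: c_def)
  also have "\<dots> = h ^ CARD('m)"
    using e by simp
  finally have det: "(\<Prod>j\<in>Basis. \<bar>c j\<bar>) = h ^ (CARD('m) + 2)"
    using \<sigma> h by (simp add: c_def abs_mult power_add power2_eq_square)
  have lb: "(lborel :: (real \<times> (real ^ 'm)) measure) = density (distr lborel borel (pole_chart a \<sigma> h)) (\<lambda>_. ennreal (h ^ (CARD('m) + 2)))"
    using lborel_affine_euclidean[where c = c and t = t, OF c0] unfolding T det .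
  show ?thesis
    by (subst lb, subst integral_density) (use h in \<open>simp_all add: integral_distr\<close>)
qed

text \<open>By Fubini a graph is null, since each section is a single point. Applied to the boundary
  of the paraboloid, where membership in the blown-up cap may fail to converge.\<close>

lemma AE_lborel_fst_neq:
  fixes \<phi> :: "'b :: euclidean_space \<Rightarrow> 'a :: euclidean_space"
  assumes "continuous_on UNIV \<phi>"
  shows "AE x in lborel. fst x \<noteq> \<phi> (snd x)"
proof -
  let ?A = "{x. fst x = \<phi> (snd x)}"
  have A: "?A \<in> sets (lborel \<Otimes>\<^sub>M lborel)"
    unfolding lborel_prod sets_lborel
    by (intro borel_closed closed_Collect_eq continuous_intros continuous_on_compose2[OF assms]) auto
  have "emeasure (lborel \<Otimes>\<^sub>M lborel) ?A = (\<integral>\<^sup>+ y. emeasure lborel ((\<lambda>x. (x, y)) -` ?A) \<partial>lborel)"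
    by (rule lborel_pair.emeasure_pair_measure_alt2[OF A])
  also have "(\<lambda>y. (\<lambda>x. (x, y)) -` ?A) = (\<lambda>y. {\<phi> y})" by auto
  then have "(\<integral>\<^sup>+ y. emeasure lborel ((\<lambda>x. (x, y)) -` ?A) \<partial>lborel) = 0" by (simp add: fun_eq_iff)
  finally have "?A \<in> null_sets lborel" using A unfolding lborel_prod null_sets_def by simp
  then show ?thesis by (rule AE_I') auto
qed

text \<open>The blown-up boundary function tends pointwise to half the Hessian form, so any point
  strictly on one side of the limiting boundary is eventually on the same side of the blown-up
  one.\<close>

lemma pole_chart_eventually_in_cap:
  assumes cap: "pole_cap a \<sigma> E s" and \<sigma>: "\<bar>\<sigma>\<bar> = 1"
    and h: "h \<longlonglongrightarrow> 0" "\<And>n. 1 \<le> n \<Longrightarrow> 0 < h n"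
    and ne: "fst x \<noteq> 1 / 2 * (snd x \<bullet> (hessian s 0 *v snd x))"
  shows "eventually (\<lambda>n. pole_chart a \<sigma> (h n) x \<in> E \<longleftrightarrow> x \<in> paraboloid (hessian s 0)) sequentially"
proof -
  obtain \<delta> U where c: "0 < \<delta>" "0 \<in> U" "s 0 = 0" "\<And>u. u \<in> U \<Longrightarrow> 0 \<le> s u"
      "twice_continuously_differentiable_on s U"
      and E: "\<And>z. \<sigma> * fst z < - a + \<delta> \<Longrightarrow> z \<in> E \<longleftrightarrow> - a + s (snd z) \<le> \<sigma> * fst z \<and> snd z \<in> U"
    using cap unfolding pole_cap_def by blast
  define q where "q = 1 / 2 * (snd x \<bullet> (hessian s 0 *v snd x))"
  \<comment> \<open>Makes the Taylor error at \<open>snd x\<close> smaller than the vertical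
    distance of \<open>x\<close> from the paraboloid's boundary; the summand 1 covers
    \<open>snd x = 0\<close>.\<close>
  define \<epsilon> where "\<epsilon> = \<bar>fst x - q\<bar> / (2 * ((norm (snd x))\<^sup>2 + 1))"
  have np: "0 < 2 * ((norm (snd x))\<^sup>2 + 1)" by (simp add: add_nonneg_pos)
  then have \<epsilon>: "0 < \<epsilon>" using ne by (simp add: \<epsilon>_def q_def)
  have "(norm (snd x))\<^sup>2 < 2 * ((norm (snd x))\<^sup>2 + 1)"
  proof -
    have *: "t < 2 * (t + 1)" if "0 \<le> t" for t :: real using that by simp
    show ?thesis by (rule *) simp
  qed
  then have "\<epsilon> * (norm (snd x))\<^sup>2 < \<epsilon> * (2 * ((norm (snd x))\<^sup>2 + 1))"
    using \<epsilon> by (rule mult_strict_left_mono)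
  also have "\<dots> = \<bar>fst x - q\<bar>" using np by (simp add: \<epsilon>_def)
  finally have \<epsilon>x: "\<epsilon> * (norm (snd x))\<^sup>2 < \<bar>fst x - q\<bar>" .
  obtain r where r: "0 < r"
    "\<And>u. norm u < r \<Longrightarrow> u \<in> U \<and> \<bar>s u - 1 / 2 * (u \<bullet> (hessian s 0 *v u))\<bar> \<le> \<epsilon> * (norm u)\<^sup>2"
    using second_order_expansion_at_minimum[OF c(5,2,3,4) \<epsilon>] by blast
  have "(\<lambda>n. (h n)\<^sup>2 * fst x) \<longlonglongrightarrow> 0\<^sup>2 * fst x" by (intro tendsto_intros h)
  then have "eventually (\<lambda>n. (h n)\<^sup>2 * fst x < \<delta>) sequentially"
    using c(1) by (intro order_tendstoD(2)) auto
  moreover have "(\<lambda>n. norm (h n *\<^sub>R snd x)) \<longlonglongrightarrow> norm (0 *\<^sub>R snd x)" by (intro tendsto_intros h)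
  then have "eventually (\<lambda>n. norm (h n *\<^sub>R snd x) < r) sequentially"
    using r(1) by (intro order_tendstoD(2)) auto
  moreover have "eventually (\<lambda>n. 1 \<le> n) sequentially" by (rule eventually_ge_at_top)
  ultimately show ?thesis
  proof eventually_elim
    case (elim n)
    have \<sigma>2: "\<sigma> * (\<sigma> * t) = t" for t
    proof -
      have "\<sigma> = 1 \<or> \<sigma> = - 1" using \<sigma> by linarith
      then show ?thesis by auto
    qed
    have hn: "0 < h n" by (rule h(2)[OF elim(3)])
    let ?z = "pole_chart a \<sigma> (h n) x"
    have fz: "\<sigma> * fst ?z = (h n)\<^sup>2 * fst x - a" by (simp add: pole_chart_def \<sigma>2)
    have sz: "snd ?z = h n *\<^sub>R snd x" by (simp add: pole_chart_def)
    have U: "snd ?z \<in> U" using r(2) elim(2) by (simp add: sz)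
    have "\<bar>s (snd ?z) - (h n)\<^sup>2 * q\<bar> \<le> \<epsilon> * (norm (snd ?z))\<^sup>2"
      using r(2)[of "snd ?z"] elim(2)
      by (simp add: sz q_def matrix_vector_mult_scaleR power2_eq_square mult.assoc)
    also have "\<dots> = (h n)\<^sup>2 * (\<epsilon> * (norm (snd x))\<^sup>2)" by (simp add: sz power_mult_distrib)
    also have "\<dots> < (h n)\<^sup>2 * \<bar>fst x - q\<bar>" using \<epsilon>x hn by simp
    finally have d: "\<bar>s (snd ?z) - (h n)\<^sup>2 * q\<bar> < \<bar>(h n)\<^sup>2 * fst x - (h n)\<^sup>2 * q\<bar>"
      by (simp add: abs_mult flip: right_diff_distrib)
    have "?z \<in> E \<longleftrightarrow> s (snd ?z) \<le> (h n)\<^sup>2 * fst x"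
      using E[of ?z] U elim(1) by (simp add: fz)
    also have "\<dots> \<longleftrightarrow> (h n)\<^sup>2 * q \<le> (h n)\<^sup>2 * fst x" using d by linarith
    also have "\<dots> \<longleftrightarrow> q \<le> fst x" using hn by simp
    finally show ?case by (simp add: paraboloid_def q_def)
  qed
qed

text \<open>Since \<open>n * h^(d+1) = 1\<close>, the change of variables yields an integral over
  the fixed bounded set \<open>B\<close>, to which dominated convergence applies. The density may be
  unbounded on \<open>E\<close>; it is continuity at the pole that bounds it by
  \<open>f ?p + 1\<close> on the shrinking images of \<open>B\<close>.\<close>

lemma intensity_near_pole_tendsto:
  fixes E :: "(real \<times> (real ^ 'm)) set"
  assumes cap: "pole_cap a \<sigma> E s" and \<sigma>: "\<bar>\<sigma>\<bar> = 1"
    and cont: "continuous (at (- \<sigma> * a, 0) within E) f"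
    and nonneg: "\<And>z. z \<in> E \<Longrightarrow> 0 \<le> f z"
    and gm: "(\<lambda>z. indicator E z * f z) \<in> borel_measurable borel"
    and B[measurable]: "B \<in> sets borel" and bd: "bounded B"
  defines "h \<equiv> \<lambda>n. real n powr (- 1 / real (CARD('m) + 2))"
  shows "(\<lambda>n. real n * (\<integral>z. indicator (pole_chart a \<sigma> (h n) ` B) z * (indicator E z * f z) \<partial>lborel))
     \<longlonglongrightarrow> f (- \<sigma> * a, 0) * measure lborel (B \<inter> paraboloid (hessian s 0))"
proof -
  let ?p = "(- \<sigma> * a, 0 :: real ^ 'm)" and ?P = "paraboloid (hessian s 0)"
  let ?g = "\<lambda>z. indicator E z * f z :: real"
  let ?\<phi> = "\<lambda>n. pole_chart a \<sigma> (h n)"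
  have h0: "h \<longlonglongrightarrow> 0" unfolding h_def by (intro tendsto_neg_powr filterlim_real_sequentially) simp
  have hpos: "0 < h n" if "1 \<le> n" for n using that by (simp add: h_def)
  have hpow: "real n * h n ^ (CARD('m) + 2) = 1" if "1 \<le> n" for n
  proof -
    have "h n ^ (CARD('m) + 2) = h n powr real (CARD('m) + 2)"
      by (rule powr_realpow[symmetric, OF hpos[OF that]])
    also have "\<dots> = real n powr (- 1 / real (CARD('m) + 2) * real (CARD('m) + 2))"
      by (simp only: h_def powr_powr)
    also have "\<dots> = real n powr (- 1)" by simp
    also have "\<dots> = 1 / real n" using that by (simp add: powr_minus_divide)
    finally show ?thesis using that by simp
  qed
  have qc: "continuous_on UNIV (\<lambda>u. 1 / 2 * (u \<bullet> (hessian s 0 *v u)))"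
    by (intro continuous_intros matrix_vector_mult_linear_continuous_on)
  have Pm[measurable]: "?P \<in> sets borel" by (rule borel_closed[OF closed_paraboloid])
  have \<phi>gm: "(\<lambda>x. ?g (?\<phi> n x)) \<in> borel_measurable borel" for n
    by (rule measurable_compose[OF pole_chart_measurable gm])
  obtain K where K: "\<And>x. x \<in> B \<Longrightarrow> norm x \<le> K" "0 < K"
    using bd bounded_pos by metis
  have dist_chart: "dist (?\<phi> n x) ?p \<le> (h n)\<^sup>2 * K + h n * K" if "norm x \<le> K" "1 \<le> n" for n x
  proof -
    have "dist (?\<phi> n x) ?p = norm (\<sigma> * ((h n)\<^sup>2 * fst x), h n *\<^sub>R snd x)"
      by (simp add: dist_norm pole_chart_def right_diff_distrib)
    also have "\<dots> \<le> norm (\<sigma> * ((h n)\<^sup>2 * fst x)) + norm (h n *\<^sub>R snd x)" by (rule norm_Pair_le)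
    also have "\<dots> = (h n)\<^sup>2 * \<bar>fst x\<bar> + h n * norm (snd x)"
      using hpos[OF that(2)] \<sigma> by (simp add: abs_mult)
    also have "\<dots> \<le> (h n)\<^sup>2 * K + h n * K"
      using that hpos[OF that(2)] norm_fst_le[of "fst x" "snd x"] norm_snd_le[of "snd x" "fst x"]
      by (intro add_mono mult_left_mono) auto
    finally show ?thesis .
  qed
  have small: "(\<lambda>n. (h n)\<^sup>2 * K + h n * K) \<longlonglongrightarrow> 0"
    by (rule tendsto_eq_intros h0 refl | simp)+
  have "continuous (at ?p within E) f" by (rule cont)
  then obtain r where r: "0 < r" "\<And>z. z \<in> E \<Longrightarrow> dist z ?p < r \<Longrightarrow> dist (f z) (f ?p) < 1"
    unfolding continuous_within_eps_delta by (meson zero_less_one)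
  have "eventually (\<lambda>n. (h n)\<^sup>2 * K + h n * K < r) sequentially"
    using small r(1) by (rule order_tendstoD(2))
  then obtain n0 where n0: "\<And>n. n0 \<le> n \<Longrightarrow> (h n)\<^sup>2 * K + h n * K < r"
    by (auto simp: eventually_sequentially)
  \<comment> \<open>The sequence is shifted so that the domination holds for every index;
    \<open>LIMSEQ_offset\<close> removes the shift afterwards.\<close>
  define k where "k = max 1 n0"
  have conv: "(\<lambda>n. indicator B x * ?g (?\<phi> n x)) \<longlonglongrightarrow> indicator (B \<inter> ?P) x * f ?p"
    if ne: "fst x \<noteq> 1 / 2 * (snd x \<bullet> (hessian s 0 *v snd x))" for x
  proof (cases "x \<in> B")
    case True
    have ev: "eventually (\<lambda>n. ?\<phi> n x \<in> E \<longleftrightarrow> x \<in> ?P) sequentially"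
      by (rule pole_chart_eventually_in_cap[OF cap \<sigma> h0 hpos ne])
    show ?thesis
    proof (cases "x \<in> ?P")
      case P: True
      have "(\<lambda>n. ?\<phi> n x) \<longlonglongrightarrow> ?p"
        unfolding pole_chart_def by (rule tendsto_eq_intros h0 refl | simp)+
      moreover have "eventually (\<lambda>n. ?\<phi> n x \<in> E) sequentially" using ev P by simp
      ultimately have "(\<lambda>n. f (?\<phi> n x)) \<longlonglongrightarrow> f ?p"
        by (intro continuous_within_tendsto_compose[OF cont])
      moreover have "eventually (\<lambda>n. f (?\<phi> n x) = indicator B x * ?g (?\<phi> n x)) sequentially"
        using ev by eventually_elim (use P True in simp)
      ultimately have "(\<lambda>n. indicator B x * ?g (?\<phi> n x)) \<longlonglongrightarrow> f ?p"
        by (rule Lim_transform_eventually)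
      then show ?thesis using P True by simp
    next
      case False
      have "eventually (\<lambda>n. indicator B x * ?g (?\<phi> n x) = 0) sequentially"
        using ev by eventually_elim (use False in simp)
      then show ?thesis using False by (simp add: tendsto_eventually)
    qed
  qed simp
  have "(\<lambda>n. \<integral>x. indicator B x * ?g (?\<phi> (n + k) x) \<partial>lborel) \<longlonglongrightarrow> (\<integral>x. indicator (B \<inter> ?P) x * f ?p \<partial>lborel)"
  proof (rule integral_dominated_convergence[where w = "\<lambda>x. indicator (cball 0 K) x * (f ?p + 1)"])
    show "AE x in lborel. (\<lambda>n. indicator B x * ?g (?\<phi> (n + k) x)) \<longlonglongrightarrow> indicator (B \<inter> ?P) x * f ?p"
      using AE_lborel_fst_neq[OF qc]
      by eventually_elim (rule LIMSEQ_ignore_initial_segment[OF conv])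
    show "integrable lborel (\<lambda>x :: real \<times> (real ^ 'm). indicator (cball 0 K) x * (f ?p + 1) :: real)"
      using emeasure_bounded_finite[OF bounded_cball, of "0 :: real \<times> (real ^ 'm)" K]
      by (intro integrable_mult_left integrable_real_indicator) simp_all
    show "AE x in lborel. norm (indicator B x * ?g (?\<phi> (n + k) x)) \<le> indicator (cball 0 K) x * (f ?p + 1)" for n
    proof (rule AE_I2)
      fix x
      have p0: "?g (?\<phi> (n + k) x) \<le> f ?p + 1" "0 \<le> ?g (?\<phi> (n + k) x)" if "x \<in> B" "?\<phi> (n + k) x \<in> E"
      proof -
        have "dist (?\<phi> (n + k) x) ?p < r"
        proof -
          have "1 \<le> n + k" "n0 \<le> n + k" by (auto simp: k_def)
          then show ?thesis using dist_chart[of x "n + k"] n0[of "n + k"] K(1)[OF that(1)] by linarith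
        qed
        from r(2)[OF that(2) this] nonneg[OF that(2)] that(2)
        show "?g (?\<phi> (n + k) x) \<le> f ?p + 1" "0 \<le> ?g (?\<phi> (n + k) x)"
          by (simp_all add: dist_real_def)
      qed
      have "0 \<le> f ?p + 1" if "x \<in> B" "?\<phi> (n + k) x \<in> E" using p0[OF that] by linarith
      moreover have "0 \<le> f ?p" by (intro nonneg pole_in_pole_cap[OF cap \<sigma>])
      ultimately show "norm (indicator B x * ?g (?\<phi> (n + k) x)) \<le> indicator (cball 0 K) x * (f ?p + 1)"
        using p0 K(1)[of x] by (cases "x \<in> B"; cases "?\<phi> (n + k) x \<in> E") (auto simp: indicator_def)
    qed
  qed (use \<phi>gm B Pm in \<open>auto intro!: borel_measurable_times borel_measurable_indicator\<close>)
  also have "(\<integral>x. indicator (B \<inter> ?P) x * f ?p \<partial>lborel) = f ?p * measure lborel (B \<inter> ?P)"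
    by simp
  finally have "(\<lambda>n. \<integral>x. indicator B x * ?g (?\<phi> n x) \<partial>lborel) \<longlonglongrightarrow> f ?p * measure lborel (B \<inter> ?P)"
    by (rule LIMSEQ_offset)
  moreover have "(\<integral>x. indicator B x * ?g (?\<phi> n x) \<partial>lborel) =
      real n * (\<integral>z. indicator (?\<phi> n ` B) z * ?g z \<partial>lborel)" if n: "1 \<le> n" for n
  proof -
    note inj = pole_chart_inject[OF hpos[OF n] \<sigma>] and im = pole_chart_image_borel[OF hpos[OF n] \<sigma> B]
    have "(\<integral>z. indicator (?\<phi> n ` B) z * ?g z \<partial>lborel) =
      h n ^ (CARD('m) + 2) * (\<integral>x. indicator (?\<phi> n ` B) (?\<phi> n x) * ?g (?\<phi> n x) \<partial>lborel)"
      by (intro lborel_integral_pole_chart hpos[OF n] \<sigma> borel_measurable_times borel_measurable_indicator im gm)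
    also have "(\<lambda>x. indicator (?\<phi> n ` B) (?\<phi> n x) :: real) = indicator B"
      by (auto simp: fun_eq_iff indicator_def image_iff inj)
    then have "(\<lambda>x. indicator (?\<phi> n ` B) (?\<phi> n x) * ?g (?\<phi> n x)) = (\<lambda>x. indicator B x * ?g (?\<phi> n x))"
      by (simp add: fun_eq_iff)
    finally show ?thesis using hpow[OF n] by (simp flip: mult.assoc)
  qed
  ultimately show ?thesis
    by (rule Lim_transform_eventually[OF _ eventually_mono[OF eventually_ge_at_top[of 1]]])
qed

section \<open>Counting pairs by cells\<close>

text \<open>Witness sets treat finite and infinite counts alike; both measurability and monotonicity
  of the counts in time are read off from them.\<close>

lemma enat_le_num_points_iff:
  "enat i \<le> num_points x B \<longleftrightarrow> (\<exists>S. finite S \<and> card S = i \<and> (\<forall>s\<in>S. x s \<in> B))"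
proof -
  let ?I = "{s. x s \<in> B}"
  have eq: "(\<forall>s\<in>S. x s \<in> B) \<longleftrightarrow> S \<subseteq> ?I" for S by auto
  show ?thesis
  proof (cases "finite ?I")
    case True
    then have "(\<exists>S. finite S \<and> card S = i \<and> S \<subseteq> ?I) \<longleftrightarrow> i \<le> card ?I"
      by (meson card_mono obtain_subset_with_card_n)
    then show ?thesis using True by (simp add: num_points_def eq)
  next
    case False
    then show ?thesis using infinite_arbitrarily_large[OF False, of i] by (auto simp: num_points_def eq)
  qed
qed

section \<open>Measurability of counts and arrival times\<close>

lemma num_points_eq_enat_iff:
  "num_points x B = enat i \<longleftrightarrow> enat i \<le> num_points x B \<and> \<not> enat (Suc i) \<le> num_points x B"
  by (cases "num_points x B") auto

lemma pred_enat_le_num_points [measurable (raw)]: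
  fixes x :: "'w \<Rightarrow> 'i :: countable \<Rightarrow> 'a"
  assumes "\<And>s. Measurable.pred M (\<lambda>\<omega>. x \<omega> s \<in> B)"
  shows "Measurable.pred M (\<lambda>\<omega>. enat i \<le> num_points (x \<omega>) B)"
proof -
  \<comment> \<open>Finite sets are replaced by duplicate-free lists, which form a countable type,
    so the existential becomes a countable union of events.\<close>
  have "(\<exists>S. finite S \<and> card S = i \<and> (\<forall>s\<in>S. x \<omega> s \<in> B)) \<longleftrightarrow>
      (\<exists>xs. distinct xs \<and> length xs = i \<and> (\<forall>s\<in>set xs. x \<omega> s \<in> B))" for \<omega>
    by (metis List.finite_set distinct_card finite_distinct_list)
  moreover have "Measurable.pred M (\<lambda>\<omega>. \<exists>xs. distinct xs \<and> length xs = i \<and> (\<forall>s\<in>set xs. x \<omega> s \<in> B))"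
  proof -
    have "Measurable.pred M (\<lambda>\<omega>. \<forall>s\<in>set xs. x \<omega> s \<in> B)" for xs
      using assms by (intro pred_intros_finite(3)) auto
    then show ?thesis by measurable
  qed
  ultimately show ?thesis by (simp only: enat_le_num_points_iff)
qed

lemma pred_num_points_eq_enat:
  fixes x :: "'w \<Rightarrow> 'i :: countable \<Rightarrow> 'a"
  assumes "\<And>s. Measurable.pred M (\<lambda>\<omega>. x \<omega> s \<in> B)"
  shows "Measurable.pred M (\<lambda>\<omega>. num_points (x \<omega>) B = enat i)"
proof -
  have p: "Measurable.pred M (\<lambda>\<omega>. enat j \<le> num_points (x \<omega>) B)" for j
    by (rule pred_enat_le_num_points[OF assms])
  show ?thesis
    unfolding num_points_eq_enat_iff by (intro pred_intros_logic(3)[OF p] pred_intros_logic(2)[OF p])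
qed

text \<open>The set of admissible times is upward closed and, because \<open>1 <= i\<close>, bounded
  below by 0; hence its infimum is below \<open>c\<close> exactly if it contains a rational below
  \<open>c\<close>.\<close>

lemma borel_measurable_arrival_time:
  fixes x :: "'w \<Rightarrow> 'i :: countable \<Rightarrow> real"
  assumes x: "\<And>s. (\<lambda>\<omega>. x \<omega> s) \<in> borel_measurable M" and i: "1 \<le> i"
  shows "(\<lambda>\<omega>. arrival_time i (x \<omega>)) \<in> borel_measurable M"
proof -
  define A where "A \<omega> = {t. enat i \<le> num_points (x \<omega>) {0..t}}" for \<omega>
  have pred: "Measurable.pred M (\<lambda>\<omega>. t \<in> A \<omega>)" for t
  proof -
    have "Measurable.pred M (\<lambda>\<omega>. x \<omega> s \<in> {0..t})" for s using x[of s] by measurable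
    then show ?thesis unfolding A_def mem_Collect_eq by (rule pred_enat_le_num_points)
  qed
  have up: "t' \<in> A \<omega>" if "t \<in> A \<omega>" "t \<le> t'" for t t' \<omega>
  proof -
    obtain S where S: "finite S" "card S = i" "\<forall>s\<in>S. x \<omega> s \<in> {0..t}"
      using \<open>t \<in> A \<omega>\<close> unfolding A_def enat_le_num_points_iff by blast
    have "\<forall>s\<in>S. x \<omega> s \<in> {0..t'}" using S(3) \<open>t \<le> t'\<close> by auto
    then show ?thesis using S(1,2) unfolding A_def enat_le_num_points_iff by blast
  qed
  have low: "0 \<le> t" if "t \<in> A \<omega>" for t \<omega>
  proof -
    obtain S where S: "finite S" "card S = i" "\<forall>s\<in>S. x \<omega> s \<in> {0..t}"
      using \<open>t \<in> A \<omega>\<close> unfolding A_def enat_le_num_points_iff by blast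
    then have "S \<noteq> {}" using i by auto
    then obtain s where "x \<omega> s \<in> {0..t}" using S(3) by blast
    then show ?thesis by simp
  qed
  then have bdd: "bdd_below (A \<omega>)" for \<omega> by (rule bdd_belowI)
  \<comment> \<open>Upward closure lets nonemptiness be tested at natural numbers. On the event that
    the set is empty, the infimum is the fixed number \<open>Inf {}\<close>, which gives the second
    branch.\<close>
  have less: "Inf (A \<omega>) < c \<longleftrightarrow> (if \<exists>n :: nat. real n \<in> A \<omega> then \<exists>q. real_of_rat q < c \<and> real_of_rat q \<in> A \<omega> else Inf {} < c)"
    for c \<omega>
  proof (cases "A \<omega> = {}")
    case False
    then obtain t where t: "t \<in> A \<omega>" by auto
    obtain n :: nat where "t \<le> real n" using real_arch_simple by blast
    with t have n: "\<exists>n :: nat. real n \<in> A \<omega>" using up by blast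
    have "Inf (A \<omega>) < c \<longleftrightarrow> (\<exists>t\<in>A \<omega>. t < c)" by (rule cInf_less_iff[OF False bdd])
    also have "\<dots> \<longleftrightarrow> (\<exists>q. real_of_rat q < c \<and> real_of_rat q \<in> A \<omega>)"
    proof
      assume "\<exists>t\<in>A \<omega>. t < c"
      then obtain t where t: "t \<in> A \<omega>" "t < c" by blast
      obtain q where "t < real_of_rat q" "real_of_rat q < c" using of_rat_dense[OF t(2)] by blast
      then show "\<exists>q. real_of_rat q < c \<and> real_of_rat q \<in> A \<omega>" using up[OF t(1)] by (meson less_imp_le)
    qed blast
    finally show ?thesis using n by simp
  qed simp
  have "Measurable.pred M (\<lambda>\<omega>. Inf (A \<omega>) < c)" for c
  proof -
    have 1: "Measurable.pred M (\<lambda>\<omega>. \<exists>n :: nat. real n \<in> A \<omega>)"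
      by (intro pred_intros_countable pred)
    have 2: "Measurable.pred M (\<lambda>\<omega>. \<exists>q :: rat. real_of_rat q < c \<and> real_of_rat q \<in> A \<omega>)"
      using pred by measurable
    show ?thesis
      unfolding less if_bool_eq_disj using 1 2 by measurable
  qed
  then show ?thesis
    unfolding borel_measurable_iff_less arrival_time_def A_def by (simp add: pred_def)
qed

text \<open>The number \<open>cc t\<close> counts pairs in a disjoint union of products of cells.
  Replacing the value of a pair by that of its cells moves it by at most \<delta>, so the exact
  count and the cell count dominate each other after a shift of time by \<delta>.\<close>

lemma card_pairs_cells:
  fixes P :: "nat \<Rightarrow> 'p set" and Q :: "nat \<Rightarrow> 'q set" and v :: "'p \<Rightarrow> 'q \<Rightarrow> real"
  assumes fin: "\<And>j. j < m \<Longrightarrow> finite (P j)" "\<And>j. j < m \<Longrightarrow> finite (Q j)"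
    and disj: "disjoint_family_on P {..<m}" "disjoint_family_on Q {..<m}"
    and close: "\<And>j l p q. j < m \<Longrightarrow> l < m \<Longrightarrow> p \<in> P j \<Longrightarrow> q \<in> Q l \<Longrightarrow> \<bar>v p q - w j l\<bar> \<le> \<delta>"
  defines "N t \<equiv> card {(p, q). p \<in> (\<Union>j<m. P j) \<and> q \<in> (\<Union>j<m. Q j) \<and> v p q \<le> t}"
    and "cc t \<equiv> \<Sum>(j, l)\<in>{..<m} \<times> {..<m}. if w j l \<le> t then card (P j) * card (Q l) else 0"
  shows "N t \<le> cc (t + \<delta>)" and "cc t \<le> N (t + \<delta>)"
proof -
  have cc: "cc t = card (\<Union>(j, l)\<in>{(j, l). j < m \<and> l < m \<and> w j l \<le> t}. P j \<times> Q l)" for t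
  proof -
    have f: "finite {(j, l). j < m \<and> l < m \<and> w j l \<le> t}"
      by (rule finite_subset[of _ "{..<m} \<times> {..<m}"]) auto
    have "cc t = (\<Sum>(j, l)\<in>{(j, l). j < m \<and> l < m \<and> w j l \<le> t}. card (P j) * card (Q l))"
      unfolding cc_def by (rule sum.mono_neutral_cong_right) (auto split: if_splits)
    also have "\<dots> = (\<Sum>x\<in>{(j, l). j < m \<and> l < m \<and> w j l \<le> t}. card (case x of (j, l) \<Rightarrow> P j \<times> Q l))"
      by (rule sum.cong) (auto simp: card_cartesian_product)
    also have "\<dots> = card (\<Union>(j, l)\<in>{(j, l). j < m \<and> l < m \<and> w j l \<le> t}. P j \<times> Q l)"
    proof (rule card_UN_disjoint[symmetric, OF f])
      show "\<forall>x\<in>{(j, l). j < m \<and> l < m \<and> w j l \<le> t}. finite (case x of (j, l) \<Rightarrow> P j \<times> Q l)"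
        using fin by auto
      show "\<forall>x\<in>{(j, l). j < m \<and> l < m \<and> w j l \<le> t}. \<forall>y\<in>{(j, l). j < m \<and> l < m \<and> w j l \<le> t}.
          x \<noteq> y \<longrightarrow> (case x of (j, l) \<Rightarrow> P j \<times> Q l) \<inter> (case y of (j, l) \<Rightarrow> P j \<times> Q l) = {}"
      proof (intro ballI impI)
        fix x y assume x: "x \<in> {(j, l). j < m \<and> l < m \<and> w j l \<le> t}"
          and y: "y \<in> {(j, l). j < m \<and> l < m \<and> w j l \<le> t}" and "x \<noteq> y"
        obtain j l j' l' where xy: "x = (j, l)" "y = (j', l')" by (cases x; cases y)
        have "P j \<inter> P j' = {} \<or> Q l \<inter> Q l' = {}"
        proof (cases "j = j'")
          case True
          then show ?thesis using x y \<open>x \<noteq> y\<close> disjoint_family_onD[OF disj(2), of l l'] by (simp add: xy)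
        next
          case False
          then show ?thesis using x y disjoint_family_onD[OF disj(1), of j j'] by (simp add: xy)
        qed
        then show "(case x of (j, l) \<Rightarrow> P j \<times> Q l) \<inter> (case y of (j, l) \<Rightarrow> P j \<times> Q l) = {}"
          unfolding xy by auto
      qed
    qed
    finally show ?thesis .
  qed
  have finU: "finite ((\<Union>j<m. P j) \<times> (\<Union>j<m. Q j))" using fin by auto
  show "N t \<le> cc (t + \<delta>)"
    unfolding cc N_def
  proof (rule card_mono)
    show "finite (\<Union>(j, l)\<in>{(j, l). j < m \<and> l < m \<and> w j l \<le> t + \<delta>}. P j \<times> Q l)"
      by (rule finite_subset[OF _ finU]) auto
    show "{(p, q). p \<in> (\<Union>j<m. P j) \<and> q \<in> (\<Union>j<m. Q j) \<and> v p q \<le> t} \<subseteq>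
      (\<Union>(j, l)\<in>{(j, l). j < m \<and> l < m \<and> w j l \<le> t + \<delta>}. P j \<times> Q l)"
    proof clarify
      fix p q j l assume *: "v p q \<le> t" "j < m" "p \<in> P j" "l < m" "q \<in> Q l"
      then have "w j l \<le> t + \<delta>" using close[OF *(2,4,3,5)] by linarith
      then show "(p, q) \<in> (\<Union>(j, l)\<in>{(j, l). j < m \<and> l < m \<and> w j l \<le> t + \<delta>}. P j \<times> Q l)"
        using * by blast
    qed
  qed
  show "cc t \<le> N (t + \<delta>)"
    unfolding cc N_def
  proof (rule card_mono)
    show "finite {(p, q). p \<in> (\<Union>j<m. P j) \<and> q \<in> (\<Union>j<m. Q j) \<and> v p q \<le> t + \<delta>}"
      by (rule finite_subset[OF _ finU]) auto
    show "(\<Union>(j, l)\<in>{(j, l). j < m \<and> l < m \<and> w j l \<le> t}. P j \<times> Q l) \<subseteq>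
      {(p, q). p \<in> (\<Union>j<m. P j) \<and> q \<in> (\<Union>j<m. Q j) \<and> v p q \<le> t + \<delta>}"
    proof clarify
      fix j l p q assume *: "w j l \<le> t" "j < m" "p \<in> P j" "l < m" "q \<in> Q l"
      then have "v p q \<le> t + \<delta>" using close[OF *(2,4,3,5)] by linarith
      then show "p \<in> (\<Union>j<m. P j) \<and> q \<in> (\<Union>j<m. Q j) \<and> v p q \<le> t + \<delta>"
        using * by blast
    qed
  qed
qed

text \<open>Compare \<open>G\<close> with the step function that is \<open>\<gamma> c\<close> on
  \<open>A c\<close> and 0 elsewhere: the error is at most \<epsilon> on the union of the events and
  at most \<open>b\<close> off it.\<close>

lemma (in prob_space) expectation_approx_on_events:
  fixes \<gamma> :: "'c \<Rightarrow> real"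
  assumes F: "finite F" and Ev[measurable]: "\<And>c. c \<in> F \<Longrightarrow> A c \<in> events"
    and disj: "disjoint_family_on A F"
    and G[measurable]: "G \<in> borel_measurable M" and bd: "\<And>\<omega>. \<omega> \<in> space M \<Longrightarrow> \<bar>G \<omega>\<bar> \<le> b"
    and close: "AE \<omega> in M. \<forall>c\<in>F. \<omega> \<in> A c \<longrightarrow> \<bar>G \<omega> - \<gamma> c\<bar> \<le> \<epsilon>" and \<epsilon>: "0 \<le> \<epsilon>" and b: "0 \<le> b"
  shows "\<bar>expectation G - (\<Sum>c\<in>F. \<gamma> c * prob (A c))\<bar> \<le> \<epsilon> + b * (1 - (\<Sum>c\<in>F. prob (A c)))"
proof -
  let ?s = "\<lambda>\<omega>. \<Sum>c\<in>F. \<gamma> c * indicator (A c) \<omega>"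
  let ?U = "\<Union>(A ` F)"
  have U: "?U \<in> events" using F Ev by (intro sets.finite_UN) auto
  have pU: "prob ?U = (\<Sum>c\<in>F. prob (A c))"
    using F Ev disj by (intro finite_measure_finite_Union) auto
  have intG: "integrable M G"
    using bd by (intro integrable_const_bound[where B = b]) auto
  have inti: "integrable M (\<lambda>\<omega>. \<gamma> c * indicator (A c) \<omega>)" if "c \<in> F" for c
    using Ev[OF that] by (intro integrable_mult_right integrable_real_indicator) (auto simp: emeasure_eq_measure)
  have ints: "integrable M ?s" using inti by (intro Bochner_Integration.integrable_sum) auto
  have Es: "expectation ?s = (\<Sum>c\<in>F. \<gamma> c * prob (A c))"
  proof -
    have "expectation ?s = (\<Sum>c\<in>F. expectation (\<lambda>\<omega>. \<gamma> c * indicator (A c) \<omega>))"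
      using inti by (intro Bochner_Integration.integral_sum) auto
    also have "\<dots> = (\<Sum>c\<in>F. \<gamma> c * prob (A c))"
      using Ev by (intro sum.cong) auto
    finally show ?thesis .
  qed
  have intU: "integrable M (\<lambda>\<omega>. \<epsilon> + b * indicator (space M - ?U) \<omega>)"
    using U by (intro Bochner_Integration.integrable_add integrable_mult_right integrable_real_indicator)
      (auto simp: emeasure_eq_measure)
  have "\<bar>expectation G - expectation ?s\<bar> = \<bar>expectation (\<lambda>\<omega>. G \<omega> - ?s \<omega>)\<bar>"
    using intG ints by simp
  also have "\<dots> \<le> expectation (\<lambda>\<omega>. \<bar>G \<omega> - ?s \<omega>\<bar>)" by (rule integral_abs_bound)
  also have "\<dots> \<le> expectation (\<lambda>\<omega>. \<epsilon> + b * indicator (space M - ?U) \<omega>)"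
  proof (rule integral_mono_AE)
    show "integrable M (\<lambda>\<omega>. \<bar>G \<omega> - ?s \<omega>\<bar>)" using intG ints by auto
    show "AE \<omega> in M. \<bar>G \<omega> - ?s \<omega>\<bar> \<le> \<epsilon> + b * indicator (space M - ?U) \<omega>"
      using close AE_space
    proof eventually_elim
      case (elim \<omega>)
      show ?case
      proof (cases "\<omega> \<in> ?U")
        case True
        then obtain c where c: "c \<in> F" "\<omega> \<in> A c" by auto
        have "\<omega> \<notin> A c'" if "c' \<in> F - {c}" for c'
          using disj c that unfolding disjoint_family_on_def by blast
        then have "?s \<omega> = \<gamma> c"
        proof -
          have "(\<Sum>c'\<in>F - {c}. \<gamma> c' * indicator (A c') \<omega>) = 0"
            using \<open>\<And>c'. c' \<in> F - {c} \<Longrightarrow> \<omega> \<notin> A c'\<close> by (intro sum.neutral) auto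
          then show ?thesis using F c by (subst sum.remove[of F c]) auto
        qed
        then show ?thesis using elim(1) c True by auto
      next
        case False
        then have "?s \<omega> = 0" by (intro sum.neutral) (auto simp: indicator_def)
        then show ?thesis using False bd[OF elim(2)] elim(2) \<epsilon> by (simp add: indicator_def)
      qed
    qed
  qed (rule intU)
  also have "\<dots> = \<epsilon> + b * prob (space M - ?U)"
    using U by (subst Bochner_Integration.integral_add) (auto simp: prob_space emeasure_eq_measure)
  also have "prob (space M - ?U) = 1 - (\<Sum>c\<in>F. prob (A c))"
    using prob_compl[OF U] pU by simp
  finally show ?thesis unfolding Es .
qed

section \<open>Laws of the cell counts in the limit\<close>

lemma (in prob_space) prob_poisson_process_counts:
  assumes X: "poisson_process M \<mu> X" and J: "finite (J :: nat set)"
    and B: "\<And>j. j \<in> J \<Longrightarrow> B j \<in> sets \<mu>" "\<And>j. j \<in> J \<Longrightarrow> emeasure \<mu> (B j) < \<infinity>"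
    and disj: "disjoint_family_on B J"
  shows "prob {\<omega> \<in> space M. \<forall>j\<in>J. num_points (\<lambda>i. X i \<omega>) (B j) = enat (c j)} =
    (\<Prod>j\<in>J. measure \<mu> (B j) ^ c j / fact (c j) * exp (- measure \<mu> (B j)))"
proof (cases "J = {}")
  case True
  then show ?thesis by (simp add: prob_space)
next
  case False
  let ?n = "\<lambda>j \<omega>. num_points (\<lambda>i. X i \<omega>) (B j)"
  have "indep_vars (\<lambda>_. count_space UNIV) ?n J"
    using X J B(1) disj unfolding poisson_process_def by blast
  from indep_varsD[OF this False J subset_refl, of "\<lambda>j. {enat (c j)}"]
  have "prob (\<Inter>j\<in>J. ?n j -` {enat (c j)} \<inter> space M) = (\<Prod>j\<in>J. prob (?n j -` {enat (c j)} \<inter> space M))"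
    by simp
  also have "(\<Inter>j\<in>J. ?n j -` {enat (c j)} \<inter> space M) = {\<omega> \<in> space M. \<forall>j\<in>J. ?n j \<omega> = enat (c j)}"
    using False by auto
  also have "(\<Prod>j\<in>J. prob (?n j -` {enat (c j)} \<inter> space M)) =
      (\<Prod>j\<in>J. measure \<mu> (B j) ^ c j / fact (c j) * exp (- measure \<mu> (B j)))"
  proof (rule prod.cong)
    fix j assume j: "j \<in> J"
    have "?n j -` {enat (c j)} \<inter> space M = {\<omega> \<in> space M. ?n j \<omega> = enat (c j)}" by auto
    then show "prob (?n j -` {enat (c j)} \<inter> space M) = measure \<mu> (B j) ^ c j / fact (c j) * exp (- measure \<mu> (B j))"
      using X B[OF j] unfolding poisson_process_def by auto
  qed simp
  finally show ?thesis .
qed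

text \<open>Prescribing the counts of finitely many cells defines a cylinder set in the product
  space indexed by the Borel sets, which is where independence is assumed.\<close>

lemma (in prob_space) independent_point_processes_counts:
  assumes ind: "independent_point_processes M X Y" and J: "finite (J :: nat set)"
    and B: "\<And>j. j \<in> J \<Longrightarrow> B j \<in> sets borel"
  shows "prob {\<omega> \<in> space M. \<forall>j\<in>J. num_points (\<lambda>i. X i \<omega>) (B j) = enat (c j) \<and> num_points (\<lambda>i. Y i \<omega>) (B j) = enat (d j)} =
    prob {\<omega> \<in> space M. \<forall>j\<in>J. num_points (\<lambda>i. X i \<omega>) (B j) = enat (c j)} *
    prob {\<omega> \<in> space M. \<forall>j\<in>J. num_points (\<lambda>i. Y i \<omega>) (B j) = enat (d j)}"
proof -
  let ?N = "PiM (sets borel) (\<lambda>_. count_space UNIV) :: ('b set \<Rightarrow> enat) measure"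
  let ?V = "\<lambda>X \<omega>. \<lambda>B \<in> sets borel. num_points (\<lambda>i. X i \<omega>) B"
  define A where "A c = {F \<in> space ?N. \<forall>j\<in>J. F (B j) = enat (c j)}" for c
  have A: "A c \<in> sets ?N" for c
  proof -
    have "{F \<in> space ?N. F (B j) = enat (c j)} \<in> sets ?N" if "j \<in> J" for j
    proof -
      have "(\<lambda>F. F (B j)) -` {enat (c j)} \<inter> space ?N \<in> sets ?N"
        using B[OF that] by (intro measurable_sets[OF measurable_component_singleton]) auto
      moreover have "(\<lambda>F. F (B j)) -` {enat (c j)} \<inter> space ?N = {F \<in> space ?N. F (B j) = enat (c j)}" by auto
      ultimately show ?thesis by simp
    qed
    then show ?thesis unfolding A_def using J by (intro sets.sets_Collect_finite_All) auto
  qed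
  have pre: "?V X -` A c \<inter> space M = {\<omega> \<in> space M. \<forall>j\<in>J. num_points (\<lambda>i. X i \<omega>) (B j) = enat (c j)}" for X c
    using B by (auto simp: A_def space_PiM)
  have "indep_set {?V X -` A \<inter> space M | A. A \<in> sets ?N} {?V Y -` B \<inter> space M | B. B \<in> sets ?N}"
    using ind unfolding independent_point_processes_def independent_rvs_def by blast
  then have "prob ((?V X -` A c \<inter> space M) \<inter> (?V Y -` A d \<inter> space M)) = prob (?V X -` A c \<inter> space M) * prob (?V Y -` A d \<inter> space M)"
    using A by (intro indep_setD) blast+
  moreover have "(?V X -` A c \<inter> space M) \<inter> (?V Y -` A d \<inter> space M) =
     {\<omega> \<in> space M. \<forall>j\<in>J. num_points (\<lambda>i. X i \<omega>) (B j) = enat (c j) \<and> num_points (\<lambda>i. Y i \<omega>) (B j) = enat (d j)}"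
    unfolding pre by auto
  ultimately show ?thesis unfolding pre by simp
qed

text \<open>Continuity from below. It provides the time horizon and the bound on the cell counts in
  the limit.\<close>

lemma (in prob_space) prob_eventually_ge:
  assumes ev: "\<And>n :: nat. Measurable.pred M (P n)"
    and mono: "\<And>n n' \<omega>. n \<le> n' \<Longrightarrow> P n \<omega> \<Longrightarrow> P n' \<omega>"
    and ae: "AE \<omega> in M. \<exists>n. P n \<omega>" and "0 < \<epsilon>"
  shows "\<exists>n. 1 - \<epsilon> < prob {\<omega> \<in> space M. P n \<omega>}"
proof -
  let ?A = "\<lambda>n. {\<omega> \<in> space M. P n \<omega>}"
  have A: "?A n \<in> events" for n using ev[of n] by measurable
  have "(\<lambda>n. prob (?A n)) \<longlonglongrightarrow> prob (\<Union>n. ?A n)"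
    using A mono by (intro finite_Lim_measure_incseq) (auto simp: incseq_def)
  moreover have "prob (\<Union>n. ?A n) = 1"
    using A ae AE_space by (subst prob_eq_1) (auto intro!: sets.countable_UN elim: eventually_mono)
  ultimately have "eventually (\<lambda>n. 1 - \<epsilon> < prob (?A n)) sequentially"
    using \<open>0 < \<epsilon>\<close> by (intro order_tendstoD(1)) auto
  then show ?thesis by (meson eventually_sequentially le_refl)
qed

section \<open>Continuous functions of tuples\<close>

lemma Euclidean_space_eq_top_of_set: "Euclidean_space k = top_of_set {x. \<forall>i\<ge>k. x i = 0}"
  by (simp add: Euclidean_space_def euclidean_product_topology)

text \<open>The metric on sequences is controlled by twice the maximum over finitely many
  coordinates and a geometric tail; \<open>e\<close> takes up the tail.\<close>

lemma dist_fun_le: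
  fixes x y :: "nat \<Rightarrow> real"
  assumes "\<And>i. \<bar>x i - y i\<bar> \<le> \<delta>" "0 < e"
  shows "dist x y \<le> 2 * \<delta> + e"
proof -
  obtain N :: nat where N: "(1 / 2) ^ N < e"
    using real_arch_pow_inv[OF assms(2), of "1 / 2"] by auto
  have "dist x y \<le> 2 * Max {dist (x (from_nat n)) (y (from_nat n)) |n. n \<le> N} + (1 / 2) ^ N"
    by (rule dist_fun_le_dist_first_terms)
  also have "Max {dist (x (from_nat n)) (y (from_nat n)) |n. n \<le> N} \<le> \<delta>"
    using assms(1) by (intro Max.boundedI) (auto simp: dist_real_def)
  finally show ?thesis using N by linarith
qed

text \<open>The box is a product of intervals and, from index \<open>k\<close> on, of singletons,
  hence compact in the sequence space; uniform continuity follows there.\<close>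

lemma continuous_map_Euclidean_space_uniform_on_box:
  assumes g: "continuous_map (Euclidean_space k) euclideanreal g" and "0 < \<epsilon>"
  obtains \<delta> where "0 < \<delta>"
    "\<And>x y. (\<And>i. i < k \<Longrightarrow> x (Suc i) \<in> {lo..hi}) \<Longrightarrow> (\<And>i. i < k \<Longrightarrow> y (Suc i) \<in> {lo..hi}) \<Longrightarrow>
       (\<And>i. i < k \<Longrightarrow> \<bar>x (Suc i) - y (Suc i)\<bar> \<le> \<delta>) \<Longrightarrow> \<bar>g (tuple k x) - g (tuple k y)\<bar> \<le> \<epsilon>"
proof -
  define C where "C = PiE (UNIV :: nat set) (\<lambda>i. if i < k then {lo..hi} else {0 :: real})"
  have "compactin (product_topology (\<lambda>i. euclidean) UNIV) C"
    unfolding C_def by (subst compactin_PiE) auto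
  then have "compact C" by (simp add: euclidean_product_topology)
  moreover have sub: "C \<subseteq> {x. \<forall>i\<ge>k. x i = 0}"
    unfolding C_def by (auto simp: PiE_iff split: if_splits)
  then have "continuous_on C g"
    using g by (auto simp: Euclidean_space_eq_top_of_set intro: continuous_on_subset)
  ultimately have "uniformly_continuous_on C g" by (intro compact_uniformly_continuous)
  then obtain d where d: "0 < d" "\<And>x y. x \<in> C \<Longrightarrow> y \<in> C \<Longrightarrow> dist y x < d \<Longrightarrow> dist (g y) (g x) < \<epsilon>"
    using \<open>0 < \<epsilon>\<close> unfolding uniformly_continuous_on_def by metis
  show thesis
  proof (rule that[of "d / 4"])
    show "0 < d / 4" using d(1) by simp
    fix x y :: "nat \<Rightarrow> real"
    assume *: "\<And>i. i < k \<Longrightarrow> x (Suc i) \<in> {lo..hi}" "\<And>i. i < k \<Longrightarrow> y (Suc i) \<in> {lo..hi}"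
      and c: "\<And>i. i < k \<Longrightarrow> \<bar>x (Suc i) - y (Suc i)\<bar> \<le> d / 4"
    have "tuple k x \<in> C" "tuple k y \<in> C" using * by (auto simp: C_def tuple_def)
    moreover have "dist (tuple k x) (tuple k y) \<le> 2 * (d / 4) + d / 4"
      using c d(1) by (intro dist_fun_le) (auto simp: tuple_def)
    then have "dist (tuple k x) (tuple k y) < d" using d(1) by simp
    ultimately show "\<bar>g (tuple k x) - g (tuple k y)\<bar> \<le> \<epsilon>"
      using d(2)[of "tuple k y" "tuple k x"] by (simp add: dist_real_def less_imp_le)
  qed
qed

text \<open>The common end of the arguments for sample and limit. The exact count \<open>N\<close>
  describes the set \<open>A\<close> only up to \<open>Tw\<close>, but \<open>i <= cc b\<close>
  guarantees an arrival by \<open>b + \<delta> <= Tw\<close>, so later times have no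
  influence.\<close>

lemma Inf_arrivals_close:
  fixes A :: "real set" and N cc :: "real \<Rightarrow> nat"
  assumes A: "\<And>t. t \<in> A \<Longrightarrow> 0 \<le> t" "\<And>t. t \<le> Tw \<Longrightarrow> t \<in> A \<longleftrightarrow> i \<le> N t"
    and N: "\<And>t. N t \<le> cc (t + \<delta>)" "\<And>t. cc t \<le> N (t + \<delta>)"
    and "0 \<le> \<delta>" "b + \<delta> \<le> Tw" and i: "i \<le> cc b"
  shows "\<bar>Inf A - Inf {t. i \<le> cc t}\<bar> \<le> \<delta>" and "Inf A \<in> {0..b + \<delta>}"
proof -
  have bdd: "bdd_below A" using A(1) by (rule bdd_belowI)
  have 1: "t + \<delta> \<in> A" if "t \<in> {t. i \<le> cc t}" "t \<le> b" for t
    using that A(2)[of "t + \<delta>"] N(2)[of t] assms(6) by auto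
  have 2: "t + \<delta> \<in> {t. i \<le> cc t}" if "t \<in> A" "t \<le> b + \<delta>" for t
    using that A(2)[of t] N(1)[of t] assms(6) by auto
  note * = Inf_close_if_shifted[OF bdd \<open>0 \<le> \<delta>\<close> _ order_refl 1 2]
  show "\<bar>Inf A - Inf {t. i \<le> cc t}\<bar> \<le> \<delta>" using i by (intro *(1)) auto
  have "Inf A \<le> b + \<delta>" using i by (intro *(2)) auto
  moreover have "0 \<le> Inf A" using 1[of b] i A(1) by (intro cInf_greatest) auto
  ultimately show "Inf A \<in> {0..b + \<delta>}" by simp
qed


text \<open>In blown-up coordinates the same cells and centers serve at both poles. The Boolean in
  an index of \<open>c\<close> tells the poles apart, \<open>True\<close> being the left
  one.\<close>

definition cell_pair_count ::
    "real \<Rightarrow> (nat \<Rightarrow> real \<times> (real ^ 'm)) \<Rightarrow> nat \<Rightarrow> (bool \<times> nat \<Rightarrow> nat) \<Rightarrow> real \<Rightarrow> nat" where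
  "cell_pair_count a ctr m c t =
     (\<Sum>(j, l)\<in>{..<m} \<times> {..<m}. if gap a (ctr j) (ctr l) \<le> t then c (True, j) * c (False, l) else 0)"

text \<open>The reference vector: once the counts are \<open>c\<close>, the arrival times of the
  limit and the scaled gaps of the sample both lie within \<delta> of it.\<close>

definition cell_arrival ::
    "real \<Rightarrow> (nat \<Rightarrow> real \<times> (real ^ 'm)) \<Rightarrow> nat \<Rightarrow> (bool \<times> nat \<Rightarrow> nat) \<Rightarrow> nat \<Rightarrow> real" where
  "cell_arrival a ctr m c i = Inf {t. i \<le> cell_pair_count a ctr m c t}"

text \<open>Up to time \<open>Tw\<close> only pairs with both points in the window count, so the
  number of pairs is finite and comparable with the cells. The first conclusion later shows that the
  retained count vectors carry most of the mass, the other two that the limit tuple is near the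
  reference vector.\<close>

lemma limit_pairs_cells:
  fixes x y :: "nat \<Rightarrow> real \<times> (real ^ 'm)"
  assumes xP: "\<And>p. x p \<in> Pl" and yP: "\<And>q. y q \<in> Pr"
    and gap: "\<And>u v. u \<in> Pl \<Longrightarrow> v \<in> Pr \<Longrightarrow> 0 \<le> gap a u v"
      "\<And>u v. u \<in> Pl \<Longrightarrow> v \<in> Pr \<Longrightarrow> gap a u v \<le> Tw \<Longrightarrow> u \<in> (\<Union>j<m. B j) \<and> v \<in> (\<Union>j<m. B j)"
    and disj: "disjoint_family_on B {..<m}"
    and close: "\<And>j l u v. j < m \<Longrightarrow> l < m \<Longrightarrow> u \<in> B j \<Longrightarrow> v \<in> B l \<Longrightarrow>
      \<bar>gap a u v - gap a (ctr j) (ctr l)\<bar> \<le> \<delta>"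
    and c: "\<And>j. j < m \<Longrightarrow> num_points x (B j) = enat (c (True, j))"
      "\<And>j. j < m \<Longrightarrow> num_points y (B j) = enat (c (False, j))"
    and "0 \<le> \<delta>"
  shows "b \<le> Tw \<Longrightarrow> enat k \<le> num_points (\<lambda>(p, q). gap a (x p) (y q)) {0..b} \<Longrightarrow>
      k \<le> cell_pair_count a ctr m c (b + \<delta>)"
    and "1 \<le> i \<Longrightarrow> b + \<delta> \<le> Tw \<Longrightarrow> i \<le> cell_pair_count a ctr m c b \<Longrightarrow>
      \<bar>arrival_time i (\<lambda>(p, q). gap a (x p) (y q)) - cell_arrival a ctr m c i\<bar> \<le> \<delta>"
    and "1 \<le> i \<Longrightarrow> b + \<delta> \<le> Tw \<Longrightarrow> i \<le> cell_pair_count a ctr m c b \<Longrightarrow>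
      arrival_time i (\<lambda>(p, q). gap a (x p) (y q)) \<in> {0..b + \<delta>}"
proof -
  define P where "P j = {p. x p \<in> B j}" for j
  define Q where "Q j = {q. y q \<in> B j}" for j
  have fin: "finite (P j)" "finite (Q j)" and card: "card (P j) = c (True, j)" "card (Q j) = c (False, j)"
    if "j < m" for j
    using c[OF that] by (auto simp: num_points_def P_def Q_def split: if_splits)
  have dj: "disjoint_family_on P {..<m}" "disjoint_family_on Q {..<m}"
    using disj unfolding disjoint_family_on_def P_def Q_def by blast+
  let ?v = "\<lambda>p q. gap a (x p) (y q)"
  define N where "N t = card {(p, q). p \<in> (\<Union>j<m. P j) \<and> q \<in> (\<Union>j<m. Q j) \<and> ?v p q \<le> t}" for t
  have cc: "(\<Sum>(j, l)\<in>{..<m} \<times> {..<m}. if gap a (ctr j) (ctr l) \<le> t then card (P j) * card (Q l) else 0) =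
      cell_pair_count a ctr m c t" for t
    unfolding cell_pair_count_def by (rule sum.cong) (auto simp: card)
  have cl: "\<bar>?v p q - gap a (ctr j) (ctr l)\<bar> \<le> \<delta>" if "j < m" "l < m" "p \<in> P j" "q \<in> Q l" for j l p q
    using close[OF that(1,2)] that(3,4) by (simp add: P_def Q_def)
  have N: "N t \<le> cell_pair_count a ctr m c (t + \<delta>)" "cell_pair_count a ctr m c t \<le> N (t + \<delta>)" for t
    using card_pairs_cells[of m P Q ?v "\<lambda>j l. gap a (ctr j) (ctr l)" \<delta> t, OF fin dj cl]
    unfolding N_def cc by auto
  have num: "num_points (\<lambda>(p, q). ?v p q) {0..t} = enat (N t)" if "t \<le> Tw" for t
  proof -
    have eq: "{s. (case s of (p, q) \<Rightarrow> ?v p q) \<in> {0..t}} =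
        {(p, q). p \<in> (\<Union>j<m. P j) \<and> q \<in> (\<Union>j<m. Q j) \<and> ?v p q \<le> t}" (is "?L = ?R")
    proof (intro set_eqI iffI)
      fix s assume "s \<in> ?L"
      moreover obtain p q where "s = (p, q)" by (cases s)
      ultimately have s: "s = (p, q)" "?v p q \<le> t" by simp_all
      then show "s \<in> ?R" using gap(2)[OF xP yP, of p q] that by (auto simp: P_def Q_def)
    next
      fix s assume "s \<in> ?R"
      then show "s \<in> ?L" using gap(1)[OF xP yP] by auto
    qed
    have "finite ((\<Union>j<m. P j) \<times> (\<Union>j<m. Q j))" using fin by auto
    then have "finite ?R" by (rule rev_finite_subset) auto
    then show ?thesis unfolding num_points_def eq N_def by simp
  qed
  let ?A = "\<lambda>i. {t. enat i \<le> num_points (\<lambda>(p, q). ?v p q) {0..t}}"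
  \<comment> \<open>For \<open>i = 0\<close> the set would be the whole line, since a negative time
    counts no point.\<close>
  have A1: "0 \<le> t" if "1 \<le> i" "t \<in> ?A i" for i t
  proof (rule ccontr)
    assume "\<not> 0 \<le> t"
    then have "{0..t} = {}" by simp
    then have "num_points (\<lambda>(p, q). ?v p q) {0..t} = 0" by (simp add: num_points_def zero_enat_def)
    then show False using that by (simp add: zero_enat_def)
  qed
  have A2: "t \<in> ?A i \<longleftrightarrow> i \<le> N t" if "t \<le> Tw" for i t using num[OF that] by simp
  show "b \<le> Tw \<Longrightarrow> enat k \<le> num_points (\<lambda>(p, q). gap a (x p) (y q)) {0..b} \<Longrightarrow>
      k \<le> cell_pair_count a ctr m c (b + \<delta>)"
    using num[of b] N(1)[of b] by auto
  show "\<bar>arrival_time i (\<lambda>(p, q). gap a (x p) (y q)) - cell_arrival a ctr m c i\<bar> \<le> \<delta>"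
    if "1 \<le> i" "b + \<delta> \<le> Tw" "i \<le> cell_pair_count a ctr m c b"
    unfolding arrival_time_def cell_arrival_def
    by (rule Inf_arrivals_close(1)[OF A1[OF that(1)] A2 N \<open>0 \<le> \<delta>\<close> that(2,3)])
  show "arrival_time i (\<lambda>(p, q). gap a (x p) (y q)) \<in> {0..b + \<delta>}"
    if "1 \<le> i" "b + \<delta> \<le> Tw" "i \<le> cell_pair_count a ctr m c b"
    unfolding arrival_time_def
    by (rule Inf_arrivals_close(2)[OF A1[OF that(1)] A2 N \<open>0 \<le> \<delta>\<close> that(2,3)])
qed

text \<open>The sample lists each pair of indices once in increasing order, the limit counts ordered
  pairs (left point, right point). Sorting is a bijection, because disjointness of \<open>P\<close>
  and \<open>Q\<close> determines which index belongs to the left pole.\<close>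

lemma card_unordered_pairs:
  fixes R :: "nat \<Rightarrow> nat \<Rightarrow> bool"
  assumes sym: "\<And>p q. R p q \<Longrightarrow> R q p" and PQ: "P \<inter> Q = {}" "P \<subseteq> {..<n}" "Q \<subseteq> {..<n}"
    and cov: "\<And>p q. p < n \<Longrightarrow> q < n \<Longrightarrow> R p q \<Longrightarrow> p \<in> P \<and> q \<in> Q \<or> q \<in> P \<and> p \<in> Q"
  shows "card {(p, q). p < q \<and> q < n \<and> R p q} = card {(p, q). p \<in> P \<and> q \<in> Q \<and> R p q}"
proof -
  let ?f = "\<lambda>(p, q). (min p q, max p q)"
  have "bij_betw ?f {(p, q). p \<in> P \<and> q \<in> Q \<and> R p q} {(p, q). p < q \<and> q < n \<and> R p q}"
  proof (rule bij_betwI')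
    fix x y assume x: "x \<in> {(p, q). p \<in> P \<and> q \<in> Q \<and> R p q}" and y: "y \<in> {(p, q). p \<in> P \<and> q \<in> Q \<and> R p q}"
    obtain p q p' q' where xy: "x = (p, q)" "y = (p', q')" by (cases x; cases y)
    have "\<not> (p = q' \<and> q = p')" using x y PQ(1) by (auto simp: xy)
    then show "(?f x = ?f y) = (x = y)" unfolding xy by (auto simp: min_def max_def split: if_splits)
  next
    fix x assume x: "x \<in> {(p, q). p \<in> P \<and> q \<in> Q \<and> R p q}"
    obtain p q where xy: "x = (p, q)" by (cases x)
    have "p \<noteq> q" "p < n" "q < n" "R p q" "R q p" using x PQ sym by (auto simp: xy)
    then show "?f x \<in> {(p, q). p < q \<and> q < n \<and> R p q}" unfolding xy by (auto simp: min_def max_def)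
  next
    fix y assume y: "y \<in> {(p, q). p < q \<and> q < n \<and> R p q}"
    obtain p q where xy: "y = (p, q)" by (cases y)
    have pq: "p < q" "q < n" "R p q" using y by (auto simp: xy)
    from cov[of p q] pq have "p \<in> P \<and> q \<in> Q \<or> q \<in> P \<and> p \<in> Q" by simp
    then show "\<exists>x\<in>{(p, q). p \<in> P \<and> q \<in> Q \<and> R p q}. y = ?f x"
    proof
      assume "p \<in> P \<and> q \<in> Q"
      then show ?thesis using pq unfolding xy by (intro bexI[of _ "(p, q)"]) auto
    next
      assume "q \<in> P \<and> p \<in> Q"
      then show ?thesis using pq sym unfolding xy by (intro bexI[of _ "(q, p)"]) auto
    qed
  qed
  then show ?thesis by (simp add: bij_betw_same_card)
qed

text \<open>The counterpart of \<open>limit_pairs_cells\<close> for a fixed realization. Two things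
  are new: \<open>scaled_gap\<close> takes the place of \<open>gap\<close>, and order statistics of
  distances have to be written as infima of sets of times.\<close>

lemma sample_pairs_cells:
  fixes z :: "nat \<Rightarrow> real \<times> (real ^ 'm)"
  assumes zE: "\<And>p. z p \<in> E" and diam: "\<And>u v. u \<in> E \<Longrightarrow> v \<in> E \<Longrightarrow> dist u v \<le> 2 * a"
    and h: "0 < h" "h\<^sup>2 * K < a"
    and W: "(\<Union>j<m. B j) = cball 0 K" and disj: "disjoint_family_on B {..<m}"
    and cov: "\<And>u v. u \<in> E \<Longrightarrow> v \<in> E \<Longrightarrow> scaled_gap a h u v \<le> Tw \<Longrightarrow>
      (\<exists>x y. norm x \<le> K \<and> norm y \<le> K \<and>
        (u = pole_chart a 1 h x \<and> v = pole_chart a (- 1) h y \<or>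
         v = pole_chart a 1 h x \<and> u = pole_chart a (- 1) h y))"
    and close: "\<And>j l u v. j < m \<Longrightarrow> l < m \<Longrightarrow> u \<in> B j \<Longrightarrow> v \<in> B l \<Longrightarrow>
      \<bar>scaled_gap a h (pole_chart a 1 h u) (pole_chart a (- 1) h v) - gap a (ctr j) (ctr l)\<bar> \<le> \<delta>"
    and c: "\<And>s j. j < m \<Longrightarrow> card {p. p < n \<and> z p \<in> pole_chart a (if s then 1 else - 1) h ` B j} = c (s, j)"
    and "0 \<le> \<delta>" "b + \<delta> \<le> Tw" and k: "k \<le> cell_pair_count a ctr m c b"
  shows "k \<le> size (pair_distances z n)"
    and "i \<in> {1..k} \<Longrightarrow>
      \<bar>(2 * a - ith_largest i (pair_distances z n)) / h\<^sup>2 - cell_arrival a ctr m c i\<bar> \<le> \<delta>"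
    and "i \<in> {1..k} \<Longrightarrow> (2 * a - ith_largest i (pair_distances z n)) / h\<^sup>2 \<in> {0..b + \<delta>}"
proof -
  define P where "P j = {p. p < n \<and> z p \<in> pole_chart a 1 h ` B j}" for j
  define Q where "Q j = {q. q < n \<and> z q \<in> pole_chart a (- 1) h ` B j}" for j
  have fin: "finite (P j)" "finite (Q j)" for j by (simp_all add: P_def Q_def)
  have card: "card (P j) = c (True, j)" "card (Q j) = c (False, j)" if "j < m" for j
    using c[OF that, of True] c[OF that, of False] by (simp_all add: P_def Q_def)
  have inj: "pole_chart a \<sigma> h ` B i \<inter> pole_chart a \<sigma> h ` B j = {}"
    if "B i \<inter> B j = {}" "\<bar>\<sigma>\<bar> = 1" for \<sigma> i j
  proof -
    have "inj (pole_chart a \<sigma> h :: real \<times> (real ^ 'm) \<Rightarrow> _)"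
      using pole_chart_inject[OF h(1) that(2)] by (intro injI) blast
    then show ?thesis using that(1) by (simp flip: image_Int)
  qed
  have "P i \<inter> P j = {}" "Q i \<inter> Q j = {}" if "i < m" "j < m" "i \<noteq> j" for i j
  proof -
    have "B i \<inter> B j = {}" using disjoint_family_onD[OF disj] that by simp
    then show "P i \<inter> P j = {}" "Q i \<inter> Q j = {}"
      using inj[of i j 1] inj[of i j "- 1"] unfolding P_def Q_def by auto
  qed
  then have dj: "disjoint_family_on P {..<m}" "disjoint_family_on Q {..<m}"
    by (simp_all add: disjoint_family_on_def)
  let ?v = "\<lambda>p q. scaled_gap a h (z p) (z q)"
  define N where "N t = card {(p, q). p \<in> (\<Union>j<m. P j) \<and> q \<in> (\<Union>j<m. Q j) \<and> ?v p q \<le> t}" for t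
  have cc: "(\<Sum>(j, l)\<in>{..<m} \<times> {..<m}. if gap a (ctr j) (ctr l) \<le> t then card (P j) * card (Q l) else 0) =
      cell_pair_count a ctr m c t" for t
    unfolding cell_pair_count_def by (rule sum.cong) (auto simp: card)
  have cl: "\<bar>?v p q - gap a (ctr j) (ctr l)\<bar> \<le> \<delta>" if "j < m" "l < m" "p \<in> P j" "q \<in> Q l" for j l p q
    using close[OF that(1,2)] that(3,4) by (auto simp: P_def Q_def)
  have N: "N t \<le> cell_pair_count a ctr m c (t + \<delta>)" "cell_pair_count a ctr m c t \<le> N (t + \<delta>)" for t
    using card_pairs_cells[of m P Q ?v "\<lambda>j l. gap a (ctr j) (ctr l)" \<delta> t, OF fin dj cl]
    unfolding N_def cc by auto
  define N' where "N' t = card {(p, q). p < q \<and> q < n \<and> ?v p q \<le> t}" for t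
  have NN': "N' t = N t" if "t \<le> Tw" for t
    unfolding N_def N'_def
  proof (rule card_unordered_pairs)
    show "(\<Union>j<m. P j) \<inter> (\<Union>j<m. Q j) = {}"
    proof -
      \<comment> \<open>As \<open>h^2 * K < a\<close>, the two charts map the window into opposite
        half-spaces, so no sample point is counted at both poles.\<close>
      have "fst (pole_chart a 1 h x) < 0" "0 < fst (pole_chart a (- 1) h x)" if "x \<in> B j" "j < m" for x j
      proof -
        have "norm x \<le> K" using that W by auto
        then have "fst x \<le> K" using norm_fst_le[of "fst x" "snd x"] by simp
        then have "h\<^sup>2 * fst x \<le> h\<^sup>2 * K" by (intro mult_left_mono) auto
        then show "fst (pole_chart a 1 h x) < 0" "0 < fst (pole_chart a (- 1) h x)"
          using h(2) by (simp_all add: pole_chart_def)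
      qed
      then have "z p \<notin> pole_chart a (- 1) h ` B l" if "z p \<in> pole_chart a 1 h ` B j" "j < m" "l < m" for p j l
        using that by (metis imageE less_asym)
      then show ?thesis unfolding P_def Q_def by blast
    qed
    fix p q assume "p < n" "q < n" "?v p q \<le> t"
    then have "?v p q \<le> Tw" using that by simp
    from cov[OF zE zE this] obtain x y where xy: "norm x \<le> K" "norm y \<le> K"
        "z p = pole_chart a 1 h x \<and> z q = pole_chart a (- 1) h y \<or>
         z q = pole_chart a 1 h x \<and> z p = pole_chart a (- 1) h y" by blast
    have "x \<in> (\<Union>j<m. B j)" "y \<in> (\<Union>j<m. B j)" using xy(1,2) by (simp_all add: W)
    then obtain j l where "j < m" "x \<in> B j" "l < m" "y \<in> B l" by blast
    then show "p \<in> (\<Union>j<m. P j) \<and> q \<in> (\<Union>j<m. Q j) \<or> q \<in> (\<Union>j<m. P j) \<and> p \<in> (\<Union>j<m. Q j)"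
      using xy(3) \<open>p < n\<close> \<open>q < n\<close> unfolding P_def Q_def by blast
  qed (auto simp: P_def Q_def scaled_gap_commute)
  have h2: "0 < h\<^sup>2" using h(1) by simp
  have N'eq: "N' t = size {#x \<in># pair_distances z n. 2 * a - h\<^sup>2 * t \<le> x#}" for t
    unfolding size_filter_pair_distances N'_def scaled_gap_def
    using h2 by (simp add: pos_divide_le_eq algebra_simps)
  have sz: "N' t \<le> size (pair_distances z n)" for t
    unfolding N'eq by (rule size_mset_mono) simp
  have "cell_pair_count a ctr m c b \<le> N' (b + \<delta>)" using N(2)[of b] NN'[OF \<open>b + \<delta> \<le> Tw\<close>] by simp
  with k sz[of "b + \<delta>"] show kk: "k \<le> size (pair_distances z n)" by linarith
  show "\<bar>(2 * a - ith_largest i (pair_distances z n)) / h\<^sup>2 - cell_arrival a ctr m c i\<bar> \<le> \<delta>"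
    and "(2 * a - ith_largest i (pair_distances z n)) / h\<^sup>2 \<in> {0..b + \<delta>}" if i: "i \<in> {1..k}"
  proof -
    let ?u = "(2 * a - ith_largest i (pair_distances z n)) / h\<^sup>2"
    have iff: "i \<le> N' t \<longleftrightarrow> ?u \<le> t" for t
    proof -
      have "i \<le> N' t \<longleftrightarrow> 2 * a - h\<^sup>2 * t \<le> ith_largest i (pair_distances z n)"
        unfolding N'eq using i kk by (subst le_ith_largest_iff) auto
      then show ?thesis using h2 by (simp add: pos_divide_le_eq algebra_simps)
    qed
    \<comment> \<open>The \<open>i\<close>-th largest distance is the \<open>i\<close>-th smallest
      scaled gap. The times with at least \<open>i\<close> pairs thus form a closed half-line, and
      \<open>?u\<close> is their infimum, as an arrival time is in the limit.\<close>
    then have A: "{t. i \<le> N' t} = {?u..}" by auto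
    have A1: "0 \<le> t" if "t \<in> {t. i \<le> N' t}" for t
    proof (rule ccontr)
      assume "\<not> 0 \<le> t"
      have "0 \<le> ?v p q" for p q
        unfolding scaled_gap_def using diam[OF zE zE, of p q] h2 by (intro divide_nonneg_pos) auto
      then have "\<not> ?v p q \<le> t" for p q using \<open>\<not> 0 \<le> t\<close> by (meson order_trans)
      then show False using that i by (simp add: N'_def)
    qed
    have A2: "t \<in> {t. i \<le> N' t} \<longleftrightarrow> i \<le> N t" if "t \<le> Tw" for t using NN'[OF that] by simp
    have ik: "i \<le> cell_pair_count a ctr m c b" using i k by simp
    have "Inf {t. i \<le> N' t} = ?u" unfolding A by simp
    with Inf_arrivals_close[OF A1 A2 N \<open>0 \<le> \<delta>\<close> \<open>b + \<delta> \<le> Tw\<close> ik]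
    show "\<bar>?u - cell_arrival a ctr m c i\<bar> \<le> \<delta>" "?u \<in> {0..b + \<delta>}"
      unfolding cell_arrival_def by simp_all
  qed
qed

section \<open>Convergence in distribution\<close>

lemma emeasure_scaled_restricted_lborel:
  assumes [measurable]: "P \<in> sets borel" "B \<in> sets borel"
  shows "emeasure (scale_measure (ennreal p) (density lborel (indicator P))) B =
      ennreal p * emeasure lborel (B \<inter> P)"
proof -
  have "emeasure (density lborel (indicator P)) B = (\<integral>\<^sup>+ x. indicator P x * indicator B x \<partial>lborel)"
    by (rule emeasure_density) auto
  also have "\<dots> = (\<integral>\<^sup>+ x. indicator (B \<inter> P) x \<partial>lborel)"
    by (intro nn_integral_cong) (auto simp: indicator_def)
  also have "\<dots> = emeasure lborel (B \<inter> P)" by simp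
  finally show ?thesis by simp
qed

text \<open>With mean zero the Poisson formula gives the count 0 probability 1; applied to the
  complement of the paraboloid.\<close>

lemma (in prob_space) AE_poisson_process_support:
  assumes X: "poisson_process M \<mu> X" and S: "S \<in> sets \<mu>" "emeasure \<mu> S = 0"
  shows "AE \<omega> in M. \<forall>i. X i \<omega> \<notin> S"
proof -
  have Xm: "X i \<in> measurable M \<mu>" for i using X by (simp add: poisson_process_def)
  have "prob {\<omega> \<in> space M. num_points (\<lambda>i. X i \<omega>) S = enat 0} = measure \<mu> S ^ 0 / fact 0 * exp (- measure \<mu> S)"
    using X S unfolding poisson_process_def by auto
  then have "prob {\<omega> \<in> space M. num_points (\<lambda>i. X i \<omega>) S = enat 0} = 1"
    using S by (simp add: measure_def)
  moreover have "{\<omega> \<in> space M. num_points (\<lambda>i. X i \<omega>) S = enat 0} \<in> events"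
  proof -
    have "Measurable.pred M (\<lambda>\<omega>. X i \<omega> \<in> S)" for i using Xm S(1) by measurable
    then have "Measurable.pred M (\<lambda>\<omega>. num_points (\<lambda>i. X i \<omega>) S = enat 0)"
      by (rule pred_num_points_eq_enat)
    then show ?thesis by measurable
  qed
  ultimately have "AE \<omega> in M. \<omega> \<in> {\<omega> \<in> space M. num_points (\<lambda>i. X i \<omega>) S = enat 0}"
    by (simp add: prob_eq_1)
  then show ?thesis
    by eventually_elim (auto simp: num_points_def split: if_splits)
qed

text \<open>The Poisson weights of the finite counts already sum to 1, which leaves no mass for an
  infinite count.\<close>

lemma (in prob_space) AE_poisson_process_finite:
  assumes X: "poisson_process M \<mu> X" and S: "S \<in> sets \<mu>" "emeasure \<mu> S < \<infinity>"
  shows "AE \<omega> in M. num_points (\<lambda>i. X i \<omega>) S \<noteq> \<infinity>"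
proof -
  have Xm: "X i \<in> measurable M \<mu>" for i using X by (simp add: poisson_process_def)
  let ?A = "\<lambda>m. {\<omega> \<in> space M. num_points (\<lambda>i. X i \<omega>) S = enat m}"
  have A: "?A m \<in> events" for m
  proof -
    have "Measurable.pred M (\<lambda>\<omega>. X i \<omega> \<in> S)" for i using Xm S(1) by measurable
    then have "Measurable.pred M (\<lambda>\<omega>. num_points (\<lambda>i. X i \<omega>) S = enat m)"
      by (rule pred_num_points_eq_enat)
    then show ?thesis by measurable
  qed
  let ?r = "measure \<mu> S"
  have "(\<lambda>m. prob (?A m)) sums prob (\<Union>m. ?A m)"
    using A by (intro finite_measure_UNION) (auto simp: disjoint_family_on_def)
  moreover have "prob (?A m) = ?r ^ m / fact m * exp (- ?r)" for m
    using X S unfolding poisson_process_def by blast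
  moreover have "(\<lambda>m. ?r ^ m / fact m * exp (- ?r)) sums 1"
  proof -
    have "(\<lambda>m. ?r ^ m /\<^sub>R fact m * exp (- ?r)) sums (exp ?r * exp (- ?r))"
      by (intro sums_mult2 exp_converges)
    then show ?thesis by (simp add: exp_minus divide_inverse mult.commute)
  qed
  ultimately have "prob (\<Union>m. ?A m) = 1" using sums_unique2 by auto
  then have "AE \<omega> in M. \<omega> \<in> (\<Union>m. ?A m)" using A by (subst (asm) prob_eq_1) auto
  then show ?thesis by eventually_elim auto
qed

lemma (in prob_space) prob_distributed_eq_integral:
  fixes g :: "'b :: euclidean_space \<Rightarrow> real"
  assumes D: "distributed M lborel Z (\<lambda>z. ennreal (g z))" and g0: "\<And>z. 0 \<le> g z" and S: "S \<in> sets borel"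
  shows "g \<in> borel_measurable borel"
    and "prob {\<omega> \<in> space M. Z \<omega> \<in> S} = (\<integral>z. indicator S z * g z \<partial>lborel)"
proof -
  have "(\<lambda>z. ennreal (g z)) \<in> borel_measurable lborel" using D by (rule distributed_borel_measurable)
  then have "(\<lambda>z. enn2real (ennreal (g z))) \<in> borel_measurable lborel" by measurable
  then show g: "g \<in> borel_measurable borel" using g0 by simp
  have Zm: "Z \<in> measurable M lborel" using D by (rule distributed_measurable)
  have "prob {\<omega> \<in> space M. Z \<omega> \<in> S} = measure (distr M lborel Z) S"
    using S by (subst measure_distr[OF Zm]) (auto intro!: arg_cong[where f = prob])
  also have "distr M lborel Z = density lborel (\<lambda>z. ennreal (g z))"
    using D by (rule distributed_distr_eq_density)
  also have "measure \<dots> S = enn2real (\<integral>\<^sup>+ z. ennreal (g z) * indicator S z \<partial>lborel)"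
    using S g by (simp add: measure_def emeasure_density)
  also have "(\<lambda>z. ennreal (g z) * indicator S z) = (\<lambda>z. ennreal (indicator S z * g z))"
    by (auto simp: fun_eq_iff indicator_def)
  also have "enn2real (\<integral>\<^sup>+ z. ennreal (indicator S z * g z) \<partial>lborel) = (\<integral>z. indicator S z * g z \<partial>lborel)"
    using S g g0 by (intro integral_eq_nn_integral[symmetric]) auto
  finally show "prob {\<omega> \<in> space M. Z \<omega> \<in> S} = (\<integral>z. indicator S z * g z \<partial>lborel)" .
qed

lemma (in prob_space) AE_distributed_indicator:
  fixes g :: "'b :: euclidean_space \<Rightarrow> real"
  assumes D: "distributed M lborel Z (\<lambda>z. ennreal (indicator E z * f z))" and E: "E \<in> sets borel"
  shows "AE \<omega> in M. Z \<omega> \<in> E"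
proof -
  have g: "(\<lambda>z. ennreal (indicator E z * f z)) \<in> borel_measurable lborel"
    using D by (rule distributed_borel_measurable)
  have Zm: "Z \<in> measurable M lborel" using D by (rule distributed_measurable)
  have "AE z in density lborel (\<lambda>z. ennreal (indicator E z * f z)). z \<in> E"
    using g by (subst AE_density) (auto simp: indicator_def)
  then have "AE z in distr M lborel Z. z \<in> E"
    unfolding distributed_distr_eq_density[OF D] .
  then show ?thesis using E by (subst (asm) AE_distr_iff[OF Zm]) auto
qed

section \<open>Random tuples and approximation arguments\<close>

lemma random_element_measurable_comp:
  assumes X: "random_element T M X" and g: "continuous_map T euclideanreal g"
  shows "(\<lambda>\<omega>. g (X \<omega>)) \<in> borel_measurable M"
proof (rule borel_measurableI)
  fix S :: "real set" assume "open S"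
  then have "openin T {x \<in> topspace T. g x \<in> S}"
    using openin_continuous_map_preimage[OF g, of S] by simp
  then have "X -` {x \<in> topspace T. g x \<in> S} \<inter> space M \<in> sets M"
    using X unfolding random_element_def by blast
  also have "X -` {x \<in> topspace T. g x \<in> S} \<inter> space M = (\<lambda>\<omega>. g (X \<omega>)) -` S \<inter> space M"
    using X by (auto simp: random_element_def)
  finally show "(\<lambda>\<omega>. g (X \<omega>)) -` S \<inter> space M \<in> sets M" .
qed

lemma tuple_in_topspace: "tuple k x \<in> topspace (Euclidean_space k)"
  by (simp add: topspace_Euclidean_space tuple_def)

lemma random_element_tuple:
  assumes "\<And>i. i \<in> {1..k} \<Longrightarrow> x i \<in> borel_measurable M"
  shows "random_element (Euclidean_space k) M (\<lambda>\<omega>. tuple k (\<lambda>i. x i \<omega>))"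
  unfolding random_element_def
proof (intro conjI ballI allI impI tuple_in_topspace)
  fix V assume "openin (Euclidean_space k) V"
  then obtain U where U: "open U" "V = {x. \<forall>i\<ge>k. x i = 0} \<inter> U"
    by (auto simp: Euclidean_space_eq_top_of_set openin_open)
  have "(\<lambda>\<omega>. tuple k (\<lambda>i. x i \<omega>)) \<in> borel_measurable M"
  proof (rule measurable_coordinatewise_then_product)
    fix i
    show "(\<lambda>\<omega>. tuple k (\<lambda>i. x i \<omega>) i) \<in> borel_measurable M"
      using assms[of "Suc i"] by (cases "i < k") (auto simp: tuple_def)
  qed
  then have "(\<lambda>\<omega>. tuple k (\<lambda>i. x i \<omega>)) -` U \<inter> space M \<in> sets M"
    using U(1) by (intro measurable_sets) auto
  also have "(\<lambda>\<omega>. tuple k (\<lambda>i. x i \<omega>)) -` U \<inter> space M = (\<lambda>\<omega>. tuple k (\<lambda>i. x i \<omega>)) -` V \<inter> space M"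
    by (auto simp: U(2) tuple_def)
  finally show "(\<lambda>\<omega>. tuple k (\<lambda>i. x i \<omega>)) -` V \<inter> space M \<in> sets M" .
qed

lemma gap_uniform_on_cball:
  fixes K :: real
  assumes "0 < a" "0 < \<epsilon>"
  obtains \<rho> where "0 < \<rho>"
    "\<And>x y x' y' :: real \<times> (real ^ 'm). norm x \<le> K \<Longrightarrow> norm y \<le> K \<Longrightarrow> norm x' \<le> K \<Longrightarrow> norm y' \<le> K \<Longrightarrow>
       dist x x' < \<rho> \<Longrightarrow> dist y y' < \<rho> \<Longrightarrow> \<bar>gap a x y - gap a x' y'\<bar> \<le> \<epsilon>"
proof -
  let ?W = "cball 0 K \<times> cball 0 K :: ((real \<times> (real ^ 'm)) \<times> (real \<times> (real ^ 'm))) set"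
  let ?f = "\<lambda>p :: (real \<times> (real ^ 'm)) \<times> (real \<times> (real ^ 'm)). gap a (fst p) (snd p)"
  have "continuous_on ?W ?f" unfolding gap_def using assms(1) by (intro continuous_intros) auto
  moreover have "compact ?W" by (intro compact_Times compact_cball)
  ultimately have "uniformly_continuous_on ?W ?f" by (intro compact_uniformly_continuous)
  then obtain d where d: "0 < d" "\<And>p q. p \<in> ?W \<Longrightarrow> q \<in> ?W \<Longrightarrow> dist q p < d \<Longrightarrow> dist (?f q) (?f p) < \<epsilon>"
    using assms(2) unfolding uniformly_continuous_on_def by metis
  show thesis
  proof (rule that[of "d / 2"])
    show "0 < d / 2" using d by simp
    fix x y x' y' :: "real \<times> (real ^ 'm)"
    assume n: "norm x \<le> K" "norm y \<le> K" "norm x' \<le> K" "norm y' \<le> K" and c: "dist x x' < d / 2" "dist y y' < d / 2"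
    have "dist (x, y) (x', y') \<le> dist x x' + dist y y'"
      unfolding dist_Pair_Pair by (rule sqrt_sum_squares_le_sum) auto
    then have "dist (x, y) (x', y') < d" using c by simp
    from d(2)[OF _ _ this] n show "\<bar>gap a x y - gap a x' y'\<bar> \<le> \<epsilon>"
      by (auto simp: dist_real_def intro: less_imp_le)
  qed
qed

lemma LIMSEQ_by_approximation:
  fixes x :: "nat \<Rightarrow> real"
  assumes "\<And>\<epsilon>. 0 < \<epsilon> \<Longrightarrow> \<exists>s l. s \<longlonglongrightarrow> l \<and> eventually (\<lambda>n. \<bar>x n - s n\<bar> \<le> \<epsilon>) sequentially \<and> \<bar>y - l\<bar> \<le> \<epsilon>"
  shows "x \<longlonglongrightarrow> y"
proof (rule tendstoI)
  fix e :: real assume "0 < e"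
  then obtain s l where s: "s \<longlonglongrightarrow> l" "eventually (\<lambda>n. \<bar>x n - s n\<bar> \<le> e / 4) sequentially" "\<bar>y - l\<bar> \<le> e / 4"
    using assms[of "e / 4"] by auto
  have "eventually (\<lambda>n. dist (s n) l < e / 4) sequentially"
    using s(1) \<open>0 < e\<close> by (intro tendstoD) auto
  with s(2) show "eventually (\<lambda>n. dist (x n) y < e) sequentially"
  proof eventually_elim
    case (elim n)
    then show ?case using s(3) \<open>0 < e\<close> unfolding dist_real_def by linarith
  qed
qed

lemma (in prob_space) prob_Int_ge:
  assumes "A \<in> events" "B \<in> events"
  shows "prob A + prob B - 1 \<le> prob (A \<inter> B)"
proof -
  have "prob A = prob (A \<inter> B) + prob (A - B)"
    using assms finite_measure_Diff'[of A B] by simp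
  moreover have "prob (A - B) \<le> prob (space M - B)"
    using assms sets.sets_into_space by (intro finite_measure_mono) auto
  ultimately show ?thesis using prob_compl[OF assms(2)] by simp
qed

theorem theorem3:
  fixes a \<eta> pl pr :: real
    and E :: "(real \<times> (real ^ ('m :: {finite, linorder}))) set"
    and sl sr :: "real ^ ('m :: {finite, linorder}) \<Rightarrow> real"
    and \<kappa>l \<kappa>r :: "real ^ ('m :: {finite, linorder})"
    and Ul Ur :: "real ^ ('m :: {finite, linorder}) ^ ('m :: {finite, linorder})"
    and f :: "real \<times> (real ^ ('m :: {finite, linorder})) \<Rightarrow> real"
    and M :: "'w measure"
    and Z :: "nat \<Rightarrow> 'w \<Rightarrow> real \<times> (real ^ ('m :: {finite, linorder}))"
    and N :: "nat \<Rightarrow> 'w \<Rightarrow> nat"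
    and D :: "nat \<Rightarrow> nat \<Rightarrow> 'w \<Rightarrow> real"
    and M' :: "'v measure"
    and X Y :: "nat \<Rightarrow> 'v \<Rightarrow> real \<times> (real ^ ('m :: {finite, linorder}))"
    and k :: nat
  assumes "0 < a"
    and "unique_diameter a E"
    and "smooth_pole_caps a E sl sr"
    and "ordered_eigensystem (hessian sl 0) \<kappa>l Ul"
    and "ordered_eigensystem (hessian sr 0) \<kappa>r Ur"
    and "0 < \<eta>" and "\<eta> < 1"
    and "positive_semidefinite (curvature_matrix a \<eta> \<kappa>l Ul \<kappa>r Ur)"
    and "\<And>z. z \<in> E \<Longrightarrow> 0 \<le> f z"
    and "(LINT z:E|lborel. f z) = 1"
    and "continuous (at (left_pole a) within E) f"
    and "continuous (at (right_pole a) within E) f"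
    and "pl = f (left_pole a)" and "0 < pl"
    and "pr = f (right_pole a)" and "0 < pr"
    and "prob_space M"
    and "prob_space.indep_vars M (\<lambda>_. borel) Z UNIV"
    and "\<And>i. distributed M lborel (Z i) (\<lambda>z. ennreal (indicator E z * f z))"
    and "\<And>n. 1 \<le> n \<Longrightarrow> distr M (count_space UNIV) (N n) = measure_pmf (poisson_pmf (real n))"
    and "\<And>n. 1 \<le> n \<Longrightarrow>
           independent_rvs M (count_space UNIV) (N n) (PiM UNIV (\<lambda>_. borel)) (\<lambda>\<omega> i. Z i \<omega>)"
    and "\<And>n i. i \<in> {1..k} \<Longrightarrow> D n i \<in> borel_measurable M"
    and "\<And>n i \<omega>. 1 \<le> n \<Longrightarrow> i \<in> {1..k} \<Longrightarrow> \<omega> \<in> space M \<Longrightarrow>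
           k \<le> size (pair_distances (\<lambda>j. Z j \<omega>) (N n \<omega>)) \<Longrightarrow>
           D n i \<omega> = ith_largest i (pair_distances (\<lambda>j. Z j \<omega>) (N n \<omega>))"
    and "prob_space M'"
    and "poisson_process M'
           (scale_measure (ennreal pl) (density lborel (indicator (paraboloid (hessian sl 0))))) X"
    and "poisson_process M'
           (scale_measure (ennreal pr) (density lborel (indicator (paraboloid (hessian sr 0))))) Y"
    and "independent_point_processes M' X Y"
  shows "converges_in_distribution (Euclidean_space k)
           M (\<lambda>n \<omega>. tuple k (\<lambda>i. real n powr (2 / (real DIM(real \<times> (real ^ ('m :: {finite, linorder}))) + 1))
                                    * (2 * a - D n i \<omega>)))
           M' (\<lambda>\<omega>. tuple k (\<lambda>i. arrival_time i (\<lambda>(p, q). gap a (X p \<omega>) (Y q \<omega>))))"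
proof -
  interpret M: prob_space M by (rule assms(17))
  interpret M': prob_space M' by (rule assms(24))
  note a = assms(1) and diam = assms(2) and \<eta> = assms(6,7)
  let ?Pl = "paraboloid (hessian sl 0)" and ?Pr = "paraboloid (hessian sr 0)"
  let ?\<mu>l = "scale_measure (ennreal pl) (density lborel (indicator ?Pl))"
  let ?\<mu>r = "scale_measure (ennreal pr) (density lborel (indicator ?Pr))"
  note X = assms(25) and Y = assms(26) and XY = assms(27)
  have capl: "pole_cap a 1 E sl" and capr: "pole_cap a (- 1) E sr"
    using smooth_pole_caps_imp_pole_cap[OF diam assms(3)] by auto
  have curv: "(norm (x - y))\<^sup>2 \<le> 2 * a * \<eta> * (x \<bullet> (hessian sl 0 *v x) + y \<bullet> (hessian sr 0 *v y))" for x y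
    by (rule curvature_condition_form[OF assms(4,5,8)])
  have closedE: "closed E" and bE: "bounded E" and dE: "diameter E = 2 * a"
    using diam by (auto simp: unique_diameter_def)
  have E_borel: "E \<in> sets borel" using closedE by simp
  have le_diam: "dist u v \<le> 2 * a" if "u \<in> E" "v \<in> E" for u v
    using diameter_bounded_bound[OF bE that] dE by simp
  let ?g = "\<lambda>z. indicator E z * f z :: real"
  have g0: "0 \<le> ?g z" for z using assms(9) by (simp add: indicator_def)
  have gm: "?g \<in> borel_measurable borel"
    using M.prob_distributed_eq_integral(1)[OF assms(19) g0, of UNIV] by simp
  define h where "h n = real n powr (- 1 / real (CARD('m) + 2))" for n
  have hpos: "0 < h n" if "1 \<le> n" for n using that by (simp add: h_def)
  have h_lim: "h \<longlonglongrightarrow> 0" unfolding h_def by (intro tendsto_neg_powr filterlim_real_sequentially) simp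
  \<comment> \<open>The dimension is \<open>CARD('m) + 1\<close>, so the normalizing factor of the
    theorem is exactly \<open>1 / h^2\<close>.\<close>
  have scale: "real n powr (2 / (real DIM(real \<times> (real ^ ('m :: {finite, linorder}))) + 1)) * t = t / (h n)\<^sup>2" if "1 \<le> n" for n t
  proof -
    have "(h n)\<^sup>2 = h n powr 2" using hpos[OF that] powr_realpow[of "h n" 2] by simp
    also have "\<dots> = real n powr (- (2 / (real DIM(real \<times> (real ^ ('m :: {finite, linorder}))) + 1)))"
      by (simp add: h_def powr_powr)
    finally show ?thesis using that by (simp add: powr_minus divide_inverse mult.commute)
  qed
  let ?T = "\<lambda>n \<omega> i. real n powr (2 / (real DIM(real \<times> (real ^ ('m :: {finite, linorder}))) + 1)) * (2 * a - D n i \<omega>)"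
  let ?G = "\<lambda>\<omega> (p, q). gap a (X p \<omega>) (Y q \<omega>)"
  let ?T' = "\<lambda>\<omega> i. arrival_time i (?G \<omega>)"
  have Xm[measurable]: "X p \<in> borel_measurable M'" and Ym[measurable]: "Y q \<in> borel_measurable M'" for p q
    using X Y by (auto simp: poisson_process_def cong: measurable_cong_sets)
  have Gm: "(\<lambda>\<omega>. ?G \<omega> s) \<in> borel_measurable M'" for s
  proof (cases s)
    case (Pair p q)
    have "(\<lambda>u. gap a (fst u) (snd u)) \<in> borel_measurable borel"
      unfolding gap_def using a by (intro borel_measurable_continuous_onI continuous_intros) auto
    moreover have "(\<lambda>\<omega>. (X p \<omega>, Y q \<omega>)) \<in> borel_measurable M'"
      using Xm Ym by (rule borel_measurable_Pair)
    ultimately have "(\<lambda>\<omega>. gap a (fst (X p \<omega>, Y q \<omega>)) (snd (X p \<omega>, Y q \<omega>))) \<in> borel_measurable M'"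
      by (rule measurable_compose[rotated])
    then show ?thesis by (simp add: Pair)
  qed
  have re: "random_element (Euclidean_space k) M (\<lambda>\<omega>. tuple k (?T n \<omega>))" for n
  proof (rule random_element_tuple)
    fix i assume "i \<in> {1..k}"
    then have [measurable]: "D n i \<in> borel_measurable M" by (rule assms(22))
    show "(\<lambda>\<omega>. ?T n \<omega> i) \<in> borel_measurable M" by measurable
  qed
  have re': "random_element (Euclidean_space k) M' (\<lambda>\<omega>. tuple k (?T' \<omega>))"
    by (rule random_element_tuple, rule borel_measurable_arrival_time[OF Gm]) simp
  have em_l: "emeasure ?\<mu>l S = ennreal pl * emeasure lborel (S \<inter> ?Pl)"
    and em_r: "emeasure ?\<mu>r S = ennreal pr * emeasure lborel (S \<inter> ?Pr)" if "S \<in> sets borel" for S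
    by (rule emeasure_scaled_restricted_lborel[OF borel_closed[OF closed_paraboloid] that])+
  \<comment> \<open>On the paraboloids \<open>gap\<close> is nonnegative, so the intervals
    \<open>{0..t}\<close> in the arrival times miss no pair with gap at most
    \<open>t\<close>.\<close>
  have gap_AE: "AE \<omega> in M'. (\<forall>p. X p \<omega> \<in> ?Pl) \<and> (\<forall>q. Y q \<omega> \<in> ?Pr)"
  proof -
    have "AE \<omega> in M'. \<forall>p. X p \<omega> \<notin> - ?Pl"
    proof (rule M'.AE_poisson_process_support[OF X])
      show S: "- ?Pl \<in> sets ?\<mu>l"
        unfolding sets_scale_measure sets_density sets_lborel by (rule borel_comp[OF borel_closed[OF closed_paraboloid]])
      show "emeasure ?\<mu>l (- ?Pl) = 0"
        using S unfolding sets_scale_measure sets_density sets_lborel by (subst em_l) simp_all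
    qed
    moreover have "AE \<omega> in M'. \<forall>q. Y q \<omega> \<notin> - ?Pr"
    proof (rule M'.AE_poisson_process_support[OF Y])
      show S: "- ?Pr \<in> sets ?\<mu>r"
        unfolding sets_scale_measure sets_density sets_lborel by (rule borel_comp[OF borel_closed[OF closed_paraboloid]])
      show "emeasure ?\<mu>r (- ?Pr) = 0"
        using S unfolding sets_scale_measure sets_density sets_lborel by (subst em_r) simp_all
    qed
    ultimately show ?thesis by eventually_elim simp
  qed
  have Z_AE: "AE \<omega> in M. \<forall>i. Z i \<omega> \<in> E"
    using M.AE_distributed_indicator[OF assms(19) E_borel] by (simp add: AE_all_countable)
  have conv: "(\<lambda>n. M.expectation (\<lambda>\<omega>. g (tuple k (?T n \<omega>)))) \<longlonglongrightarrow> M'.expectation (\<lambda>\<omega>. g (tuple k (?T' \<omega>)))"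
    if g: "continuous_map (Euclidean_space k) euclideanreal g" and gb: "bounded (g ` topspace (Euclidean_space k))" for g
  proof (rule LIMSEQ_by_approximation)
    fix \<epsilon> :: real assume "0 < \<epsilon>"
    obtain b where b: "0 < b" "\<And>x. x \<in> topspace (Euclidean_space k) \<Longrightarrow> \<bar>g x\<bar> \<le> b"
      using gb by (auto simp: bounded_pos)
    \<comment> \<open>The error budget: \<open>e\<close> for closeness on the retained events,
      \<open>b * (2 * e)\<close> for the mass outside them.\<close>
    define e where "e = \<epsilon> / (1 + 2 * b)"
    have "e * (1 + 2 * b) = \<epsilon>" using b(1) by (simp add: e_def)
    moreover have "e + b * (2 * e) = e * (1 + 2 * b)" by (simp add: algebra_simps)
    ultimately have e: "0 < e" "e + b * (2 * e) = \<epsilon>"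
      using b(1) \<open>0 < \<epsilon>\<close> by (simp_all add: e_def)
    have gT: "(\<lambda>\<omega>. g (tuple k (?T n \<omega>))) \<in> borel_measurable M" for n
      by (rule random_element_measurable_comp[OF re g])
    have gT': "(\<lambda>\<omega>. g (tuple k (?T' \<omega>))) \<in> borel_measurable M'"
      by (rule random_element_measurable_comp[OF re' g])

    \<comment> \<open>Choice of the time horizon, the window and the cells\<close>
    let ?early = "\<lambda>T \<omega>. enat k \<le> num_points (?G \<omega>) {0..real T}"
    have early_pred: "Measurable.pred M' (?early T)" for T
    proof -
      have "Measurable.pred M' (\<lambda>\<omega>. ?G \<omega> s \<in> {0..real T})" for s using Gm[of s] by measurable
      then show ?thesis by (rule pred_enat_le_num_points)
    qed
    \<comment> \<open>Half of the admissible loss of mass; the other half goes to the event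
      \<open>?few\<close> below.\<close>
    have "\<exists>T. 1 - e / 2 < M'.prob {\<omega> \<in> space M'. ?early T \<omega>}"
    proof (rule M'.prob_eventually_ge[OF early_pred])
      fix n n' :: nat and \<omega> assume le: "n \<le> n'" and "?early n \<omega>"
      then obtain S where S: "finite S" "card S = k" "\<forall>s\<in>S. ?G \<omega> s \<in> {0..real n}"
        unfolding enat_le_num_points_iff by blast
      have "\<forall>s\<in>S. ?G \<omega> s \<in> {0..real n'}"
      proof
        fix s assume "s \<in> S"
        then have "?G \<omega> s \<in> {0..real n}" using S(3) by blast
        moreover have "real n \<le> real n'" using le by simp
        ultimately show "?G \<omega> s \<in> {0..real n'}" unfolding atLeastAtMost_iff by linarith
      qed
      then show "?early n' \<omega>" using S(1,2) unfolding enat_le_num_points_iff by blast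
    next
      show "AE \<omega> in M'. \<exists>T. ?early T \<omega>"
        using gap_AE
      proof eventually_elim
        case (elim \<omega>)
        \<comment> \<open>An enumeration by all of \<open>nat\<close> provides the pairs; their gaps just have to be finite.\<close>
        obtain T :: nat where T: "(\<Sum>p<k. \<bar>?G \<omega> (p, 0)\<bar>) \<le> real T" using real_arch_simple by blast
        have "?G \<omega> s \<in> {0..real T}" if s: "s \<in> (\<lambda>p. (p, 0)) ` {..<k}" for s
        proof -
          obtain p where p: "s = (p, 0)" "p < k" using s by auto
          have "0 \<le> ?G \<omega> s" using paraboloid_gap_bounds(1)[OF curv a \<eta>] elim by (simp add: p)
          moreover have "\<bar>?G \<omega> s\<bar> \<le> (\<Sum>p<k. \<bar>?G \<omega> (p, 0)\<bar>)"
            unfolding p(1) using p(2) by (intro member_le_sum[of p]) auto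
          ultimately show ?thesis using T by simp
        qed
        moreover have "card ((\<lambda>p. (p, 0 :: nat)) ` {..<k}) = k" by (simp add: card_image inj_on_def)
        ultimately have "?early T \<omega>"
          unfolding enat_le_num_points_iff by (intro exI[of _ "(\<lambda>p. (p, 0)) ` {..<k}"]) blast
        then show ?case ..
      qed
    next
      show "0 < e / 2" using e by simp
    qed
    then obtain T where T: "1 - e / 2 < M'.prob {\<omega> \<in> space M'. ?early T \<omega>}" by blast
    \<comment> \<open>Passing from points to cells and back costs \<delta> <= 1 each time and one
      unit is kept for the bound in \<open>F\<close>, so times up to
      \<open>real T + 1 + \<delta>\<close> must be covered.\<close>
    define Tw where "Tw = real T + 4"
    have Tw: "0 < Tw" by (simp add: Tw_def)
    obtain K1 h1 where h1: "0 < h1" and cov: "\<And>h z w. 0 < h \<Longrightarrow> h < h1 \<Longrightarrow> z \<in> E \<Longrightarrow> w \<in> E \<Longrightarrow> scaled_gap a h z w \<le> Tw \<Longrightarrow>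
      (\<exists>x y. norm x \<le> K1 \<and> norm y \<le> K1 \<and>
        (z = pole_chart a 1 h x \<and> w = pole_chart a (- 1) h y \<or>
         w = pole_chart a 1 h x \<and> z = pole_chart a (- 1) h y))"
      by (rule almost_diametral_pairs_in_window[OF diam capl capr curv \<eta> Tw]) (rule that)
    \<comment> \<open>The maximum of the window radius for the sample and the explicit radius for
      the limit, so that one set of cells serves both.\<close>
    define K where "K = max K1 (Tw / (1 - \<eta>) + sqrt (4 * a * (Tw / (1 - \<eta>))))"
    \<comment> \<open>The exact tuples will have entries in \<open>{0..real T + 2}\<close>; the
      reference vector is within \<delta> <= 1 of them, which accounts for the box.\<close>
    obtain \<delta>' where \<delta>': "0 < \<delta>'" and guni: "\<And>x y. (\<And>i. i < k \<Longrightarrow> x (Suc i) \<in> {- 1..real T + 3}) \<Longrightarrow>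
        (\<And>i. i < k \<Longrightarrow> y (Suc i) \<in> {- 1..real T + 3}) \<Longrightarrow>
        (\<And>i. i < k \<Longrightarrow> \<bar>x (Suc i) - y (Suc i)\<bar> \<le> \<delta>') \<Longrightarrow> \<bar>g (tuple k x) - g (tuple k y)\<bar> \<le> e"
      using continuous_map_Euclidean_space_uniform_on_box[OF g e(1)] by metis
    define \<delta> where "\<delta> = min \<delta>' 1"
    have \<delta>: "0 < \<delta>" "\<delta> \<le> 1" "\<delta> \<le> \<delta>'" using \<delta>' by (auto simp: \<delta>_def)
    have guni': "\<bar>g (tuple k x) - g (tuple k y)\<bar> \<le> e"
      if "\<And>i. i \<in> {1..k} \<Longrightarrow> x i \<in> {0..real T + 1 + \<delta>}" "\<And>i. i \<in> {1..k} \<Longrightarrow> \<bar>x i - y i\<bar> \<le> \<delta>" for x y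
    proof (rule guni)
      fix i assume "i < k"
      then have "x (Suc i) \<in> {0..real T + 1 + \<delta>}" "\<bar>x (Suc i) - y (Suc i)\<bar> \<le> \<delta>" using that[of "Suc i"] by auto
      then show "x (Suc i) \<in> {- 1..real T + 3}" "y (Suc i) \<in> {- 1..real T + 3}" "\<bar>x (Suc i) - y (Suc i)\<bar> \<le> \<delta>'"
        using \<delta> by (auto simp: abs_le_iff)
    qed
    \<comment> \<open>One \<open>\<delta> / 2\<close> is spent on the size of the cells, the other
      on replacing \<open>scaled_gap\<close> by \<open>gap\<close>.\<close>
    obtain \<rho> where \<rho>: "0 < \<rho>" and gapuni: "\<And>x y x' y' :: real \<times> (real ^ ('m :: {finite, linorder})). norm x \<le> K \<Longrightarrow> norm y \<le> K \<Longrightarrow> norm x' \<le> K \<Longrightarrow> norm y' \<le> K \<Longrightarrow>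
       dist x x' < \<rho> \<Longrightarrow> dist y y' < \<rho> \<Longrightarrow> \<bar>gap a x y - gap a x' y'\<bar> \<le> \<delta> / 2"
      using gap_uniform_on_cball[OF a, of "\<delta> / 2" K] \<delta>(1) by (metis half_gt_zero)
    obtain m and B :: "nat \<Rightarrow> (real \<times> (real ^ ('m :: {finite, linorder}))) set" and ctr where
      B: "\<And>j. j < m \<Longrightarrow> B j \<in> sets borel" and W: "(\<Union>j<m. B j) = cball 0 K" and
      disjB: "disjoint_family_on B {..<m}" and
      ctr: "\<And>j x. j < m \<Longrightarrow> x \<in> B j \<Longrightarrow> dist (ctr j) x < \<rho>" "\<And>j. j < m \<Longrightarrow> ctr j \<in> cball 0 K"
      using compact_cells[OF compact_cball \<rho>, of "0 :: real \<times> (real ^ ('m :: {finite, linorder}))" K] by metis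
    have BK: "norm x \<le> K" if "x \<in> B j" "j < m" for x j using that W by auto
    have Bbd: "bounded (B j)" if "j < m" for j using BK[OF _ that] by (rule boundedI)
    have gap_close: "\<bar>gap a u v - gap a (ctr j) (ctr l)\<bar> \<le> \<delta> / 2"
      if "j < m" "l < m" "u \<in> B j" "v \<in> B l" for j l u v
      using that ctr BK by (intro gapuni) (auto simp: dist_commute)
    obtain h2 where h2: "0 < h2" and sg: "\<And>h x y :: real \<times> (real ^ ('m :: {finite, linorder})). 0 < h \<Longrightarrow> h < h2 \<Longrightarrow> norm x \<le> K \<Longrightarrow> norm y \<le> K \<Longrightarrow>
       \<bar>scaled_gap a h (pole_chart a 1 h x) (pole_chart a (- 1) h y) - gap a x y\<bar> \<le> \<delta> / 2"
      using scaled_gap_near_gap[OF a, of "\<delta> / 2" K] \<delta>(1) by (metis half_gt_zero)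

    \<comment> \<open>Cell counts in the limit\<close>
    let ?J = "(UNIV :: bool set) \<times> {..<m}"
    define \<Lambda> where "\<Lambda> = (\<lambda>(s, j). (if s then pl else pr) * measure lborel (B j \<inter> (if s then ?Pl else ?Pr)))"
    let ?po = "\<lambda>c \<Lambda>. \<Prod>x\<in>?J. \<Lambda> x ^ c x / fact (c x) * exp (- \<Lambda> x)"
    have fin_em: "emeasure lborel (B j \<inter> S) < \<infinity>" if "j < m" for j and S :: "(real \<times> (real ^ ('m :: {finite, linorder}))) set"
      by (rule emeasure_bounded_finite[OF bounded_subset[OF Bbd[OF that] Int_lower1]])
    have emX: "emeasure ?\<mu>l (B j) < \<infinity>" and emY: "emeasure ?\<mu>r (B j) < \<infinity>" if "j < m" for j
      unfolding em_l[OF B[OF that]] em_r[OF B[OF that]] using fin_em[OF that] by (simp_all add: ennreal_mult_less_top)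
    have meX: "measure ?\<mu>l (B j) = \<Lambda> (True, j)" and meY: "measure ?\<mu>r (B j) = \<Lambda> (False, j)" if "j < m" for j
      unfolding measure_def em_l[OF B[OF that]] em_r[OF B[OF that]] using assms(14,16) by (simp_all add: \<Lambda>_def measure_def enn2real_mult)

    let ?cX = "\<lambda>\<omega> j. num_points (\<lambda>i. X i \<omega>) (B j)" and ?cY = "\<lambda>\<omega> j. num_points (\<lambda>i. Y i \<omega>) (B j)"
    define A' where "A' c = {\<omega> \<in> space M'. \<forall>j\<in>{..<m}. ?cX \<omega> j = enat (c (True, j)) \<and> ?cY \<omega> j = enat (c (False, j))}" for c
    have cXp: "Measurable.pred M' (\<lambda>\<omega>. ?cX \<omega> j = enat n)" and cYp: "Measurable.pred M' (\<lambda>\<omega>. ?cY \<omega> j = enat n)" if "j < m" for j n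
    proof -
      have "Measurable.pred M' (\<lambda>\<omega>. X i \<omega> \<in> B j)" "Measurable.pred M' (\<lambda>\<omega>. Y i \<omega> \<in> B j)" for i
        using B[OF that] by measurable
      then show "Measurable.pred M' (\<lambda>\<omega>. ?cX \<omega> j = enat n)" "Measurable.pred M' (\<lambda>\<omega>. ?cY \<omega> j = enat n)"
        by (simp_all add: pred_num_points_eq_enat)
    qed
    have A'_ev: "A' c \<in> M'.events" for c
      unfolding A'_def using cXp cYp by (intro sets.sets_Collect_finite_All sets.sets_Collect_conj) (auto simp: pred_def)
    have A'_prob: "M'.prob (A' c) = ?po c \<Lambda>" for c
    proof -
      have "M'.prob (A' c) =
        M'.prob {\<omega> \<in> space M'. \<forall>j\<in>{..<m}. ?cX \<omega> j = enat (c (True, j))} *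
        M'.prob {\<omega> \<in> space M'. \<forall>j\<in>{..<m}. ?cY \<omega> j = enat (c (False, j))}"
        unfolding A'_def using B by (intro M'.independent_point_processes_counts[OF XY]) auto
      also have "M'.prob {\<omega> \<in> space M'. \<forall>j\<in>{..<m}. ?cX \<omega> j = enat (c (True, j))} =
          (\<Prod>j\<in>{..<m}. measure ?\<mu>l (B j) ^ c (True, j) / fact (c (True, j)) * exp (- measure ?\<mu>l (B j)))"
        using B emX disjB by (intro M'.prob_poisson_process_counts[OF X]) auto
      also have "M'.prob {\<omega> \<in> space M'. \<forall>j\<in>{..<m}. ?cY \<omega> j = enat (c (False, j))} =
          (\<Prod>j\<in>{..<m}. measure ?\<mu>r (B j) ^ c (False, j) / fact (c (False, j)) * exp (- measure ?\<mu>r (B j)))"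
        using B emY disjB by (intro M'.prob_poisson_process_counts[OF Y]) auto
      also have "(\<Prod>j\<in>{..<m}. measure ?\<mu>l (B j) ^ c (True, j) / fact (c (True, j)) * exp (- measure ?\<mu>l (B j))) *
          (\<Prod>j\<in>{..<m}. measure ?\<mu>r (B j) ^ c (False, j) / fact (c (False, j)) * exp (- measure ?\<mu>r (B j))) = ?po c \<Lambda>"
      proof -
        have "?po c \<Lambda> = (\<Prod>s\<in>UNIV. \<Prod>j\<in>{..<m}. \<Lambda> (s, j) ^ c (s, j) / fact (c (s, j)) * exp (- \<Lambda> (s, j)))"
          unfolding prod.cartesian_product by (rule prod.cong) auto
        also have "\<dots> = (\<Prod>j\<in>{..<m}. \<Lambda> (True, j) ^ c (True, j) / fact (c (True, j)) * exp (- \<Lambda> (True, j))) *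
            (\<Prod>j\<in>{..<m}. \<Lambda> (False, j) ^ c (False, j) / fact (c (False, j)) * exp (- \<Lambda> (False, j)))"
          by (simp only: UNIV_bool) simp
        also have "\<dots> = (\<Prod>j\<in>{..<m}. measure ?\<mu>l (B j) ^ c (True, j) / fact (c (True, j)) * exp (- measure ?\<mu>l (B j))) *
          (\<Prod>j\<in>{..<m}. measure ?\<mu>r (B j) ^ c (False, j) / fact (c (False, j)) * exp (- measure ?\<mu>r (B j)))"
          by (intro arg_cong2[where f = "(*)"] prod.cong) (simp_all only: meX meY lessThan_iff)
        finally show ?thesis by (rule sym)
      qed
      finally show ?thesis .
    qed

    \<comment> \<open>Bounding all counts by \<open>L\<close> leaves finitely many count
      vectors.\<close>
    let ?few = "\<lambda>L \<omega>. \<forall>j\<in>{..<m}. (\<exists>n\<in>{..L}. ?cX \<omega> j = enat n) \<and> (\<exists>n\<in>{..L}. ?cY \<omega> j = enat n)"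
    have few_pred: "Measurable.pred M' (?few L)" for L
      using cXp cYp by (intro pred_intros_finite(3) pred_intros_logic(3) pred_intros_finite(4)) auto
    have "\<exists>L. 1 - e / 2 < M'.prob {\<omega> \<in> space M'. ?few L \<omega>}"
    proof (rule M'.prob_eventually_ge[OF few_pred])
      fix n n' :: nat and \<omega> assume "n \<le> n'" "?few n \<omega>"
      then show "?few n' \<omega>" by (meson atMost_iff order_trans)
    next
      have "AE \<omega> in M'. \<forall>j\<in>{..<m}. ?cX \<omega> j \<noteq> \<infinity> \<and> ?cY \<omega> j \<noteq> \<infinity>"
        using M'.AE_poisson_process_finite[OF X _ emX] M'.AE_poisson_process_finite[OF Y _ emY] B
        by (intro AE_finite_allI) auto
      then show "AE \<omega> in M'. \<exists>L. ?few L \<omega>"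
      proof eventually_elim
        case (elim \<omega>)
        then have "\<forall>j\<in>{..<m}. \<exists>n. ?cX \<omega> j = enat n" "\<forall>j\<in>{..<m}. \<exists>n. ?cY \<omega> j = enat n" by auto
        then obtain u v where uv: "\<forall>j\<in>{..<m}. ?cX \<omega> j = enat (u j)" "\<forall>j\<in>{..<m}. ?cY \<omega> j = enat (v j)"
          unfolding bchoice_iff by blast
        have "u j \<le> (\<Sum>j<m. u j + v j)" "v j \<le> (\<Sum>j<m. u j + v j)" if "j < m" for j
          using member_le_sum[of j "{..<m}" "\<lambda>j. u j + v j"] that by auto
        then show ?case using uv by (intro exI[of _ "\<Sum>j<m. u j + v j"]) auto
      qed
    next
      show "0 < e / 2" using e by simp
    qed
    then obtain L where L: "1 - e / 2 < M'.prob {\<omega> \<in> space M'. ?few L \<omega>}" by blast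
    \<comment> \<open>\<open>PiE\<close> fixes the values off the index set, so that
      \<open>F\<close> is finite and distinct members give disjoint events. The bound is taken at
      \<open>real T + 1\<close> because \<open>k\<close> pairs by time \<open>T\<close> are visible
      in the cells only by \<open>real T + \<delta>\<close>.\<close>
    define F where "F = {c \<in> PiE ?J (\<lambda>_. {..L}). k \<le> cell_pair_count a ctr m c (real T + 1)}"
    have finF: "finite F" unfolding F_def by (intro finite_subset[OF _ finite_PiE[of ?J "\<lambda>_. {..L}"]]) auto
    have F_eq: "c = c'" if "c \<in> F" "c' \<in> F" "\<And>s j. j < m \<Longrightarrow> c (s, j) = c' (s, j)" for c c'
      using that by (intro PiE_ext[of c ?J "\<lambda>_. {..L}" c']) (auto simp: F_def)
    have A'_disj: "disjoint_family_on A' F"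
    proof -
      have "c = c'" if "c \<in> F" "c' \<in> F" "\<omega> \<in> A' c" "\<omega> \<in> A' c'" for c c' \<omega>
      proof (rule F_eq[OF that(1,2)])
        fix s j assume "j < m"
        then show "c (s, j) = c' (s, j)" using that(3,4) by (cases s) (auto simp: A'_def)
      qed
      then show ?thesis unfolding disjoint_family_on_def by blast
    qed
    have lim_gap: "u \<in> (\<Union>j<m. B j) \<and> v \<in> (\<Union>j<m. B j)" if "u \<in> ?Pl" "v \<in> ?Pr" "gap a u v \<le> Tw" for u v
      using paraboloid_gap_bounds(2,3)[OF curv a \<eta> that] unfolding W K_def by (simp add: le_max_iff_disj)
    have gap_close': "\<bar>gap a u v - gap a (ctr j) (ctr l)\<bar> \<le> \<delta>"
      if "j < m" "l < m" "u \<in> B j" "v \<in> B l" for j l u v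
      using gap_close[OF that] \<delta>(1) by linarith
    have lim_gap0: "0 \<le> gap a u v" if "u \<in> ?Pl" "v \<in> ?Pr" for u v
      by (rule paraboloid_gap_bounds(1)[OF curv a \<eta> that])
    have \<delta>0: "0 \<le> \<delta>" using \<delta>(1) by simp
    have lim_cells: "s \<le> Tw \<Longrightarrow> enat i \<le> num_points (?G \<omega>) {0..s} \<Longrightarrow> i \<le> cell_pair_count a ctr m c (s + \<delta>)"
      "1 \<le> i \<Longrightarrow> s + \<delta> \<le> Tw \<Longrightarrow> i \<le> cell_pair_count a ctr m c s \<Longrightarrow> \<bar>?T' \<omega> i - cell_arrival a ctr m c i\<bar> \<le> \<delta>"
      "1 \<le> i \<Longrightarrow> s + \<delta> \<le> Tw \<Longrightarrow> i \<le> cell_pair_count a ctr m c s \<Longrightarrow> ?T' \<omega> i \<in> {0..s + \<delta>}"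
      if support: "(\<forall>p. X p \<omega> \<in> ?Pl) \<and> (\<forall>q. Y q \<omega> \<in> ?Pr)"
        and cc: "\<And>j. j < m \<Longrightarrow> ?cX \<omega> j = enat (c (True, j))" "\<And>j. j < m \<Longrightarrow> ?cY \<omega> j = enat (c (False, j))"
      for \<omega> c i s
    proof -
      have XP: "X p \<omega> \<in> ?Pl" and YP: "Y q \<omega> \<in> ?Pr" for p q using support by auto
      note * = limit_pairs_cells[where x = "\<lambda>p. X p \<omega>" and y = "\<lambda>q. Y q \<omega>" and Pl = ?Pl and Pr = ?Pr and Tw = Tw and B = B and c = c and ctr = ctr and \<delta> = \<delta> and m = m and a = a]
      show "i \<le> cell_pair_count a ctr m c (s + \<delta>)" if "s \<le> Tw" "enat i \<le> num_points (?G \<omega>) {0..s}"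
        by (rule *(1), fact XP, fact YP, fact lim_gap0, fact lim_gap, fact disjB, fact gap_close', fact cc(1), fact cc(2), fact \<delta>0, fact that(1), fact that(2))
      show "\<bar>?T' \<omega> i - cell_arrival a ctr m c i\<bar> \<le> \<delta>" if "1 \<le> i" "s + \<delta> \<le> Tw" "i \<le> cell_pair_count a ctr m c s"
        by (rule *(2), fact XP, fact YP, fact lim_gap0, fact lim_gap, fact disjB, fact gap_close', fact cc(1), fact cc(2), fact \<delta>0, fact that(1), fact that(2), fact that(3))
      show "?T' \<omega> i \<in> {0..s + \<delta>}" if "1 \<le> i" "s + \<delta> \<le> Tw" "i \<le> cell_pair_count a ctr m c s"
        by (rule *(3), fact XP, fact YP, fact lim_gap0, fact lim_gap, fact disjB, fact gap_close', fact cc(1), fact cc(2), fact \<delta>0, fact that(1), fact that(2), fact that(3))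
    qed
    have cpc_mono: "cell_pair_count a ctr m c t \<le> cell_pair_count a ctr m c t'" if "t \<le> t'" for c t t'
      unfolding cell_pair_count_def using that by (intro sum_mono) auto
    \<comment> \<open>On \<open>?early\<close> and \<open>?few\<close>, for almost every outcome,
      the actual vector of counts is a member of \<open>F\<close>.\<close>
    have A'_big: "1 - e \<le> (\<Sum>c\<in>F. M'.prob (A' c))"
    proof -
      let ?S = "{\<omega> \<in> space M'. ?early T \<omega>} \<inter> {\<omega> \<in> space M'. ?few L \<omega>}"
      have ev: "{\<omega> \<in> space M'. ?early T \<omega>} \<in> M'.events" "{\<omega> \<in> space M'. ?few L \<omega>} \<in> M'.events"
        using early_pred few_pred by (simp_all add: pred_def)
      have "1 - e \<le> M'.prob ?S"
        using M'.prob_Int_ge[OF ev] T L by linarith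
      also have "\<dots> \<le> M'.prob (\<Union>(A' ` F))"
      proof (rule M'.finite_measure_mono_AE)
        show "AE \<omega> in M'. \<omega> \<in> ?S \<longrightarrow> \<omega> \<in> \<Union>(A' ` F)"
          using gap_AE
        proof eventually_elim
          case (elim \<omega>)
          show ?case
          proof
            assume w: "\<omega> \<in> ?S"
            define c where "c = (\<lambda>(s, j)\<in>?J. the_enat (if s then ?cX \<omega> j else ?cY \<omega> j))"
            have few: "?few L \<omega>" using w by blast
            have c: "?cX \<omega> j = enat (c (True, j))" "?cY \<omega> j = enat (c (False, j))" and cL: "c (s, j) \<le> L" if "j < m" for s j
            proof -
              obtain n n' where "?cX \<omega> j = enat n" "n \<le> L" "?cY \<omega> j = enat n'" "n' \<le> L" using few \<open>j < m\<close> by blast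
              then show "?cX \<omega> j = enat (c (True, j))" "?cY \<omega> j = enat (c (False, j))" "c (s, j) \<le> L"
                using \<open>j < m\<close> by (simp_all add: c_def)
            qed
            have "enat k \<le> num_points (?G \<omega>) {0..real T}" "real T \<le> Tw" using w by (auto simp: Tw_def)
            then have "k \<le> cell_pair_count a ctr m c (real T + \<delta>)"
              using lim_cells(1)[OF elim c] by blast
            also have "\<dots> \<le> cell_pair_count a ctr m c (real T + 1)" using \<delta> by (intro cpc_mono) simp
            finally have "c \<in> F" using cL unfolding F_def by (auto simp: PiE_iff c_def)
            moreover have "\<omega> \<in> A' c" using w c by (simp add: A'_def)
            ultimately show "\<omega> \<in> \<Union>(A' ` F)" by blast
          qed
        qed
      qed (use finF A'_ev in auto)
      also have "\<dots> = (\<Sum>c\<in>F. M'.prob (A' c))"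
        using finF A'_ev A'_disj by (intro M'.finite_measure_finite_Union) auto
      finally show ?thesis .
    qed
    have b1: "real T + 1 + \<delta> \<le> Tw" using \<delta> by (simp add: Tw_def)
    have close': "AE \<omega> in M'. \<forall>c\<in>F. \<omega> \<in> A' c \<longrightarrow> \<bar>g (tuple k (?T' \<omega>)) - g (tuple k (cell_arrival a ctr m c))\<bar> \<le> e"
      using gap_AE
    proof eventually_elim
      case (elim \<omega>)
      show ?case
      proof (intro ballI impI)
        fix c assume c: "c \<in> F" "\<omega> \<in> A' c"
        have cc: "?cX \<omega> j = enat (c (True, j))" "?cY \<omega> j = enat (c (False, j))" if "j < m" for j
          using c(2) that by (auto simp: A'_def)
        have kc: "i \<le> cell_pair_count a ctr m c (real T + 1)" if "i \<in> {1..k}" for i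
          using c(1) that by (auto simp: F_def)
        show "\<bar>g (tuple k (?T' \<omega>)) - g (tuple k (cell_arrival a ctr m c))\<bar> \<le> e"
        proof (rule guni')
          fix i assume i: "i \<in> {1..k}"
          show "?T' \<omega> i \<in> {0..real T + 1 + \<delta>}"
            using lim_cells(3)[OF elim cc _ b1 kc[OF i]] i by simp
          show "\<bar>?T' \<omega> i - cell_arrival a ctr m c i\<bar> \<le> \<delta>"
            using lim_cells(2)[OF elim cc _ b1 kc[OF i]] i by simp
        qed
      qed
    qed

    \<comment> \<open>Cell counts of the Poissonized sample\<close>
    let ?S = "\<lambda>n (s, j). pole_chart a (if s then 1 else - 1) (h n) ` B j"
    define A where "A n c = {\<omega> \<in> space M. \<forall>x\<in>?J. card {i. i < N n \<omega> \<and> Z i \<omega> \<in> ?S n x} = c x}" for n c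
    have "eventually (\<lambda>n. h n < min h1 h2) sequentially"
      using h_lim h1 h2 by (intro order_tendstoD(2)) auto
    moreover have "(\<lambda>n. (h n)\<^sup>2 * K) \<longlonglongrightarrow> 0\<^sup>2 * K" by (intro tendsto_intros h_lim)
    then have "eventually (\<lambda>n. (h n)\<^sup>2 * K < a) sequentially"
      using a by (intro order_tendstoD(2)) auto
    ultimately have "eventually (\<lambda>n. 1 \<le> n \<and> h n < h1 \<and> h n < h2 \<and> (h n)\<^sup>2 * K < a) sequentially"
      using eventually_ge_at_top[of 1] by eventually_elim simp
    then obtain n0 where n0: "\<And>n. n0 \<le> n \<Longrightarrow> 1 \<le> n \<and> h n < h1 \<and> h n < h2 \<and> (h n)\<^sup>2 * K < a"
      by (auto simp: eventually_sequentially)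
    let ?\<nu> = "\<lambda>n x. \<integral>z. indicator (?S n x) z * ?g z \<partial>lborel"
    have S_borel: "?S n x \<in> sets borel" if "1 \<le> n" "x \<in> ?J" for n x
      using that pole_chart_image_borel[OF hpos[OF that(1)] _ B] by (cases x) auto
    have Nm: "N n \<in> measurable M (count_space UNIV)" if "1 \<le> n" for n
      using assms(21)[OF that] by (simp add: independent_rvs_def)
    have Zm: "Z i \<in> borel_measurable M" for i
      using distributed_measurable[OF assms(19)] by simp
    have A_ev: "A n c \<in> M.events" if "1 \<le> n" for n c
    proof -
      have "Measurable.pred M (\<lambda>\<omega>. card {i. i < N n \<omega> \<and> Z i \<omega> \<in> ?S n x} = c x)" if x: "x \<in> ?J" for x
      proof -
        have eq: "card {i. i < N n \<omega> \<and> Z i \<omega> \<in> ?S n x} = c x \<longleftrightarrow>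
            (\<exists>q. N n \<omega> = q \<and> (\<Sum>i<q. indicator (?S n x) (Z i \<omega>)) = c x)" for \<omega>
          by (simp add: indicator_def sum.If_cases Int_def)
        note [measurable] = Nm[OF \<open>1 \<le> n\<close>] S_borel[OF \<open>1 \<le> n\<close> x] Zm
        show ?thesis unfolding eq by measurable
      qed
      then show ?thesis unfolding A_def by (intro sets.sets_Collect_finite_All) (auto simp: pred_def)
    qed
    have A_prob: "M.prob (A n c) = ?po c (\<lambda>x. real n * ?\<nu> n x)" if n: "n0 \<le> n" for n c
    proof -
      have n1: "1 \<le> n" "(h n)\<^sup>2 * K < a" using n0[OF n] by auto
      \<comment> \<open>The sign of the first coordinate reveals the pole, so images of cells at
        different poles are disjoint; at the same pole injectivity of the chart is enough.\<close>
      have sgn: "(if s then 1 else - 1) * fst (pole_chart a (if s then 1 else - 1) (h n) x) < 0"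
        if "x \<in> B j" "j < m" for s x j
      proof -
        have "fst x \<le> K" using BK[OF that] norm_fst_le[of "fst x" "snd x"] by simp
        then have "(h n)\<^sup>2 * fst x \<le> (h n)\<^sup>2 * K" by (intro mult_left_mono) auto
        then show ?thesis using n1(2) by (simp add: pole_chart_def)
      qed
      have "disjoint_family_on (?S n) ?J"
      proof -
        have "x = x'" if x: "x \<in> ?J" "x' \<in> ?J" "z \<in> ?S n x" "z \<in> ?S n x'" for x x' z
        proof -
          obtain s j s' j' where xx: "x = (s, j)" "x' = (s', j')" by (cases x; cases x')
          obtain u u' where u: "u \<in> B j" "z = pole_chart a (if s then 1 else - 1) (h n) u"
            and u': "u' \<in> B j'" "z = pole_chart a (if s' then 1 else - 1) (h n) u'"
            using x by (auto simp: xx)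
          have jm: "j < m" "j' < m" using x by (auto simp: xx)
          have s: "s = s'"
            using sgn[OF u(1) jm(1), of s] sgn[OF u'(1) jm(2), of s'] unfolding u(2)[symmetric] u'(2)[symmetric]
            by (cases s; cases s') auto
          have "u = u'"
            using u(2) u'(2) pole_chart_inject[OF hpos[OF n1(1)], of "if s then 1 else - 1" a u u'] unfolding s by auto
          then have "j = j'" using u(1) u'(1) jm disjB by (auto simp: disjoint_family_on_def)
          with s show ?thesis by (simp add: xx)
        qed
        then show ?thesis unfolding disjoint_family_on_def by blast
      qed
      moreover have "M.prob {\<omega> \<in> space M. Z i \<omega> \<in> ?S n x} = ?\<nu> n x" if "x \<in> ?J" for i x
        by (rule M.prob_distributed_eq_integral(2)[OF assms(19) g0 S_borel[OF n1(1) that]])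
      ultimately show ?thesis
        unfolding A_def using n1(1) S_borel[OF n1(1)]
        by (intro M.prob_poisson_counts[OF assms(18) _ _ _ _ _ assms(20)[OF n1(1)] assms(21)[OF n1(1)]]) auto
    qed
    have \<nu>_lim: "(\<lambda>n. real n * ?\<nu> n x) \<longlonglongrightarrow> \<Lambda> x" if "x \<in> ?J" for x
    proof -
      obtain s j where x: "x = (s, j)" "j < m" using \<open>x \<in> ?J\<close> by auto
      have contl: "continuous (at (- 1 * a, 0) within E) f" and contr: "continuous (at (- (- 1) * a, 0) within E) f"
        using assms(11,12) by (simp_all add: left_pole_def right_pole_def)
      have "(\<lambda>n. real n * (\<integral>z. indicator (pole_chart a 1 (h n) ` B j) z * ?g z \<partial>lborel)) \<longlonglongrightarrow> f (- 1 * a, 0) * measure lborel (B j \<inter> ?Pl)"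
        unfolding h_def using Bbd B x(2) by (intro intensity_near_pole_tendsto[OF capl _ contl assms(9) gm]) auto
      moreover have "(\<lambda>n. real n * (\<integral>z. indicator (pole_chart a (- 1) (h n) ` B j) z * ?g z \<partial>lborel)) \<longlonglongrightarrow> f (- (- 1) * a, 0) * measure lborel (B j \<inter> ?Pr)"
        unfolding h_def using Bbd B x(2) by (intro intensity_near_pole_tendsto[OF capr _ contr assms(9) gm]) auto
      ultimately show ?thesis
        using assms(13,15) by (cases s) (simp_all add: x(1) \<Lambda>_def left_pole_def right_pole_def)
    qed
    \<comment> \<open>Both probabilities are the same finite product of Poisson weights, which is
      continuous in the means.\<close>
    have A_lim: "(\<lambda>n. M.prob (A n c)) \<longlonglongrightarrow> M'.prob (A' c)" for c
    proof -
      have "(\<lambda>n. ?po c (\<lambda>x. real n * ?\<nu> n x)) \<longlonglongrightarrow> ?po c \<Lambda>"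
        by (intro tendsto_intros \<nu>_lim) auto
      moreover have "eventually (\<lambda>n. ?po c (\<lambda>x. real n * ?\<nu> n x) = M.prob (A n c)) sequentially"
        by (rule eventually_mono[OF eventually_ge_at_top[of n0]]) (rule A_prob[symmetric])
      ultimately show ?thesis unfolding A'_prob by (rule Lim_transform_eventually)
    qed
    have A_disj: "disjoint_family_on (A n) F" for n
    proof -
      have "c = c'" if "c \<in> F" "c' \<in> F" "\<omega> \<in> A n c" "\<omega> \<in> A n c'" for c c' \<omega>
        using that(3,4) by (intro F_eq[OF that(1,2)]) (auto simp: A_def)
      then show ?thesis unfolding disjoint_family_on_def by blast
    qed
    have close: "AE \<omega> in M. \<forall>c\<in>F. \<omega> \<in> A n c \<longrightarrow> \<bar>g (tuple k (?T n \<omega>)) - g (tuple k (cell_arrival a ctr m c))\<bar> \<le> e"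
      if n: "n0 \<le> n" for n
      using Z_AE AE_space
    proof eventually_elim
      case (elim \<omega>)
      have n1: "1 \<le> n" "h n < h1" "h n < h2" "(h n)\<^sup>2 * K < a" using n0[OF n] by auto
      note hn = hpos[OF n1(1)]
      have cov': "\<exists>x y. norm x \<le> K \<and> norm y \<le> K \<and>
        (u = pole_chart a 1 (h n) x \<and> v = pole_chart a (- 1) (h n) y \<or>
         v = pole_chart a 1 (h n) x \<and> u = pole_chart a (- 1) (h n) y)"
        if "u \<in> E" "v \<in> E" "scaled_gap a (h n) u v \<le> Tw" for u v
      proof -
        note ex = cov[OF hn n1(2) that]
        obtain x y where xy: "norm x \<le> K1" "norm y \<le> K1"
          "u = pole_chart a 1 (h n) x \<and> v = pole_chart a (- 1) (h n) y \<or>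
           v = pole_chart a 1 (h n) x \<and> u = pole_chart a (- 1) (h n) y"
          using ex by blast
        have "K1 \<le> K" by (simp add: K_def)
        then have "norm x \<le> K" "norm y \<le> K" using xy(1,2) by linarith+
        with xy(3) show ?thesis by (intro exI[of _ x] exI[of _ y] conjI)
      qed
      have sg_close: "\<bar>scaled_gap a (h n) (pole_chart a 1 (h n) u) (pole_chart a (- 1) (h n) v) - gap a (ctr j) (ctr l)\<bar> \<le> \<delta>"
        if "j < m" "l < m" "u \<in> B j" "v \<in> B l" for j l u v
        using gap_close[OF that] sg[OF hn n1(3) BK[OF that(3,1)] BK[OF that(4,2)]] by linarith
      show ?case
      proof (intro ballI impI)
        fix c assume c: "c \<in> F" "\<omega> \<in> A n c"
        have cc: "card {p. p < N n \<omega> \<and> Z p \<omega> \<in> pole_chart a (if s then 1 else - 1) (h n) ` B j} = c (s, j)" if "j < m" for s j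
          using c(2) that by (auto simp: A_def)
        have kc: "k \<le> cell_pair_count a ctr m c (real T + 1)" using c(1) by (simp add: F_def)
        have ZE: "Z p \<omega> \<in> E" for p using elim by blast
        note * = sample_pairs_cells[where z = "\<lambda>p. Z p \<omega>" and n = "N n \<omega>" and c = c and E = E and a = a and h = "h n"
            and K = K and m = m and B = B and Tw = Tw and ctr = ctr and \<delta> = \<delta> and b = "real T + 1" and k = k]
        have smp1: "k \<le> size (pair_distances (\<lambda>p. Z p \<omega>) (N n \<omega>))"
          by (rule *(1), fact ZE, fact le_diam, fact hn, fact n1(4), fact W, fact disjB, fact cov', fact sg_close, fact cc, fact \<delta>0, fact b1, fact kc)
        have smp2: "\<bar>(2 * a - ith_largest i (pair_distances (\<lambda>p. Z p \<omega>) (N n \<omega>))) / (h n)\<^sup>2 - cell_arrival a ctr m c i\<bar> \<le> \<delta>"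
          if "i \<in> {1..k}" for i
          by (rule *(2), fact ZE, fact le_diam, fact hn, fact n1(4), fact W, fact disjB, fact cov', fact sg_close, fact cc, fact \<delta>0, fact b1, fact kc, fact that)
        have smp3: "(2 * a - ith_largest i (pair_distances (\<lambda>p. Z p \<omega>) (N n \<omega>))) / (h n)\<^sup>2 \<in> {0..real T + 1 + \<delta>}"
          if "i \<in> {1..k}" for i
          by (rule *(3), fact ZE, fact le_diam, fact hn, fact n1(4), fact W, fact disjB, fact cov', fact sg_close, fact cc, fact \<delta>0, fact b1, fact kc, fact that)
        have Di: "?T n \<omega> i = (2 * a - ith_largest i (pair_distances (\<lambda>p. Z p \<omega>) (N n \<omega>))) / (h n)\<^sup>2"
          if "i \<in> {1..k}" for i
          unfolding scale[OF n1(1)] assms(23)[OF n1(1) that elim(2) smp1] ..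
        show "\<bar>g (tuple k (?T n \<omega>)) - g (tuple k (cell_arrival a ctr m c))\<bar> \<le> e"
        proof (rule guni')
          fix i assume i: "i \<in> {1..k}"
          show "?T n \<omega> i \<in> {0..real T + 1 + \<delta>}" unfolding Di[OF i] by (rule smp3[OF i])
          show "\<bar>?T n \<omega> i - cell_arrival a ctr m c i\<bar> \<le> \<delta>" unfolding Di[OF i] by (rule smp2[OF i])
        qed
      qed
    qed

    \<comment> \<open>Comparison of the two expectations\<close>
    let ?\<gamma> = "\<lambda>c. g (tuple k (cell_arrival a ctr m c))"
    have appr': "\<bar>M'.expectation (\<lambda>\<omega>. g (tuple k (?T' \<omega>))) - (\<Sum>c\<in>F. ?\<gamma> c * M'.prob (A' c))\<bar> \<le> \<epsilon>"
    proof -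
      have "\<bar>M'.expectation (\<lambda>\<omega>. g (tuple k (?T' \<omega>))) - (\<Sum>c\<in>F. ?\<gamma> c * M'.prob (A' c))\<bar>
          \<le> e + b * (1 - (\<Sum>c\<in>F. M'.prob (A' c)))"
        using b e by (intro M'.expectation_approx_on_events[OF finF A'_ev A'_disj gT' _ close'] b(2) tuple_in_topspace) auto
      also have "\<dots> \<le> e + b * (2 * e)"
        using A'_big b(1) e(1) by (intro add_left_mono mult_left_mono) auto
      finally show ?thesis using e(2) by simp
    qed
    \<comment> \<open>Tightness of the sample comes from the limit: the finitely many retained
      events have total limiting mass at least \<open>1 - e\<close>, so their mass eventually
      exceeds \<open>1 - 2 * e\<close>.\<close>
    have "(\<lambda>n. \<Sum>c\<in>F. M.prob (A n c)) \<longlonglongrightarrow> (\<Sum>c\<in>F. M'.prob (A' c))" by (intro tendsto_sum A_lim)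
    then have "eventually (\<lambda>n. 1 - 2 * e < (\<Sum>c\<in>F. M.prob (A n c))) sequentially"
      using A'_big e(1) by (intro order_tendstoD(1)) auto
    then have appr: "eventually (\<lambda>n. \<bar>M.expectation (\<lambda>\<omega>. g (tuple k (?T n \<omega>))) - (\<Sum>c\<in>F. ?\<gamma> c * M.prob (A n c))\<bar> \<le> \<epsilon>) sequentially"
      using eventually_ge_at_top[of n0]
    proof eventually_elim
      case (elim n)
      have "1 \<le> n" using n0[OF elim(2)] by simp
      then have "\<bar>M.expectation (\<lambda>\<omega>. g (tuple k (?T n \<omega>))) - (\<Sum>c\<in>F. ?\<gamma> c * M.prob (A n c))\<bar>
          \<le> e + b * (1 - (\<Sum>c\<in>F. M.prob (A n c)))"
        using b e by (intro M.expectation_approx_on_events[OF finF A_ev A_disj gT _ close[OF elim(2)]] b(2) tuple_in_topspace) auto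
      also have "\<dots> \<le> e + b * (2 * e)"
        using elim(1) b(1) by (intro add_left_mono mult_left_mono) auto
      finally show ?case using e(2) by simp
    qed
    have "(\<lambda>n. \<Sum>c\<in>F. ?\<gamma> c * M.prob (A n c)) \<longlonglongrightarrow> (\<Sum>c\<in>F. ?\<gamma> c * M'.prob (A' c))"
      by (intro tendsto_sum tendsto_mult tendsto_const A_lim)
    with appr appr' show "\<exists>s l. s \<longlonglongrightarrow> l \<and>
        eventually (\<lambda>n. \<bar>M.expectation (\<lambda>\<omega>. g (tuple k (?T n \<omega>))) - s n\<bar> \<le> \<epsilon>) sequentially \<and>
        \<bar>M'.expectation (\<lambda>\<omega>. g (tuple k (?T' \<omega>))) - l\<bar> \<le> \<epsilon>"
      by blast
  qed
  show ?thesis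
    unfolding converges_in_distribution_def using re re' conv by blast
qed

end
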